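(* Let $\Gamma$ be a group. The categories $\Gamma\mathbf{GrIS}$ (of $\Gamma$-graded-Boolean inverse $\wedge$-semigroups) and $\Gamma\mathbf{GrGp}$ (of $\Gamma$-graded Hausdorff ample groupoids) are dually equivalent, via the following contravariant functors and natural isomorphisms. (a) $\mathsf{S}^{\mathrm{gr}}:\Gamma\mathbf{GrGp}\to\Gamma\mathbf{GrIS}$, sending an object $\mathcal{G}$ to $\mathsf{S}^{\mathrm{gr}}(\mathcal{G})$ and a morphism $\phi:\mathcal{G}\to\mathcal{H}$ to $\phi^{-1}:\mathsf{S}^{\mathrm{gr}}(\mathcal{H})\to\mathsf{S}^{\mathrm{gr}}(\mathcal{G})$, $X\mapsto\phi^{-1}(X)$. (b) $\mathsf{G}:\Gamma\mathbf{GrIS}\to\Gamma\mathbf{GrGp}$, sending an object $S$ to $\mathsf{G}(S)$ and a morphism $\phi:S\to T$ to the partial functor $\phi':\mathsf{G}(T)\to\mathsf{G}(S)$ with domain $\{X\in\mathsf{G}(T)\mid\phi^{-1}(X)\in\mathsf{G}(S)\}$, given by $\phi'(X)=\phi^{-1}(X)$. (c) The natural isomorphism $\mu:1_{\Gamma\mathbf{GrGp}}\to\mathsf{G}\mathsf{S}^{\mathrm{gr}}$ with components $\mu_{\mathcal{G}}:\mathcal{G}\to\mathsf{G}(\mathsf{S}^{\mathrm{gr}}(\mathcal{G}))$, $x\mapsto\{Y\in\mathsf{S}^{\mathrm{gr}}(\mathcal{G})\mid x\in Y\}$. (d) The natural isomorphism $\nu:1_{\Gamma\mathbf{GrIS}}\to\mathsf{S}^{\mathrm{gr}}\mathsf{G}$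 with components $\nu_S:S\to\mathsf{S}^{\mathrm{gr}}(\mathsf{G}(S))$, $s\mapsto\{Y\in\mathsf{G}(S)\mid s\in Y\}$.
   Context: Semigroups. All semigroups have a zero element $0$. For an inverse semigroup $S$, $E(S)$ is its set of idempotents, and $\le$ is the natural partial order: $s\le t$ iff $s=tu$ for some $u\in E(S)$. Meets and joins are taken with respect to $\le$. $S$ is an inverse $\wedge$-semigroup if every pair of elements has a meet. Elements $s,t$ are orthogonal if $s^{-1}t=0=st^{-1}$. Gradings. Let $\Gamma$ be a group with identity $\varepsilon$. A semigroup $S$ is $\Gamma$-graded if it is equipped with a map $\deg:S\setminus\{0\}\to\Gamma$ with $\deg(st)=\deg(s)\deg(t)$ whenever $st\ne0$; put $S_\alpha=\deg^{-1}(\alpha)\cup\{0\}$. A homomorphism $\phi:S\to T$ of $\Gamma$-graded semigroups is graded if $\phi(S_\alpha)\subseteq T_\alpha$ for all $\alpha\in\Gamma$. A $\Gamma$-graded inverse semigroup $S$ is $\Gamma$-graded-Boolean if (1) for all $\alpha\in\Gamma$, every orthogonal pair $s,t\in S_\alpha$ has a join in $S$, and (2) $E(S)$ is a distributive lattice and each nonzero principal order ideal $\{e\}^{\downarrow}=\{f\in E(S)\mid f\le e\}$ of $E(S)$ is a Boolean algebra. Category $\Gamma\mathbf{GrIS}$. Objects: $\Gamma$-graded-Boolean inverse $\wedge$-semigroups. Morphisms: graded homomorphisms $S\to T$ of inverse semigroups that preserve meets of pairs and restrict to lattice homomorphisms $E(S)\to E(T)$ preserving complements in principal order ideals (if $e\le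 f$ in $E(S)$, the complement of $e$ in $\{f\}^{\downarrow}$ is sent to the complement of $\phi(e)$ in $\{\phi(f)\}^{\downarrow}$; in particular $\phi(0)=0$). Groupoids. A groupoid $\mathcal{G}$ is a small category with all morphisms invertible, identified with its set of morphisms; objects are identified with identity morphisms and form the unit space $\mathcal{G}^{(0)}$. $\mathbf{d}(x)=x^{-1}x$, $\mathbf{r}(x)=xx^{-1}$; $xy$ is defined iff $\mathbf{d}(x)=\mathbf{r}(y)$. A topological groupoid has a topology making inversion and composition continuous; it is étale if $\mathbf{d}:\mathcal{G}\to\mathcal{G}^{(0)}$ is a local homeomorphism. A slice is an open subset on which $\mathbf{d}$ and $\mathbf{r}$ are injective. An étale groupoid is ample if its compact slices form a base for its topology and $\mathcal{G}^{(0)}$ is Hausdorff. $\mathcal{G}$ is $\Gamma$-graded if equipped with a continuous functor $\deg:\mathcal{G}\to\Gamma$ ($\Gamma$ discrete); $\mathcal{G}_\alpha=\deg^{-1}(\alpha)$. Category $\Gamma\mathbf{GrGp}$. Objects: $\Gamma$-graded Hausdorff ample groupoids. Morphisms $\mathcal{G}\to\mathcal{H}$: graded proper covering partial functors. A partial functor is a functor $\phi:\mathcal{G}'\to\mathcal{H}$ where $\mathcal{G}'$ (its domain) is an open (possibly empty) subgroupoid of $\mathcal{G}$ (a subcategory closed under inverses, with open set of morphisms). It is covering if star-injective ($\phi(x)=\phi(y)$ and $\mathbf{d}(x)=\mathbf{d}(y)$ imply $x=y$) and star-surjective (if $e\in\mathcal{G}'$ is an identity morphism and $\mathbf{d}(y)=\phi(e)$,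 then there is $x\in\mathcal{G}'$ with $\mathbf{d}(x)=e$ and $\phi(x)=y$); proper if continuous and inverse images of compact subsets of $\mathcal{H}$ are compact; graded if $\phi(\mathcal{G}_\alpha\cap\mathcal{G}')\subseteq\mathcal{H}_\alpha$ for all $\alpha$. The composite $\psi\circ\phi$ of partial functors has domain $\phi^{-1}(\text{domain of }\psi)$. The semigroup $\mathsf{S}^{\mathrm{gr}}(\mathcal{G})$. For a $\Gamma$-graded ample groupoid $\mathcal{G}$, $\mathsf{S}^{\mathrm{gr}}(\mathcal{G})$ is the set of homogeneous compact slices $X$ of $\mathcal{G}$ (homogeneous: $X\subseteq\mathcal{G}_\alpha$ for some $\alpha$), an inverse semigroup under $XY=\{xy\mid x\in X,y\in Y,\mathbf{d}(x)=\mathbf{r}(y)\}$ and $X^{-1}=\{x^{-1}\mid x\in X\}$, with zero $\emptyset$, graded by $\deg(X)=\alpha$ if $\emptyset\neq X\subseteq\mathcal{G}_\alpha$. The groupoid $\mathsf{G}(S)$. A filter on a poset $P$ with bottom $0$ is a nonempty subset $Y$ with $0\notin Y$, upward closed, and downward directed (for $x,y\in Y$ there is $z\in Y$ with $z\le x$, $z\le y$). An ultrafilter is a maximal filter. For an inverse semigroup $S$, $\mathsf{G}(S)$ is the set of ultrafilters on $(S,\le)$, a groupoid with $X^{-1}=\{x^{-1}\mid x\in X\}$ and $X\cdot Y=\{s\in S\mid xy\le s\text{ for some }x\in X,y\in Y\}$, defined iff $X^{-1}\cdot X=Y\cdot Y^{-1}$. For $S$ a $\Gamma$-graded inverse $\wedge$-semigroup,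 $\mathsf{G}(S)$ has the topology with base the sets $\{Y\in\mathsf{G}(S)\mid s\in Y\}$, $s\in S$, and the grading $\deg(X)=\deg(x)$ for any $x\in X$. *)

theory Defs
  imports "HOL-Analysis.Analysis" "HOL-Algebra.Group" "HOL-Algebra.Lattice"
begin

section \<open>Order-theoretic notions\<close>

definition distributive_lattice :: "('a, 'b) gorder_scheme \<Rightarrow> bool" where
  "distributive_lattice L \<longleftrightarrow> lattice L \<and>
    (\<forall>x\<in>carrier L. \<forall>y\<in>carrier L. \<forall>z\<in>carrier L.
      x \<sqinter>\<^bsub>L\<^esub> (y \<squnion>\<^bsub>L\<^esub> z) = (x \<sqinter>\<^bsub>L\<^esub> y) \<squnion>\<^bsub>L\<^esub> (x \<sqinter>\<^bsub>L\<^esub> z))"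

definition complement_in :: "('a, 'b) gorder_scheme \<Rightarrow> 'a \<Rightarrow> 'a \<Rightarrow> bool" where
  "complement_in L x y \<longleftrightarrow> x \<in> carrier L \<and> y \<in> carrier L \<and>
    x \<sqinter>\<^bsub>L\<^esub> y = \<bottom>\<^bsub>L\<^esub> \<and> x \<squnion>\<^bsub>L\<^esub> y = \<top>\<^bsub>L\<^esub>"

definition boolean_lattice :: "('a, 'b) gorder_scheme \<Rightarrow> bool" where
  "boolean_lattice L \<longleftrightarrow> bounded_lattice L \<and> distributive_lattice L \<and>
    (\<forall>x\<in>carrier L. \<exists>y. complement_in L x y)"

definition order_filter :: "('a, 'b) gorder_scheme \<Rightarrow> 'a set \<Rightarrow> bool" where
  "order_filter P Y \<longleftrightarrow> Y \<subseteq> carrier P \<and> Y \<noteq> {} \<and> \<bottom>\<^bsub>P\<^esub> \<notin> Y \<and>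
    (\<forall>x\<in>Y. \<forall>y\<in>carrier P. x \<sqsubseteq>\<^bsub>P\<^esub> y \<longrightarrow> y \<in> Y) \<and>
    (\<forall>x\<in>Y. \<forall>y\<in>Y. \<exists>z\<in>Y. z \<sqsubseteq>\<^bsub>P\<^esub> x \<and> z \<sqsubseteq>\<^bsub>P\<^esub> y)"

definition ultrafilter_on :: "('a, 'b) gorder_scheme \<Rightarrow> 'a set \<Rightarrow> bool" where
  "ultrafilter_on P Y \<longleftrightarrow> order_filter P Y \<and> (\<forall>Z. order_filter P Z \<and> Y \<subseteq> Z \<longrightarrow> Z = Y)"


section \<open>Graded inverse semigroups with zero\<close>

text \<open>The value of \<open>sdeg\<close> at \<open>szero\<close> is irrelevant.\<close>

record ('s, 'c) graded_semigroup = "'s partial_object" +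
  smult :: "'s \<Rightarrow> 's \<Rightarrow> 's" (infixl \<open>\<cdot>\<index>\<close> 70)
  szero :: 's
  sdeg :: "'s \<Rightarrow> 'c"

definition semigroup_with_zero :: "('s, 'c) graded_semigroup \<Rightarrow> bool" where
  "semigroup_with_zero S \<longleftrightarrow>
    (\<forall>x\<in>carrier S. \<forall>y\<in>carrier S. x \<cdot>\<^bsub>S\<^esub> y \<in> carrier S) \<and>
    (\<forall>x\<in>carrier S. \<forall>y\<in>carrier S. \<forall>z\<in>carrier S.
      (x \<cdot>\<^bsub>S\<^esub> y) \<cdot>\<^bsub>S\<^esub> z = x \<cdot>\<^bsub>S\<^esub> (y \<cdot>\<^bsub>S\<^esub> z)) \<and>
    szero S \<in> carrier S \<and>
    (\<forall>x\<in>carrier S. szero S \<cdot>\<^bsub>S\<^esub> x = szero S \<and> x \<cdot>\<^bsub>S\<^esub> szero S = szero S)"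

definition is_sinv :: "('s, 'c) graded_semigroup \<Rightarrow> 's \<Rightarrow> 's \<Rightarrow> bool" where
  "is_sinv S s t \<longleftrightarrow> t \<in> carrier S \<and> s \<cdot>\<^bsub>S\<^esub> t \<cdot>\<^bsub>S\<^esub> s = s \<and> t \<cdot>\<^bsub>S\<^esub> s \<cdot>\<^bsub>S\<^esub> t = t"

definition inverse_semigroup :: "('s, 'c) graded_semigroup \<Rightarrow> bool" where
  "inverse_semigroup S \<longleftrightarrow> semigroup_with_zero S \<and> (\<forall>s\<in>carrier S. \<exists>!t. is_sinv S s t)"

definition sinv :: "('s, 'c) graded_semigroup \<Rightarrow> 's \<Rightarrow> 's" where
  "sinv S s = (THE t. is_sinv S s t)"

definition idempotents :: "('s, 'c) graded_semigroup \<Rightarrow> 's set" where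
  "idempotents S = {e \<in> carrier S. e \<cdot>\<^bsub>S\<^esub> e = e}"

definition nat_order :: "('s, 'c) graded_semigroup \<Rightarrow> 's gorder" where
  "nat_order S =
    \<lparr>carrier = carrier S, eq = (=), le = (\<lambda>s t. \<exists>u\<in>idempotents S. s = t \<cdot>\<^bsub>S\<^esub> u)\<rparr>"

definition idem_order :: "('s, 'c) graded_semigroup \<Rightarrow> 's gorder" where
  "idem_order S = (nat_order S)\<lparr>carrier := idempotents S\<rparr>"

definition idem_ideal :: "('s, 'c) graded_semigroup \<Rightarrow> 's \<Rightarrow> 's gorder" where
  "idem_ideal S e =
    (idem_order S)\<lparr>carrier := {f \<in> idempotents S. f \<sqsubseteq>\<^bsub>nat_order S\<^esub> e}\<rparr>"

definition orthogonal_in :: "('s, 'c) graded_semigroup \<Rightarrow> 's \<Rightarrow> 's \<Rightarrow> bool" where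
  "orthogonal_in S s t \<longleftrightarrow>
    sinv S s \<cdot>\<^bsub>S\<^esub> t = szero S \<and> s \<cdot>\<^bsub>S\<^esub> sinv S t = szero S"

definition scomponent :: "('s, 'c) graded_semigroup \<Rightarrow> 'c \<Rightarrow> 's set" where
  "scomponent S \<alpha> = {s \<in> carrier S. s \<noteq> szero S \<and> sdeg S s = \<alpha>} \<union> {szero S}"

definition is_graded_semigroup ::
    "('c, 'm) monoid_scheme \<Rightarrow> ('s, 'c) graded_semigroup \<Rightarrow> bool" where
  "is_graded_semigroup \<Gamma> S \<longleftrightarrow>
    (\<forall>s\<in>carrier S. s \<noteq> szero S \<longrightarrow> sdeg S s \<in> carrier \<Gamma>) \<and>
    (\<forall>s\<in>carrier S. \<forall>t\<in>carrier S. s \<cdot>\<^bsub>S\<^esub> t \<noteq> szero S \<longrightarrow>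
      sdeg S (s \<cdot>\<^bsub>S\<^esub> t) = sdeg S s \<otimes>\<^bsub>\<Gamma>\<^esub> sdeg S t)"

definition graded_boolean ::
    "('c, 'm) monoid_scheme \<Rightarrow> ('s, 'c) graded_semigroup \<Rightarrow> bool" where
  "graded_boolean \<Gamma> S \<longleftrightarrow>
    (\<forall>\<alpha>\<in>carrier \<Gamma>. \<forall>s\<in>scomponent S \<alpha>. \<forall>t\<in>scomponent S \<alpha>. orthogonal_in S s t \<longrightarrow>
      (\<exists>j. least (nat_order S) j (Upper (nat_order S) {s, t}))) \<and>
    distributive_lattice (idem_order S) \<and>
    (\<forall>e\<in>idempotents S. e \<noteq> szero S \<longrightarrow> boolean_lattice (idem_ideal S e))"


section \<open>The category of graded-Boolean inverse meet-semigroups\<close>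

definition GrIS_ob :: "('c, 'm) monoid_scheme \<Rightarrow> ('s, 'c) graded_semigroup set" where
  "GrIS_ob \<Gamma> = {S. inverse_semigroup S \<and> is_graded_semigroup \<Gamma> S \<and>
    lower_semilattice (nat_order S) \<and> graded_boolean \<Gamma> S}"

text \<open>
  Morphisms are extensional functions, so that equality of morphisms is equality in HOL. Source
  and target of a morphism may have different carrier types: neither the formation of compact
  slices nor that of ultrafilters stays within one carrier type, so the category has to comprise
  the objects over all types. The same applies to groupoids below.
\<close>

definition GrIS_hom ::
    "('c, 'm) monoid_scheme \<Rightarrow> ('s, 'c) graded_semigroup \<Rightarrow> ('t, 'c) graded_semigroup \<Rightarrow>
     ('s \<Rightarrow> 't) set" where
  "GrIS_hom \<Gamma> S T = {\<phi> \<in> carrier S \<rightarrow>\<^sub>E carrier T.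
    (\<forall>s\<in>carrier S. \<forall>t\<in>carrier S. \<phi> (s \<cdot>\<^bsub>S\<^esub> t) = \<phi> s \<cdot>\<^bsub>T\<^esub> \<phi> t) \<and>
    (\<forall>\<alpha>\<in>carrier \<Gamma>. \<phi> ` scomponent S \<alpha> \<subseteq> scomponent T \<alpha>) \<and>
    (\<forall>s\<in>carrier S. \<forall>t\<in>carrier S.
      \<phi> (s \<sqinter>\<^bsub>nat_order S\<^esub> t) = \<phi> s \<sqinter>\<^bsub>nat_order T\<^esub> \<phi> t) \<and>
    join_pres (idem_order S) (idem_order T) \<phi> \<and>
    meet_pres (idem_order S) (idem_order T) \<phi> \<and>
    (\<forall>f\<in>idempotents S. \<forall>e g. complement_in (idem_ideal S f) e g \<longrightarrow>
      complement_in (idem_ideal T (\<phi> f)) (\<phi> e) (\<phi> g))}"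

definition GrIS_id :: "('s, 'c) graded_semigroup \<Rightarrow> 's \<Rightarrow> 's" where
  "GrIS_id S = (\<lambda>s\<in>carrier S. s)"

definition GrIS_comp ::
    "('s, 'c) graded_semigroup \<Rightarrow> ('t \<Rightarrow> 'u) \<Rightarrow> ('s \<Rightarrow> 't) \<Rightarrow> 's \<Rightarrow> 'u" where
  "GrIS_comp S \<psi> \<phi> = compose (carrier S) \<psi> \<phi>"

definition GrIS_iso ::
    "('c, 'm) monoid_scheme \<Rightarrow> ('s, 'c) graded_semigroup \<Rightarrow> ('t, 'c) graded_semigroup \<Rightarrow>
     ('s \<Rightarrow> 't) \<Rightarrow> bool" where
  "GrIS_iso \<Gamma> S T \<phi> \<longleftrightarrow> \<phi> \<in> GrIS_hom \<Gamma> S T \<and>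
    (\<exists>\<psi>\<in>GrIS_hom \<Gamma> T S. GrIS_comp S \<psi> \<phi> = GrIS_id S \<and> GrIS_comp T \<phi> \<psi> = GrIS_id T)"


section \<open>Graded topological groupoids\<close>

text \<open>
  A groupoid is given by its set of morphisms; \<open>gmult G x y\<close> is meaningful only for composable
  \<open>x\<close>, \<open>y\<close>, that is, when \<open>gdom G x = gran G y\<close>.
\<close>

record ('a, 'c) graded_groupoid = "'a partial_object" +
  gmult :: "'a \<Rightarrow> 'a \<Rightarrow> 'a" (infixl \<open>\<bullet>\<index>\<close> 70)
  ginv :: "'a \<Rightarrow> 'a"
  gtop :: "'a topology"
  gdeg :: "'a \<Rightarrow> 'c"

definition gdom :: "('a, 'c) graded_groupoid \<Rightarrow> 'a \<Rightarrow> 'a" where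
  "gdom G x = ginv G x \<bullet>\<^bsub>G\<^esub> x"

definition gran :: "('a, 'c) graded_groupoid \<Rightarrow> 'a \<Rightarrow> 'a" where
  "gran G x = x \<bullet>\<^bsub>G\<^esub> ginv G x"

definition composable :: "('a, 'c) graded_groupoid \<Rightarrow> ('a \<times> 'a) set" where
  "composable G = {(x, y). x \<in> carrier G \<and> y \<in> carrier G \<and> gdom G x = gran G y}"

definition gunits :: "('a, 'c) graded_groupoid \<Rightarrow> 'a set" where
  "gunits G = gdom G ` carrier G"

text \<open>
  The axioms of a small category with set of morphisms \<open>carrier G\<close> (domain \<open>gdom G x\<close> and
  codomain \<open>gran G x\<close> of \<open>x\<close> being identity morphisms), in which \<open>ginv G x\<close> is inverse to \<open>x\<close>.
\<close>

definition is_groupoid :: "('a, 'c) graded_groupoid \<Rightarrow> bool" where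
  "is_groupoid G \<longleftrightarrow>
    (\<forall>x\<in>carrier G. gdom G x \<in> carrier G \<and> gran G x \<in> carrier G \<and>
      gdom G (gdom G x) = gdom G x \<and> gran G (gdom G x) = gdom G x \<and>
      gdom G (gran G x) = gran G x \<and> gran G (gran G x) = gran G x \<and>
      x \<bullet>\<^bsub>G\<^esub> gdom G x = x \<and> gran G x \<bullet>\<^bsub>G\<^esub> x = x) \<and>
    (\<forall>(x, y)\<in>composable G. x \<bullet>\<^bsub>G\<^esub> y \<in> carrier G \<and>
      gdom G (x \<bullet>\<^bsub>G\<^esub> y) = gdom G y \<and> gran G (x \<bullet>\<^bsub>G\<^esub> y) = gran G x) \<and>
    (\<forall>x y z. (x, y) \<in> composable G \<and> (y, z) \<in> composable G \<longrightarrow>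
      (x \<bullet>\<^bsub>G\<^esub> y) \<bullet>\<^bsub>G\<^esub> z = x \<bullet>\<^bsub>G\<^esub> (y \<bullet>\<^bsub>G\<^esub> z)) \<and>
    (\<forall>x\<in>carrier G. ginv G x \<in> carrier G \<and>
      gdom G (ginv G x) = gran G x \<and> gran G (ginv G x) = gdom G x)"

definition topological_groupoid :: "('a, 'c) graded_groupoid \<Rightarrow> bool" where
  "topological_groupoid G \<longleftrightarrow> is_groupoid G \<and> topspace (gtop G) = carrier G \<and>
    continuous_map (gtop G) (gtop G) (ginv G) \<and>
    continuous_map (subtopology (prod_topology (gtop G) (gtop G)) (composable G)) (gtop G)
      (\<lambda>(x, y). x \<bullet>\<^bsub>G\<^esub> y)"

definition local_homeomorphism_map :: "'a topology \<Rightarrow> 'b topology \<Rightarrow> ('a \<Rightarrow> 'b) \<Rightarrow> bool" where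
  "local_homeomorphism_map X Y f \<longleftrightarrow>
    (\<forall>x\<in>topspace X. \<exists>U. openin X U \<and> x \<in> U \<and> openin Y (f ` U) \<and>
      homeomorphic_map (subtopology X U) (subtopology Y (f ` U)) f)"

definition unit_topology :: "('a, 'c) graded_groupoid \<Rightarrow> 'a topology" where
  "unit_topology G = subtopology (gtop G) (gunits G)"

definition etale_groupoid :: "('a, 'c) graded_groupoid \<Rightarrow> bool" where
  "etale_groupoid G \<longleftrightarrow> topological_groupoid G \<and>
    local_homeomorphism_map (gtop G) (unit_topology G) (gdom G)"

definition slice :: "('a, 'c) graded_groupoid \<Rightarrow> 'a set \<Rightarrow> bool" where
  "slice G U \<longleftrightarrow> openin (gtop G) U \<and> inj_on (gdom G) U \<and> inj_on (gran G) U"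

definition ample_groupoid :: "('a, 'c) graded_groupoid \<Rightarrow> bool" where
  "ample_groupoid G \<longleftrightarrow> etale_groupoid G \<and>
    openin (gtop G) = arbitrary union_of (\<lambda>U. slice G U \<and> compactin (gtop G) U) \<and>
    Hausdorff_space (unit_topology G)"

definition gcomponent :: "('a, 'c) graded_groupoid \<Rightarrow> 'c \<Rightarrow> 'a set" where
  "gcomponent G \<alpha> = {x \<in> carrier G. gdeg G x = \<alpha>}"

definition is_graded_groupoid ::
    "('c, 'm) monoid_scheme \<Rightarrow> ('a, 'c) graded_groupoid \<Rightarrow> bool" where
  "is_graded_groupoid \<Gamma> G \<longleftrightarrow>
    continuous_map (gtop G) (discrete_topology (carrier \<Gamma>)) (gdeg G) \<and>
    (\<forall>(x, y)\<in>composable G. gdeg G (x \<bullet>\<^bsub>G\<^esub> y) = gdeg G x \<otimes>\<^bsub>\<Gamma>\<^esub> gdeg G y)"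


section \<open>The category of graded Hausdorff ample groupoids\<close>

definition GrGp_ob :: "('c, 'm) monoid_scheme \<Rightarrow> ('a, 'c) graded_groupoid set" where
  "GrGp_ob \<Gamma> = {G. ample_groupoid G \<and> Hausdorff_space (gtop G) \<and> is_graded_groupoid \<Gamma> G}"

text \<open>
  A partial functor is a partial map \<open>\<phi> :: 'a \<rightharpoonup> 'b\<close>; its domain is \<open>dom \<phi>\<close>.
\<close>

definition pvimage :: "('a \<rightharpoonup> 'b) \<Rightarrow> 'b set \<Rightarrow> 'a set" where
  "pvimage \<phi> K = {x \<in> dom \<phi>. the (\<phi> x) \<in> K}"

definition open_subgroupoid :: "('a, 'c) graded_groupoid \<Rightarrow> 'a set \<Rightarrow> bool" where
  "open_subgroupoid G D \<longleftrightarrow> openin (gtop G) D \<and>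
    (\<forall>x\<in>D. gdom G x \<in> D \<and> gran G x \<in> D \<and> ginv G x \<in> D) \<and>
    (\<forall>x\<in>D. \<forall>y\<in>D. (x, y) \<in> composable G \<longrightarrow> x \<bullet>\<^bsub>G\<^esub> y \<in> D)"

definition partial_functor ::
    "('a, 'c) graded_groupoid \<Rightarrow> ('b, 'c) graded_groupoid \<Rightarrow> ('a \<rightharpoonup> 'b) \<Rightarrow> bool" where
  "partial_functor G H \<phi> \<longleftrightarrow> open_subgroupoid G (dom \<phi>) \<and> ran \<phi> \<subseteq> carrier H \<and>
    (\<forall>x\<in>dom \<phi>. the (\<phi> (gdom G x)) = gdom H (the (\<phi> x)) \<and>
      the (\<phi> (gran G x)) = gran H (the (\<phi> x))) \<and>
    (\<forall>x\<in>dom \<phi>. \<forall>y\<in>dom \<phi>. (x, y) \<in> composable G \<longrightarrow>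
      the (\<phi> (x \<bullet>\<^bsub>G\<^esub> y)) = the (\<phi> x) \<bullet>\<^bsub>H\<^esub> the (\<phi> y))"

definition star_injective :: "('a, 'c) graded_groupoid \<Rightarrow> ('a \<rightharpoonup> 'b) \<Rightarrow> bool" where
  "star_injective G \<phi> \<longleftrightarrow>
    (\<forall>x\<in>dom \<phi>. \<forall>y\<in>dom \<phi>. \<phi> x = \<phi> y \<and> gdom G x = gdom G y \<longrightarrow> x = y)"

definition star_surjective ::
    "('a, 'c) graded_groupoid \<Rightarrow> ('b, 'c) graded_groupoid \<Rightarrow> ('a \<rightharpoonup> 'b) \<Rightarrow> bool" where
  "star_surjective G H \<phi> \<longleftrightarrow>
    (\<forall>e\<in>dom \<phi> \<inter> gunits G. \<forall>y\<in>carrier H. gdom H y = the (\<phi> e) \<longrightarrow>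
      (\<exists>x\<in>dom \<phi>. gdom G x = e \<and> the (\<phi> x) = y))"

text \<open>This is weaker than the library's \<open>proper_map\<close>, which also asks for a closed map.\<close>

definition proper_partial ::
    "('a, 'c) graded_groupoid \<Rightarrow> ('b, 'c) graded_groupoid \<Rightarrow> ('a \<rightharpoonup> 'b) \<Rightarrow> bool" where
  "proper_partial G H \<phi> \<longleftrightarrow>
    continuous_map (subtopology (gtop G) (dom \<phi>)) (gtop H) (the \<circ> \<phi>) \<and>
    (\<forall>K. compactin (gtop H) K \<longrightarrow> compactin (gtop G) (pvimage \<phi> K))"

definition GrGp_hom ::
    "('c, 'm) monoid_scheme \<Rightarrow> ('a, 'c) graded_groupoid \<Rightarrow> ('b, 'c) graded_groupoid \<Rightarrow>
     ('a \<rightharpoonup> 'b) set" where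
  "GrGp_hom \<Gamma> G H = {\<phi>. partial_functor G H \<phi> \<and>
    star_injective G \<phi> \<and> star_surjective G H \<phi> \<and> proper_partial G H \<phi> \<and>
    (\<forall>\<alpha>\<in>carrier \<Gamma>. (the \<circ> \<phi>) ` (gcomponent G \<alpha> \<inter> dom \<phi>) \<subseteq> gcomponent H \<alpha>)}"

definition GrGp_id :: "('a, 'c) graded_groupoid \<Rightarrow> 'a \<rightharpoonup> 'a" where
  "GrGp_id G = Some |` carrier G"

definition GrGp_iso ::
    "('c, 'm) monoid_scheme \<Rightarrow> ('a, 'c) graded_groupoid \<Rightarrow> ('b, 'c) graded_groupoid \<Rightarrow>
     ('a \<rightharpoonup> 'b) \<Rightarrow> bool" where
  "GrGp_iso \<Gamma> G H \<phi> \<longleftrightarrow> \<phi> \<in> GrGp_hom \<Gamma> G H \<and>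
    (\<exists>\<psi>\<in>GrGp_hom \<Gamma> H G. \<psi> \<circ>\<^sub>m \<phi> = GrGp_id G \<and> \<phi> \<circ>\<^sub>m \<psi> = GrGp_id H)"


section \<open>The functors and the natural transformations\<close>

text \<open>
  The two definite descriptions below pick the common degree of the elements of a nonempty
  homogeneous slice and of an ultrafilter, respectively.
\<close>

definition Sgr :: "('c, 'm) monoid_scheme \<Rightarrow> ('a, 'c) graded_groupoid \<Rightarrow>
    ('a set, 'c) graded_semigroup" where
  "Sgr \<Gamma> G =
    \<lparr>carrier = {X. slice G X \<and> compactin (gtop G) X \<and> (\<exists>\<alpha>\<in>carrier \<Gamma>. X \<subseteq> gcomponent G \<alpha>)},
     smult = (\<lambda>X Y. {x \<bullet>\<^bsub>G\<^esub> y | x y. x \<in> X \<and> y \<in> Y \<and> gdom G x = gran G y}),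
     szero = {},
     sdeg = (\<lambda>X. THE \<alpha>. \<alpha> \<in> carrier \<Gamma> \<and> X \<subseteq> gcomponent G \<alpha>)\<rparr>"

definition Sgr_map :: "('c, 'm) monoid_scheme \<Rightarrow> ('b, 'c) graded_groupoid \<Rightarrow>
    ('a \<rightharpoonup> 'b) \<Rightarrow> 'b set \<Rightarrow> 'a set" where
  "Sgr_map \<Gamma> H \<phi> = (\<lambda>X\<in>carrier (Sgr \<Gamma> H). pvimage \<phi> X)"

definition ultrafilters :: "('s, 'c) graded_semigroup \<Rightarrow> 's set set" where
  "ultrafilters S = {X. ultrafilter_on (nat_order S) X}"

definition ultrafilters_at :: "('s, 'c) graded_semigroup \<Rightarrow> 's \<Rightarrow> 's set set" where
  "ultrafilters_at S s = {Y \<in> ultrafilters S. s \<in> Y}"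

definition UG :: "('s, 'c) graded_semigroup \<Rightarrow> ('s set, 'c) graded_groupoid" where
  "UG S =
    \<lparr>carrier = ultrafilters S,
     gmult = (\<lambda>X Y. {s \<in> carrier S. \<exists>x\<in>X. \<exists>y\<in>Y. x \<cdot>\<^bsub>S\<^esub> y \<sqsubseteq>\<^bsub>nat_order S\<^esub> s}),
     ginv = (\<lambda>X. sinv S ` X),
     gtop = topology (arbitrary union_of (\<lambda>U. \<exists>s\<in>carrier S. U = ultrafilters_at S s)),
     gdeg = (\<lambda>X. THE \<alpha>. \<forall>x\<in>X. sdeg S x = \<alpha>)\<rparr>"

definition UG_map :: "('s, 'c) graded_semigroup \<Rightarrow> ('t, 'c) graded_semigroup \<Rightarrow>
    ('s \<Rightarrow> 't) \<Rightarrow> 't set \<rightharpoonup> 's set" where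
  "UG_map S T \<phi> X =
    (let Y = {s \<in> carrier S. \<phi> s \<in> X}
     in if X \<in> ultrafilters T \<and> Y \<in> ultrafilters S then Some Y else None)"

definition mu :: "('c, 'm) monoid_scheme \<Rightarrow> ('a, 'c) graded_groupoid \<Rightarrow>
    'a \<rightharpoonup> 'a set set" where
  "mu \<Gamma> G = (\<lambda>x. Some {Y \<in> carrier (Sgr \<Gamma> G). x \<in> Y}) |` carrier G"

definition nu :: "('s, 'c) graded_semigroup \<Rightarrow> 's \<Rightarrow> 's set set" where
  "nu S = (\<lambda>s\<in>carrier S. {Y \<in> carrier (UG S). s \<in> Y})"

end

theory Submission
  imports Defs
begin

text \<open>
  An ultrafilter of an inverse meet-semigroup \<open>S\<close> is determined by any one of its elements \<open>s\<close>
  together with its domain, and every ultrafilter \<open>F\<close> containing \<open>s\<^sup>-\<^sup>1 s\<close> is the domain of the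
  ultrafilter generated by \<open>s F\<close>. Hence the ultrafilters containing \<open>s\<close> form a slice, and these
  slices multiply as the elements of \<open>S\<close> do. The Boolean condition enters through relative
  differences: for \<open>a \<le> s\<close> there is a largest \<open>c \<le> s\<close> disjoint from \<open>a\<close>, and an ultrafilter
  containing \<open>s\<close> contains \<open>a\<close> or \<open>c\<close>. This gives compactness of the basic slices, characterises
  ultrafilters among filters by a condition that passes to preimages under morphisms, and makes
  \<open>s\<close> recoverable from its slice. A homogeneous compact slice is a finite union of basic ones,
  which differences make orthogonal, so that it is itself basic by the existence of orthogonal
  joins. Conversely, in a Hausdorff ample groupoid an ultrafilter of homogeneous compact slices has
  a common point by compactness, and maximality makes it the set of all slices through that point.
\<close>

text \<open>Nothing bounds \<open>E\<close> from above, so complements exist only below a given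
  idempotent, and a morphism may send no element at all into an ultrafilter \<open>X\<close> of its
  target. This is why the dual of a morphism is partial. Emptiness of the preimage is the only
  obstruction: the domain of the dual is the union of the open sets \<open>uf_at (\<phi> s)\<close>.

  Binary meets turn non-membership into something positive: an ultrafilter omits \<open>t\<close>
  only if one of its elements has meet zero with \<open>t\<close>. Separation of points, the
  alternative between \<open>a\<close> and its difference, and the behaviour of ultrafilters at
  joins start from such a witness.

  Orthogonal joins are granted within one degree only, hence the restriction to homogeneous slices.
  It loses nothing, because the components of a grading are open and homogeneous compact slices
  still form a base. Degrees pass to ultrafilters because comparable nonzero elements have equal
  degree.

  Equality of two ultrafilters is often proved from one inclusion, by maximality; this spares the
  lifting arguments that the converse would need.\<close>

no_notation inner (infix \<open>\<bullet>\<close> 70)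

section \<open>Inverse semigroups\<close>

locale inv_semigroup =
  fixes S :: "('s, 'c) graded_semigroup" (structure)
  assumes inverse_semigroup: "inverse_semigroup S"
begin

abbreviation \<iota> :: "'s \<Rightarrow> 's" where "\<iota> \<equiv> sinv S"
abbreviation E :: "'s set" where "E \<equiv> idempotents S"
abbreviation zero :: 's (\<open>\<zero>\<close>) where "\<zero> \<equiv> szero S"
abbreviation nle :: "'s \<Rightarrow> 's \<Rightarrow> bool" (infix \<open>\<preceq>\<close> 50) where
  "x \<preceq> y \<equiv> x \<sqsubseteq>\<^bsub>nat_order S\<^esub> y"

lemma smult_closed [simp, intro]: "x \<in> carrier S \<Longrightarrow> y \<in> carrier S \<Longrightarrow> x \<cdot> y \<in> carrier S"
  and smult_assoc: "x \<in> carrier S \<Longrightarrow> y \<in> carrier S \<Longrightarrow> z \<in> carrier S \<Longrightarrow> x \<cdot> y \<cdot> z = x \<cdot> (y \<cdot> z)"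
  and zero_closed [simp, intro]: "\<zero> \<in> carrier S"
  and zero_left [simp]: "x \<in> carrier S \<Longrightarrow> \<zero> \<cdot> x = \<zero>"
  and zero_right [simp]: "x \<in> carrier S \<Longrightarrow> x \<cdot> \<zero> = \<zero>"
  using inverse_semigroup unfolding inverse_semigroup_def semigroup_with_zero_def by auto

lemma is_sinv_sinv: "x \<in> carrier S \<Longrightarrow> is_sinv S x (\<iota> x)"
  unfolding sinv_def using inverse_semigroup unfolding inverse_semigroup_def by (metis theI')

lemma sinv_unique: "x \<in> carrier S \<Longrightarrow> is_sinv S x t \<Longrightarrow> t = \<iota> x"
  using is_sinv_sinv inverse_semigroup unfolding inverse_semigroup_def by blast

lemma sinv_closed [simp, intro]: "x \<in> carrier S \<Longrightarrow> \<iota> x \<in> carrier S"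
  using is_sinv_sinv is_sinv_def by fast

lemma mult_sinv_mult [simp]: "x \<in> carrier S \<Longrightarrow> x \<cdot> (\<iota> x \<cdot> x) = x"
  and sinv_mult_sinv [simp]: "x \<in> carrier S \<Longrightarrow> \<iota> x \<cdot> (x \<cdot> \<iota> x) = \<iota> x"
  using is_sinv_sinv[of x] smult_assoc sinv_closed unfolding is_sinv_def by metis+

lemma mult_sinv_mult2 [simp]:
  "x \<in> carrier S \<Longrightarrow> y \<in> carrier S \<Longrightarrow> x \<cdot> (\<iota> x \<cdot> (x \<cdot> y)) = x \<cdot> y"
  "x \<in> carrier S \<Longrightarrow> y \<in> carrier S \<Longrightarrow> \<iota> x \<cdot> (x \<cdot> (\<iota> x \<cdot> y)) = \<iota> x \<cdot> y"
  by (metis mult_sinv_mult sinv_mult_sinv smult_assoc smult_closed sinv_closed)+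

lemma sinv_eqI:
  assumes "x \<in> carrier S" "t \<in> carrier S" "x \<cdot> (t \<cdot> x) = x" "t \<cdot> (x \<cdot> t) = t"
  shows "\<iota> x = t"
  using assms sinv_unique[of x t] by (simp add: is_sinv_def smult_assoc)

lemma sinv_sinv [simp]: "x \<in> carrier S \<Longrightarrow> \<iota> (\<iota> x) = x"
  by (rule sinv_eqI) auto

lemma idem_closed [simp, intro]: "e \<in> E \<Longrightarrow> e \<in> carrier S"
  and idem_idem [simp]: "e \<in> E \<Longrightarrow> e \<cdot> e = e"
  by (auto simp: idempotents_def)

lemma idem_idem2 [simp]: "e \<in> E \<Longrightarrow> y \<in> carrier S \<Longrightarrow> e \<cdot> (e \<cdot> y) = e \<cdot> y"
  by (metis idem_closed idem_idem smult_assoc)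

lemma idemI: "e \<in> carrier S \<Longrightarrow> e \<cdot> e = e \<Longrightarrow> e \<in> E"
  unfolding idempotents_def by blast

lemma sinv_idem [simp]: "e \<in> E \<Longrightarrow> \<iota> e = e"
  by (rule sinv_eqI) auto

text \<open>With \<open>x\<close> the inverse of \<open>e \<cdot> f\<close>, also
  \<open>f \<cdot> (x \<cdot> e)\<close> is an inverse of \<open>e \<cdot> f\<close>, so the two
  agree. The second form shows that \<open>x\<close> is idempotent; an idempotent is its own
  inverse, so \<open>e \<cdot> f\<close> is idempotent too.\<close>

lemma idem_mult [simp, intro]:
  assumes e: "e \<in> E" and f: "f \<in> E"
  shows "e \<cdot> f \<in> E"
proof -
  define x where "x = \<iota> (e \<cdot> f)"
  have [simp]: "x \<in> carrier S" "e \<in> carrier S" "f \<in> carrier S"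
    using e f by (auto simp: x_def)
  have 1: "e \<cdot> (f \<cdot> (x \<cdot> (e \<cdot> f))) = e \<cdot> f"
    using mult_sinv_mult[of "e \<cdot> f"] by (simp add: x_def[symmetric] smult_assoc)
  have 2: "x \<cdot> (e \<cdot> (f \<cdot> x)) = x"
    using sinv_mult_sinv[of "e \<cdot> f"] by (simp add: x_def[symmetric] smult_assoc)
  have 3: "x \<cdot> (e \<cdot> (f \<cdot> (x \<cdot> y))) = x \<cdot> y" if "y \<in> carrier S" for y
    using 2 that
    by (metis \<open>e \<in> carrier S\<close> \<open>f \<in> carrier S\<close> \<open>x \<in> carrier S\<close> smult_assoc smult_closed)
  have "\<iota> (e \<cdot> f) = f \<cdot> (x \<cdot> e)"
  proof (rule sinv_eqI)
    show "e \<cdot> f \<cdot> (f \<cdot> (x \<cdot> e) \<cdot> (e \<cdot> f)) = e \<cdot> f"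
      using e f by (simp add: smult_assoc 1)
    show "f \<cdot> (x \<cdot> e) \<cdot> (e \<cdot> f \<cdot> (f \<cdot> (x \<cdot> e))) = f \<cdot> (x \<cdot> e)"
      using e f by (simp add: smult_assoc 3)
  qed simp_all
  then have x: "x = f \<cdot> (x \<cdot> e)"
    by (simp only: x_def)
  have "x \<cdot> x = f \<cdot> (x \<cdot> e) \<cdot> (f \<cdot> (x \<cdot> e))"
    by (rule arg_cong2[OF x x])
  also have "\<dots> = f \<cdot> (x \<cdot> e)"
    using 3[of e] by (simp add: smult_assoc)
  also have "\<dots> = x"
    using x by (rule sym)
  finally have "x \<in> E"
    by (simp add: idemI)
  then have "\<iota> x \<in> E"
    by simp
  moreover have "\<iota> x = e \<cdot> f"
    unfolding x_def by (rule sinv_sinv) simp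
  ultimately show ?thesis
    by (simp only:)
qed

text \<open>Both products are idempotent, and this makes each an inverse of the other; but an
  idempotent is its own inverse.\<close>

lemma idem_comm:
  assumes e: "e \<in> E" and f: "f \<in> E"
  shows "e \<cdot> f = f \<cdot> e"
proof -
  have ef: "e \<cdot> f \<in> E" "f \<cdot> e \<in> E"
    using e f by auto
  then have 1: "e \<cdot> (f \<cdot> (e \<cdot> f)) = e \<cdot> f" "f \<cdot> (e \<cdot> (f \<cdot> e)) = f \<cdot> e"
    using idem_idem[OF ef(1)] idem_idem[OF ef(2)] idem_closed[OF e] idem_closed[OF f]
    by (metis smult_assoc smult_closed)+
  have "\<iota> (e \<cdot> f) = f \<cdot> e"
    by (rule sinv_eqI) (use e f 1 in \<open>simp_all add: smult_assoc\<close>)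
  then show ?thesis
    by (metis sinv_idem[OF ef(1)])
qed

lemma idem_left_comm:
  assumes "e \<in> E" "f \<in> E" "y \<in> carrier S"
  shows "e \<cdot> (f \<cdot> y) = f \<cdot> (e \<cdot> y)"
proof -
  have "e \<cdot> (f \<cdot> y) = (e \<cdot> f) \<cdot> y"
    using assms by (simp add: smult_assoc)
  also have "\<dots> = (f \<cdot> e) \<cdot> y"
    by (simp only: idem_comm[OF assms(1,2)])
  also have "\<dots> = f \<cdot> (e \<cdot> y)"
    using assms by (simp add: smult_assoc)
  finally show ?thesis .
qed

lemma sinv_mult_idem [simp, intro]: "x \<in> carrier S \<Longrightarrow> \<iota> x \<cdot> x \<in> E"
  and mult_sinv_idem [simp, intro]: "x \<in> carrier S \<Longrightarrow> x \<cdot> \<iota> x \<in> E"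
  by (rule idemI; simp add: smult_assoc)+

lemma zero_idem [simp, intro]: "\<zero> \<in> E"
  by (rule idemI) auto

lemma sinv_zero [simp]: "\<iota> \<zero> = \<zero>"
  by simp

text \<open>In both inverse equations the idempotents \<open>y \<cdot> \<iota> y\<close> and
  \<open>\<iota> x \<cdot> x\<close> stand side by side; commuting them lets each be
  absorbed.\<close>

lemma sinv_mult:
  assumes [simp]: "x \<in> carrier S" "y \<in> carrier S"
  shows "\<iota> (x \<cdot> y) = \<iota> y \<cdot> \<iota> x"
proof (rule sinv_eqI)
  have "x \<cdot> y \<cdot> (\<iota> y \<cdot> \<iota> x \<cdot> (x \<cdot> y)) = x \<cdot> ((y \<cdot> \<iota> y) \<cdot> ((\<iota> x \<cdot> x) \<cdot> y))"
    by (simp add: smult_assoc)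
  also have "\<dots> = x \<cdot> ((\<iota> x \<cdot> x) \<cdot> ((y \<cdot> \<iota> y) \<cdot> y))"
    by (subst idem_left_comm) auto
  also have "\<dots> = x \<cdot> y"
    by (simp add: smult_assoc)
  finally show "x \<cdot> y \<cdot> (\<iota> y \<cdot> \<iota> x \<cdot> (x \<cdot> y)) = x \<cdot> y" .
  have "\<iota> y \<cdot> \<iota> x \<cdot> (x \<cdot> y \<cdot> (\<iota> y \<cdot> \<iota> x)) = \<iota> y \<cdot> ((\<iota> x \<cdot> x) \<cdot> ((y \<cdot> \<iota> y) \<cdot> \<iota> x))"
    by (simp add: smult_assoc)
  also have "\<dots> = \<iota> y \<cdot> ((y \<cdot> \<iota> y) \<cdot> ((\<iota> x \<cdot> x) \<cdot> \<iota> x))"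
    by (subst idem_left_comm) auto
  also have "\<dots> = \<iota> y \<cdot> \<iota> x"
    by (simp add: smult_assoc)
  finally show "\<iota> y \<cdot> \<iota> x \<cdot> (x \<cdot> y \<cdot> (\<iota> y \<cdot> \<iota> x)) = \<iota> y \<cdot> \<iota> x" .
qed auto

lemma conj_idem [simp, intro]:
  assumes [simp]: "x \<in> carrier S" "e \<in> E"
  shows "x \<cdot> (e \<cdot> \<iota> x) \<in> E"
proof (rule idemI)
  have "x \<cdot> (e \<cdot> \<iota> x) \<cdot> (x \<cdot> (e \<cdot> \<iota> x)) = x \<cdot> (e \<cdot> ((\<iota> x \<cdot> x) \<cdot> (e \<cdot> \<iota> x)))"
    by (simp add: smult_assoc)
  also have "\<dots> = x \<cdot> ((\<iota> x \<cdot> x) \<cdot> (e \<cdot> \<iota> x))"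
    by (subst idem_left_comm) auto
  finally show "x \<cdot> (e \<cdot> \<iota> x) \<cdot> (x \<cdot> (e \<cdot> \<iota> x)) = x \<cdot> (e \<cdot> \<iota> x)"
    by (simp add: smult_assoc)
qed auto

text \<open>Moves an idempotent from the left of \<open>x\<close> to the right, at the price of
  conjugating it. This makes the order, which is defined by right factors, symmetric in left and
  right.\<close>

lemma idem_mult_eq:
  assumes [simp]: "x \<in> carrier S" "e \<in> E"
  shows "e \<cdot> x = x \<cdot> (\<iota> x \<cdot> (e \<cdot> x))"
proof -
  have "x \<cdot> (\<iota> x \<cdot> (e \<cdot> x)) = (x \<cdot> \<iota> x) \<cdot> (e \<cdot> x)"
    by (simp add: smult_assoc)
  also have "\<dots> = e \<cdot> ((x \<cdot> \<iota> x) \<cdot> x)"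
    by (subst idem_left_comm) auto
  finally show ?thesis
    by (simp add: smult_assoc)
qed


subsection \<open>The natural partial order\<close>

lemma nle_iff: "x \<preceq> y \<longleftrightarrow> (\<exists>e\<in>E. x = y \<cdot> e)"
  by (simp add: nat_order_def)

lemma mult_idem_le [simp, intro]: "x \<in> carrier S \<Longrightarrow> e \<in> E \<Longrightarrow> x \<cdot> e \<preceq> x"
  by (auto simp: nle_iff)

lemma idem_mult_le [simp, intro]: "x \<in> carrier S \<Longrightarrow> e \<in> E \<Longrightarrow> e \<cdot> x \<preceq> x"
  using idem_mult_eq[of x e] conj_idem[of "\<iota> x" e] by (auto simp: nle_iff)

lemma le_closed: "x \<preceq> y \<Longrightarrow> y \<in> carrier S \<Longrightarrow> x \<in> carrier S"
  by (auto simp: nle_iff)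

text \<open>The idempotent witnessing \<open>x \<preceq> y\<close> can always be taken to be
  \<open>\<iota> x \<cdot> x\<close>, which depends on \<open>x\<close> alone: below a fixed
  \<open>y\<close>, an element is determined by its domain idempotent.\<close>

lemma le_dom:
  assumes "x \<preceq> y" "y \<in> carrier S"
  shows "y \<cdot> (\<iota> x \<cdot> x) = x"
proof -
  obtain e where e [simp]: "e \<in> E" "x = y \<cdot> e"
    using assms nle_iff by auto
  have "y \<cdot> (\<iota> x \<cdot> x) = y \<cdot> (e \<cdot> ((\<iota> y \<cdot> y) \<cdot> e))"
    using assms by (simp add: smult_assoc sinv_mult)
  also have "\<dots> = y \<cdot> ((\<iota> y \<cdot> y) \<cdot> e)"
    by (subst idem_left_comm) (use assms in auto)
  finally show ?thesis
    using assms by (simp add: smult_assoc)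
qed

lemma le_refl [simp, intro]: "x \<in> carrier S \<Longrightarrow> x \<preceq> x"
  by (metis mult_idem_le mult_sinv_mult sinv_mult_idem)

lemma le_trans [trans]: "x \<preceq> y \<Longrightarrow> y \<preceq> z \<Longrightarrow> z \<in> carrier S \<Longrightarrow> x \<preceq> z"
  by (auto simp: nle_iff smult_assoc)

lemma le_antisym:
  assumes "x \<preceq> y" "y \<preceq> x" "x \<in> carrier S"
  shows "x = y"
proof -
  obtain e f where [simp]: "e \<in> E" "f \<in> E" and x: "x = y \<cdot> e" and y: "y = x \<cdot> f"
    using assms nle_iff by auto
  have "y = y \<cdot> f"
    using y assms(3) by (metis \<open>f \<in> E\<close> idem_closed idem_idem smult_assoc)
  then have "x = y \<cdot> (f \<cdot> e)"
    using x assms by (metis \<open>f \<in> E\<close> \<open>e \<in> E\<close> idem_closed le_closed smult_assoc)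
  also have "\<dots> = y \<cdot> (e \<cdot> f)"
    by (simp add: idem_comm)
  also have "\<dots> = y"
    using x y assms by (metis \<open>f \<in> E\<close> \<open>e \<in> E\<close> idem_closed le_closed smult_assoc)
  finally show ?thesis .
qed

lemma le_sinv: "x \<preceq> y \<Longrightarrow> y \<in> carrier S \<Longrightarrow> \<iota> x \<preceq> \<iota> y"
  by (metis idem_mult_le idem_closed nle_iff sinv_closed sinv_idem sinv_mult)

text \<open>\<open>e\<close> is carried across \<open>v\<close> by \<open>idem_mult_eq\<close>, so
  that both idempotents gather at the right end.\<close>

lemma le_mult:
  assumes "x \<preceq> y" "u \<preceq> v" "y \<in> carrier S" "v \<in> carrier S"
  shows "x \<cdot> u \<preceq> y \<cdot> v"
proof -
  obtain e f where e [simp]: "e \<in> E" "f \<in> E" and "x = y \<cdot> e" "u = v \<cdot> f"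
    using assms nle_iff by auto
  then have "x \<cdot> u = y \<cdot> ((e \<cdot> v) \<cdot> f)"
    using assms by (simp add: smult_assoc)
  also have "\<dots> = y \<cdot> ((v \<cdot> (\<iota> v \<cdot> (e \<cdot> v))) \<cdot> f)"
    using assms idem_mult_eq[of v e] by (simp only: e)
  also have "\<dots> = y \<cdot> v \<cdot> (\<iota> v \<cdot> (e \<cdot> v) \<cdot> f)"
    using assms by (simp add: smult_assoc)
  also have "\<dots> \<preceq> y \<cdot> v"
    using assms conj_idem[of "\<iota> v" e] by auto
  finally show ?thesis .
qed

lemma carrier_nat_order [simp]: "carrier (nat_order S) = carrier S"
  and eq_nat_order [simp]: "(.=\<^bsub>nat_order S\<^esub>) = (=)"
  by (simp_all add: nat_order_def)

lemma partial_order_nat_order: "partial_order (nat_order S)"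
  by unfold_locales (auto intro: le_antisym le_trans)

lemma zero_le [simp, intro]: "x \<in> carrier S \<Longrightarrow> \<zero> \<preceq> x"
  by (metis mult_idem_le zero_idem zero_right)

lemma le_zero: "x \<preceq> \<zero> \<longleftrightarrow> x = \<zero>"
  by (auto simp: nle_iff)

text \<open>\<open>bottom\<close> is an indefinite description of a least element, and
  \<open>order_filter\<close> is defined with it, so it has to be identified with the zero.\<close>

lemma bottom_nat_order: "\<bottom>\<^bsub>nat_order S\<^esub> = \<zero>"
proof -
  interpret partial_order "nat_order S"
    by (rule partial_order_nat_order)
  have "least (nat_order S) \<zero> (carrier S)"
    by (auto simp: least_def)
  then show ?thesis
    unfolding bottom_def by (metis carrier_nat_order least_unique some_equality)
qed

lemma le_idem: "x \<preceq> e \<Longrightarrow> e \<in> E \<Longrightarrow> x \<in> E"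
  by (auto simp: nle_iff)

lemma idem_le_iff: "e \<in> E \<Longrightarrow> f \<in> E \<Longrightarrow> e \<preceq> f \<longleftrightarrow> f \<cdot> e = e"
  by (metis idem_mult_eq idem_closed le_dom nle_iff sinv_idem idem_idem)

lemma dom_zero: "x \<in> carrier S \<Longrightarrow> \<iota> x \<cdot> x = \<zero> \<Longrightarrow> x = \<zero>"
  by (metis mult_sinv_mult zero_right)

lemma le_dom_mono: "x \<preceq> y \<Longrightarrow> y \<in> carrier S \<Longrightarrow> \<iota> x \<cdot> x \<preceq> \<iota> y \<cdot> y"
  by (simp add: le_mult le_sinv)

lemma le_ran_mono: "x \<preceq> y \<Longrightarrow> y \<in> carrier S \<Longrightarrow> x \<cdot> \<iota> x \<preceq> y \<cdot> \<iota> y"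
  by (simp add: le_mult le_sinv)

end

section \<open>The groupoid of ultrafilters\<close>

context inv_semigroup
begin

abbreviation filt :: "'s set \<Rightarrow> bool" where "filt X \<equiv> order_filter (nat_order S) X"
abbreviation ufprod :: "'s set \<Rightarrow> 's set \<Rightarrow> 's set" (infixl \<open>\<star>\<close> 70) where
  "X \<star> Y \<equiv> X \<bullet>\<^bsub>UG S\<^esub> Y"

section \<open>Filters and ultrafilters\<close>

lemma filt_iff:
  "filt X \<longleftrightarrow> X \<subseteq> carrier S \<and> X \<noteq> {} \<and> \<zero> \<notin> X \<and>
    (\<forall>x\<in>X. \<forall>y\<in>carrier S. x \<preceq> y \<longrightarrow> y \<in> X) \<and> (\<forall>x\<in>X. \<forall>y\<in>X. \<exists>z\<in>X. z \<preceq> x \<and> z \<preceq> y)"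
  by (simp add: order_filter_def bottom_nat_order)

lemma filtI:
  assumes "X \<subseteq> carrier S" "x \<in> X" "\<zero> \<notin> X"
    "\<And>x y. x \<in> X \<Longrightarrow> y \<in> carrier S \<Longrightarrow> x \<preceq> y \<Longrightarrow> y \<in> X"
    "\<And>x y. x \<in> X \<Longrightarrow> y \<in> X \<Longrightarrow> \<exists>z\<in>X. z \<preceq> x \<and> z \<preceq> y"
  shows "filt X"
  using assms filt_iff by auto

lemma filt_closed: "filt X \<Longrightarrow> x \<in> X \<Longrightarrow> x \<in> carrier S"
  and filt_nonempty: "filt X \<Longrightarrow> \<exists>x. x \<in> X"
  and filt_not_zero: "filt X \<Longrightarrow> \<zero> \<notin> X"
  and filt_upward: "filt X \<Longrightarrow> x \<in> X \<Longrightarrow> x \<preceq> y \<Longrightarrow> y \<in> carrier S \<Longrightarrow> y \<in> X"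
  and filt_directed: "filt X \<Longrightarrow> x \<in> X \<Longrightarrow> y \<in> X \<Longrightarrow> \<exists>z\<in>X. z \<preceq> x \<and> z \<preceq> y"
  unfolding filt_iff by blast+

text \<open>The filter generated by a filter base. The sets of products, of meets and of covering
  remainders used below are directed but not upward closed.\<close>

lemma filt_up:
  assumes A: "A \<subseteq> carrier S" "a \<in> A" "\<zero> \<notin> A"
    and dir: "\<And>x y. x \<in> A \<Longrightarrow> y \<in> A \<Longrightarrow> \<exists>z\<in>A. z \<preceq> x \<and> z \<preceq> y"
  shows "filt {t \<in> carrier S. \<exists>x\<in>A. x \<preceq> t}"
proof (rule filtI)
  show "a \<in> {t \<in> carrier S. \<exists>x\<in>A. x \<preceq> t}"
    using A by auto
  show "\<zero> \<notin> {t \<in> carrier S. \<exists>x\<in>A. x \<preceq> t}"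
    using A by (auto simp: le_zero)
  show "y \<in> {t \<in> carrier S. \<exists>x\<in>A. x \<preceq> t}"
    if "x \<in> {t \<in> carrier S. \<exists>x\<in>A. x \<preceq> t}" "y \<in> carrier S" "x \<preceq> y" for x y
    using that le_trans by blast
  show "\<exists>z\<in>{t \<in> carrier S. \<exists>x\<in>A. x \<preceq> t}. z \<preceq> x \<and> z \<preceq> y"
    if xy: "x \<in> {t \<in> carrier S. \<exists>x\<in>A. x \<preceq> t}" "y \<in> {t \<in> carrier S. \<exists>x\<in>A. x \<preceq> t}" for x y
  proof -
    obtain a b where ab: "a \<in> A" "b \<in> A" "a \<preceq> x" "b \<preceq> y"
      using xy by blast
    then obtain z where "z \<in> A" "z \<preceq> a" "z \<preceq> b"
      using dir by blast
    then show ?thesis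
      using ab A(1) xy le_trans[of z a x] le_trans[of z b y] by (intro bexI[of _ z]) auto
  qed
qed auto

lemma uf_filt [dest]: "X \<in> ultrafilters S \<Longrightarrow> filt X"
  and uf_max: "X \<in> ultrafilters S \<Longrightarrow> filt Z \<Longrightarrow> X \<subseteq> Z \<Longrightarrow> Z = X"
  by (auto simp: ultrafilters_def ultrafilter_on_def)

lemma ufI: "filt X \<Longrightarrow> (\<And>Z. filt Z \<Longrightarrow> X \<subseteq> Z \<Longrightarrow> Z \<subseteq> X) \<Longrightarrow> X \<in> ultrafilters S"
  by (auto simp: ultrafilters_def ultrafilter_on_def)

lemma filt_Union_chain:
  assumes "subset.chain {X. filt X} C" "C \<noteq> {}"
  shows "filt (\<Union>C)"
proof -
  have C: "\<And>X. X \<in> C \<Longrightarrow> filt X" "\<And>X Y. X \<in> C \<Longrightarrow> Y \<in> C \<Longrightarrow> X \<subseteq> Y \<or> Y \<subseteq> X"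
    using assms(1) by (auto simp: subset_chain_def)
  obtain X x where "X \<in> C" "x \<in> X"
    using assms(2) C filt_nonempty by blast
  then show ?thesis
  proof (intro filtI[of _ x])
    show "\<exists>z\<in>\<Union>C. z \<preceq> a \<and> z \<preceq> b" if ab: "a \<in> \<Union>C" "b \<in> \<Union>C" for a b
    proof -
      obtain A B where "A \<in> C" "B \<in> C" "a \<in> A" "b \<in> B"
        using ab by blast
      then obtain D where "D \<in> C" "a \<in> D" "b \<in> D"
        using C(2) by blast
      then show ?thesis
        using C(1) filt_directed by blast
    qed
  qed (use C(1) filt_closed filt_not_zero filt_upward in blast)+
qed

lemma uf_extend:
  assumes "filt X"
  obtains Y where "Y \<in> ultrafilters S" "X \<subseteq> Y"
proof -
  let ?A = "{Z. filt Z \<and> X \<subseteq> Z}"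
  have "\<exists>M\<in>?A. \<forall>Z\<in>?A. M \<subseteq> Z \<longrightarrow> Z = M"
  \<comment> \<open>Upper bounds are asked for nonempty chains only, as they must be: the empty
    union is not a filter.\<close>
  proof (rule subset_Zorn_nonempty)
    show "?A \<noteq> {}"
      using assms by blast
    fix C assume C: "C \<noteq> {}" "subset.chain ?A C"
    then have "subset.chain {X. filt X} C"
      by (auto simp: subset_chain_def)
    then have "filt (\<Union>C)"
      using filt_Union_chain C by blast
    moreover have "X \<subseteq> \<Union>C"
      using C unfolding subset_chain_def by blast
    ultimately show "\<Union>C \<in> ?A"
      by blast
  qed
  then obtain M where M: "M \<in> ?A" "\<forall>Z\<in>?A. M \<subseteq> Z \<longrightarrow> Z = M" ..
  have "M \<in> ultrafilters S"
  proof (rule ufI)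
    show "Z \<subseteq> M" if "filt Z" "M \<subseteq> Z" for Z
      using M that by auto
  qed (use M in simp)
  then show ?thesis
    using that M by blast
qed

lemma uf_containing:
  assumes "s \<in> carrier S" "s \<noteq> \<zero>"
  obtains Y where "Y \<in> ultrafilters S" "s \<in> Y"
proof -
  have "filt {t \<in> carrier S. \<exists>x\<in>{s}. x \<preceq> t}"
    by (rule filt_up[of _ s]) (use assms in auto)
  then obtain Y where "Y \<in> ultrafilters S" "{t \<in> carrier S. \<exists>x\<in>{s}. x \<preceq> t} \<subseteq> Y"
    by (rule uf_extend)
  then show ?thesis
    using that assms by auto
qed

section \<open>Products and inverses of filters\<close>

lemma mem_ufprod: "s \<in> X \<star> Y \<longleftrightarrow> s \<in> carrier S \<and> (\<exists>x\<in>X. \<exists>y\<in>Y. x \<cdot> y \<preceq> s)"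
  by (simp add: UG_def)

lemma ufprod_closed [simp]: "X \<star> Y \<subseteq> carrier S"
  by (auto simp: mem_ufprod)

lemma ufprodI: "x \<in> X \<Longrightarrow> y \<in> Y \<Longrightarrow> X \<subseteq> carrier S \<Longrightarrow> Y \<subseteq> carrier S \<Longrightarrow> x \<cdot> y \<in> X \<star> Y"
  unfolding mem_ufprod by (meson le_refl smult_closed subsetD)

lemma ufprod_assoc:
  assumes "X \<subseteq> carrier S" "Y \<subseteq> carrier S" "Z \<subseteq> carrier S"
  shows "(X \<star> Y) \<star> Z = X \<star> (Y \<star> Z)"
proof (intro equalityI subsetI)
  fix s assume "s \<in> (X \<star> Y) \<star> Z"
  then obtain t x y z where t: "s \<in> carrier S" "t \<in> carrier S" "x \<in> X" "y \<in> Y" "z \<in> Z"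
      "t \<cdot> z \<preceq> s" "x \<cdot> y \<preceq> t"
    by (auto simp: mem_ufprod)
  have C: "x \<in> carrier S" "y \<in> carrier S" "z \<in> carrier S"
    using t assms by auto
  have "x \<cdot> y \<cdot> z \<preceq> t \<cdot> z"
    using t C by (intro le_mult) auto
  then have "x \<cdot> (y \<cdot> z) \<preceq> s"
    using t C le_trans[of "x \<cdot> y \<cdot> z" "t \<cdot> z" s] smult_assoc[of x y z] by auto
  then show "s \<in> X \<star> (Y \<star> Z)"
    using t assms ufprodI[of y Y z Z] mem_ufprod[of s X "Y \<star> Z"] by blast
next
  fix s assume "s \<in> X \<star> (Y \<star> Z)"
  then obtain t x y z where t: "s \<in> carrier S" "t \<in> carrier S" "x \<in> X" "y \<in> Y" "z \<in> Z"
      "x \<cdot> t \<preceq> s" "y \<cdot> z \<preceq> t"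
    by (auto simp: mem_ufprod)
  have C: "x \<in> carrier S" "y \<in> carrier S" "z \<in> carrier S"
    using t assms by auto
  have "x \<cdot> (y \<cdot> z) \<preceq> x \<cdot> t"
    using t C by (intro le_mult) auto
  then have "x \<cdot> y \<cdot> z \<preceq> s"
    using t C le_trans[of "x \<cdot> (y \<cdot> z)" "x \<cdot> t" s] smult_assoc[of x y z] by auto
  then show "s \<in> (X \<star> Y) \<star> Z"
    using t assms ufprodI[of x X y Y] mem_ufprod[of s "X \<star> Y" Z] by blast
qed

lemma sinv_image_closed: "X \<subseteq> carrier S \<Longrightarrow> \<iota> ` X \<subseteq> carrier S"
  by auto

lemma sinv_image_sinv_image [simp]: "X \<subseteq> carrier S \<Longrightarrow> \<iota> ` (\<iota> ` X) = X"
  by (force simp: image_iff)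

lemma mem_sinv_image: "X \<subseteq> carrier S \<Longrightarrow> s \<in> carrier S \<Longrightarrow> s \<in> \<iota> ` X \<longleftrightarrow> \<iota> s \<in> X"
  by (force simp: image_iff)

lemma sinv_image_ufprod:
  assumes "X \<subseteq> carrier S" "Y \<subseteq> carrier S"
  shows "\<iota> ` (X \<star> Y) = \<iota> ` Y \<star> \<iota> ` X"
proof -
  have 1: "\<iota> ` (X \<star> Y) \<subseteq> \<iota> ` Y \<star> \<iota> ` X" if "X \<subseteq> carrier S" "Y \<subseteq> carrier S" for X Y
  proof
    fix s assume "s \<in> \<iota> ` (X \<star> Y)"
    then obtain x y t where t: "s = \<iota> t" "t \<in> carrier S" "x \<in> X" "y \<in> Y" "x \<cdot> y \<preceq> t"
      by (auto simp: mem_ufprod)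
    then have "x \<in> carrier S" "y \<in> carrier S"
      using that by auto
    then have "\<iota> y \<cdot> \<iota> x \<preceq> s"
      using t le_sinv[of "x \<cdot> y" t] sinv_mult[of x y] by simp
    then show "s \<in> \<iota> ` Y \<star> \<iota> ` X"
      using t by (auto simp: mem_ufprod)
  qed
  \<comment> \<open>The converse inclusion is the same statement for the inverse sets.\<close>
  have "\<iota> ` Y \<star> \<iota> ` X = \<iota> ` (\<iota> ` (\<iota> ` Y \<star> \<iota> ` X))"
    by simp
  also have "\<dots> \<subseteq> \<iota> ` (\<iota> ` (\<iota> ` X) \<star> \<iota> ` (\<iota> ` Y))"
    using 1[of "\<iota> ` Y" "\<iota> ` X"] assms sinv_image_closed by (intro image_mono) blast
  also have "\<dots> = \<iota> ` (X \<star> Y)"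
    using assms by simp
  finally show ?thesis
    using 1[OF assms] by blast
qed

lemma filt_sinv_image:
  assumes "filt X"
  shows "filt (\<iota> ` X)"
proof -
  obtain x where x: "x \<in> X"
    using assms filt_nonempty by blast
  show ?thesis
  proof (rule filtI)
    show "\<iota> ` X \<subseteq> carrier S" "\<iota> x \<in> \<iota> ` X"
      using assms x filt_closed by auto
    show "\<zero> \<notin> \<iota> ` X"
      using assms filt_closed filt_not_zero by (metis imageE sinv_sinv sinv_zero)
    show "t \<in> \<iota> ` X" if "s \<in> \<iota> ` X" "t \<in> carrier S" "s \<preceq> t" for s t
    proof -
      have "\<iota> s \<in> X"
        using that assms filt_closed by auto
      moreover have "\<iota> s \<preceq> \<iota> t"
        using that le_sinv by blast
      ultimately have "\<iota> t \<in> X"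
        using assms filt_upward that by blast
      then show ?thesis
        using that by (metis imageI sinv_sinv)
    qed
    show "\<exists>z\<in>\<iota> ` X. z \<preceq> s \<and> z \<preceq> t" if "s \<in> \<iota> ` X" "t \<in> \<iota> ` X" for s t
      using that assms filt_closed filt_directed le_sinv by (smt (verit) imageE imageI)
  qed
qed

lemma uf_sinv_image:
  assumes X: "X \<in> ultrafilters S"
  shows "\<iota> ` X \<in> ultrafilters S"
proof (rule ufI)
  show "filt (\<iota> ` X)"
    using X filt_sinv_image by blast
  fix Z assume Z: "filt Z" "\<iota> ` X \<subseteq> Z"
  then have "\<iota> ` (\<iota> ` X) \<subseteq> \<iota> ` Z"
    by blast
  moreover have XC: "X \<subseteq> carrier S" and ZC: "Z \<subseteq> carrier S"
    using X Z filt_closed by blast+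
  ultimately have "\<iota> ` Z = X"
    using uf_max[OF X] filt_sinv_image Z by simp
  then show "Z \<subseteq> \<iota> ` X"
    using ZC by (metis sinv_image_sinv_image order_refl)
qed

text \<open>The product X^-1 X is generated by the idempotents of single elements:
  \<open>\<iota> x \<cdot> y\<close> lies above \<open>\<iota> z \<cdot> z\<close> for any common
  lower bound \<open>z\<close> of \<open>x\<close> and \<open>y\<close> in \<open>X\<close>.\<close>

lemma mem_dom_filt:
  assumes X: "filt X"
  shows "s \<in> \<iota> ` X \<star> X \<longleftrightarrow> s \<in> carrier S \<and> (\<exists>x\<in>X. \<iota> x \<cdot> x \<preceq> s)"
proof
  assume "s \<in> \<iota> ` X \<star> X"
  then obtain x y where x: "x \<in> X" "y \<in> X" "\<iota> x \<cdot> y \<preceq> s" "s \<in> carrier S"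
    by (auto simp: mem_ufprod)
  then obtain z where z: "z \<in> X" "z \<preceq> x" "z \<preceq> y"
    using X filt_directed by blast
  then have "\<iota> z \<cdot> z \<preceq> \<iota> x \<cdot> y"
    using x X filt_closed by (intro le_mult le_sinv) auto
  then show "s \<in> carrier S \<and> (\<exists>x\<in>X. \<iota> x \<cdot> x \<preceq> s)"
    using x z le_trans by blast
qed (auto simp: mem_ufprod)

lemma dom_mem_filt: "filt X \<Longrightarrow> s \<in> X \<Longrightarrow> \<iota> s \<cdot> s \<in> \<iota> ` X \<star> X"
  by (meson filt_closed le_refl mem_dom_filt sinv_closed smult_closed)

lemma mem_ran_filt:
  assumes X: "filt X"
  shows "s \<in> X \<star> \<iota> ` X \<longleftrightarrow> s \<in> carrier S \<and> (\<exists>x\<in>X. x \<cdot> \<iota> x \<preceq> s)"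
proof -
  have "X \<subseteq> carrier S"
    using X filt_closed by blast
  then have "X \<star> \<iota> ` X = \<iota> ` (\<iota> ` X) \<star> \<iota> ` X"
    by simp
  moreover have "\<iota> (\<iota> x) = x" if "x \<in> X" for x
    using that \<open>X \<subseteq> carrier S\<close> by auto
  ultimately show ?thesis
    using mem_dom_filt[OF filt_sinv_image[OF X], of s] by auto
qed

text \<open>The unit law of the groupoid, already valid for filters. A common lower bound
  \<open>z\<close> of \<open>x\<close> and \<open>y\<close> satisfies z = z z^-1 z, and the
  right-hand side lies below \<open>x \<cdot> e\<close>.\<close>

lemma filt_ufprod_sinv_ufprod:
  assumes X: "filt X"
  shows "X \<star> (\<iota> ` X \<star> X) = X"
proof (intro equalityI subsetI)
  have XC: "X \<subseteq> carrier S"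
    using X filt_closed by blast
  fix s assume "s \<in> X \<star> (\<iota> ` X \<star> X)"
  then obtain x y e where x: "x \<in> X" "y \<in> X" "\<iota> y \<cdot> y \<preceq> e" "x \<cdot> e \<preceq> s"
      "s \<in> carrier S" "e \<in> carrier S"
    by (auto simp: mem_ufprod[of _ X "\<iota> ` X \<star> X"] mem_dom_filt[OF X])
  then obtain z where z: "z \<in> X" "z \<preceq> x" "z \<preceq> y"
    using X filt_directed by blast
  have "z \<cdot> (\<iota> z \<cdot> z) \<preceq> x \<cdot> e"
    using x z XC le_trans[OF le_dom_mono[of z y], of e] by (intro le_mult) auto
  then show "s \<in> X"
    using x z X XC le_trans[of z "x \<cdot> e" s] filt_upward[of X z s] by auto
next
  fix s assume s: "s \<in> X"
  then have "s \<in> carrier S" "s \<cdot> (\<iota> s \<cdot> s) \<preceq> s"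
    using X filt_closed by auto
  moreover have "\<iota> s \<cdot> s \<in> \<iota> ` X \<star> X"
    using s X by (rule dom_mem_filt[rotated])
  ultimately show "s \<in> X \<star> (\<iota> ` X \<star> X)"
    using s mem_ufprod by blast
qed


subsection \<open>Translates of ultrafilters\<close>

text \<open>The coset of \<open>Y\<close> under \<open>s\<close>. If \<open>Y\<close> is an
  ultrafilter whose range contains \<open>\<iota> s \<cdot> s\<close>, this is the product with
  \<open>Y\<close> of the only arrow through \<open>s\<close> that has this range as its
  domain.\<close>

definition translate :: "'s \<Rightarrow> 's set \<Rightarrow> 's set" where
  "translate s Y = {t \<in> carrier S. \<exists>y\<in>Y. s \<cdot> y \<preceq> t}"

text \<open>If \<open>z \<in> X\<close> lies below \<open>s\<close> and \<open>t\<close>, then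
  \<open>z\<close> is \<open>s\<close> times its own domain idempotent, which belongs to the domain
  of \<open>X\<close>. So \<open>X\<close> is generated by the products of \<open>s\<close> with its
  domain.\<close>

lemma filt_translate_dom:
  assumes X: "filt X" and s: "s \<in> X"
  shows "translate s (\<iota> ` X \<star> X) = X"
proof (intro equalityI subsetI)
  show "t \<in> X" if "t \<in> translate s (\<iota> ` X \<star> X)" for t
  proof -
    have "t \<in> X \<star> (\<iota> ` X \<star> X)"
      using that s unfolding translate_def mem_ufprod[of t X] by blast
    then show ?thesis
      by (simp only: filt_ufprod_sinv_ufprod[OF X])
  qed
  fix t assume t: "t \<in> X"
  then obtain z where z: "z \<in> X" "z \<preceq> s" "z \<preceq> t"
    using X s filt_directed by blast
  then have "s \<cdot> (\<iota> z \<cdot> z) = z"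
    using X s filt_closed le_dom by blast
  then have "s \<cdot> (\<iota> z \<cdot> z) \<preceq> t"
    using z by simp
  moreover have "\<iota> z \<cdot> z \<in> \<iota> ` X \<star> X"
    using z X dom_mem_filt by blast
  ultimately show "t \<in> translate s (\<iota> ` X \<star> X)"
    using filt_closed[OF X t] unfolding translate_def by blast
qed

text \<open>Elements fixed by \<open>\<iota> s \<cdot> s\<close> occur arbitrarily low in
  \<open>Y\<close>, so translation by \<open>s\<close> can be undone by
  \<open>\<iota> s\<close>.\<close>

lemma translate_ran_aux:
  assumes Y: "filt Y" and s: "s \<in> carrier S" "\<iota> s \<cdot> s \<in> Y \<star> \<iota> ` Y" and y: "y \<in> Y"
  obtains z where "z \<in> Y" "z \<preceq> y" "\<iota> s \<cdot> (s \<cdot> z) = z"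
proof -
  obtain x where x: "x \<in> Y" "x \<cdot> \<iota> x \<preceq> \<iota> s \<cdot> s"
    using s Y mem_ran_filt by blast
  obtain z where z: "z \<in> Y" "z \<preceq> y" "z \<preceq> x"
    using x y Y filt_directed by blast
  have C: "x \<in> carrier S" "z \<in> carrier S"
    using x z Y filt_closed by auto
  then have "z \<cdot> \<iota> z \<preceq> \<iota> s \<cdot> s"
    using x z s le_ran_mono le_trans by blast
  then have "(\<iota> s \<cdot> s) \<cdot> (z \<cdot> \<iota> z) = z \<cdot> \<iota> z"
    using C s idem_le_iff by simp
  then have "(\<iota> s \<cdot> s) \<cdot> (z \<cdot> \<iota> z) \<cdot> z = z \<cdot> \<iota> z \<cdot> z"
    by simp
  then have "\<iota> s \<cdot> (s \<cdot> z) = z"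
    using C s by (simp add: smult_assoc)
  then show ?thesis
    using that z by blast
qed

text \<open>Maximality comes from translating back. If a filter \<open>Z\<close> contains the
  translate, the filter \<open>?W\<close> generated by the products of \<open>\<iota> s\<close> with
  \<open>Z\<close> contains \<open>Y\<close>, hence equals \<open>Y\<close>; translating by
  \<open>s\<close> once more puts \<open>Z\<close> inside the translate of \<open>Y\<close>.\<close>

lemma uf_translate:
  assumes Y: "Y \<in> ultrafilters S" and s: "s \<in> carrier S" "\<iota> s \<cdot> s \<in> Y \<star> \<iota> ` Y"
  shows "translate s Y \<in> ultrafilters S"
proof (rule ufI)
  have fY: "filt Y"
    using Y by blast
  then have YC: "Y \<subseteq> carrier S"
    using filt_closed by blast
  obtain y0 where y0: "y0 \<in> Y"
    using fY filt_nonempty by blast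
  note aux = translate_ran_aux[OF fY s]
  have "filt {t \<in> carrier S. \<exists>x\<in>(\<cdot>) s ` Y. x \<preceq> t}"
  proof (rule filt_up)
    show "(\<cdot>) s ` Y \<subseteq> carrier S" "s \<cdot> y0 \<in> (\<cdot>) s ` Y"
      using YC s y0 by auto
    show "\<zero> \<notin> (\<cdot>) s ` Y"
    proof
      assume "\<zero> \<in> (\<cdot>) s ` Y"
      then obtain y where y: "y \<in> Y" "s \<cdot> y = \<zero>"
        by auto
      then obtain z where z: "z \<in> Y" "z \<preceq> y" "\<iota> s \<cdot> (s \<cdot> z) = z"
        using aux by blast
      then have "s \<cdot> z \<preceq> \<zero>"
        using y s YC le_mult[of s s z y] by auto
      then have "s \<cdot> z = \<zero>"
        by (simp add: le_zero)
      then show False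
        using z s fY filt_not_zero by auto
    qed
    show "\<exists>z\<in>(\<cdot>) s ` Y. z \<preceq> x \<and> z \<preceq> y" if xy: "x \<in> (\<cdot>) s ` Y" "y \<in> (\<cdot>) s ` Y" for x y
    proof -
      obtain a b where ab: "a \<in> Y" "b \<in> Y" "x = s \<cdot> a" "y = s \<cdot> b"
        using xy by auto
      then obtain c where "c \<in> Y" "c \<preceq> a" "c \<preceq> b"
        using fY filt_directed by blast
      then show ?thesis
        using ab s YC le_mult[of s s c a] le_mult[of s s c b] by auto
    qed
  qed
  then show tr: "filt (translate s Y)"
    by (simp add: translate_def)
  fix Z assume Z: "filt Z" "translate s Y \<subseteq> Z"
  then have ZC: "Z \<subseteq> carrier S"
    using filt_closed by blast
  have sY: "s \<cdot> y \<in> Z" if "y \<in> Y" for y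
    using that Z s YC by (force simp: translate_def)
  let ?W = "{t \<in> carrier S. \<exists>x\<in>(\<cdot>) (\<iota> s) ` Z. x \<preceq> t}"
  have "filt ?W"
  proof (rule filt_up)
    show "(\<cdot>) (\<iota> s) ` Z \<subseteq> carrier S" "\<iota> s \<cdot> (s \<cdot> y0) \<in> (\<cdot>) (\<iota> s) ` Z"
      using ZC s sY y0 by auto
    show "\<zero> \<notin> (\<cdot>) (\<iota> s) ` Z"
    proof
      assume "\<zero> \<in> (\<cdot>) (\<iota> s) ` Z"
      then obtain z where z: "z \<in> Z" "\<iota> s \<cdot> z = \<zero>"
        by auto
      then obtain w where w: "w \<in> Z" "w \<preceq> z" "w \<preceq> s \<cdot> y0"
        using Z sY y0 filt_directed by blast
      then have "\<iota> s \<cdot> w \<preceq> \<zero>"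
        using z s ZC le_mult[of "\<iota> s" "\<iota> s" w z] by auto
      then have "\<iota> s \<cdot> w = \<zero>"
        by (simp add: le_zero)
      \<comment> \<open>Being below \<open>s \<cdot> y0\<close>, the element \<open>w\<close> is
        fixed by \<open>s \<cdot> \<iota> s\<close>; if \<open>\<iota> s\<close> annihilated it, it
        would be zero.\<close>
      moreover obtain f where "f \<in> E" "w = s \<cdot> y0 \<cdot> f"
        using w nle_iff by blast
      then have "s \<cdot> (\<iota> s \<cdot> w) = w"
        using s y0 YC by (auto simp: smult_assoc)
      ultimately show False
        using w s Z filt_not_zero by auto
    qed
    show "\<exists>z\<in>(\<cdot>) (\<iota> s) ` Z. z \<preceq> x \<and> z \<preceq> y"
      if xy: "x \<in> (\<cdot>) (\<iota> s) ` Z" "y \<in> (\<cdot>) (\<iota> s) ` Z" for x y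
    proof -
      obtain a b where ab: "a \<in> Z" "b \<in> Z" "x = \<iota> s \<cdot> a" "y = \<iota> s \<cdot> b"
        using xy by auto
      then obtain c where "c \<in> Z" "c \<preceq> a" "c \<preceq> b"
        using Z filt_directed by blast
      then show ?thesis
        using ab s ZC le_mult[of "\<iota> s" "\<iota> s" c a] le_mult[of "\<iota> s" "\<iota> s" c b] by auto
    qed
  qed
  moreover have "Y \<subseteq> ?W"
  proof
    fix y assume y: "y \<in> Y"
    then obtain z where z: "z \<in> Y" "z \<preceq> y" "\<iota> s \<cdot> (s \<cdot> z) = z"
      using aux by blast
    then have "\<iota> s \<cdot> (s \<cdot> z) \<preceq> y" "s \<cdot> z \<in> Z"
      using sY by auto
    then show "y \<in> ?W"
      using y YC by blast
  qed
  ultimately have W: "?W = Y"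
    using uf_max Y by blast
  show "Z \<subseteq> translate s Y"
  proof
    fix v assume v: "v \<in> Z"
    then have "\<iota> s \<cdot> v \<in> ?W"
      using s ZC by auto
    then have "\<iota> s \<cdot> v \<in> Y"
      unfolding W .
    moreover have "s \<cdot> (\<iota> s \<cdot> v) \<preceq> v"
      using v s ZC idem_mult_le[of v "s \<cdot> \<iota> s"] by (auto simp: smult_assoc)
    ultimately show "v \<in> translate s Y"
      using v ZC by (auto simp: translate_def)
  qed
qed

text \<open>One element of \<open>X\<close> suffices to multiply by: any \<open>x \<in> X\<close>
  lies above some \<open>s \<cdot> a\<close> with \<open>a\<close> in the domain of
  \<open>X\<close>, which is the range of \<open>Y\<close>, and left multiplication by such an
  \<open>a\<close> maps \<open>Y\<close> into itself.\<close>

lemma ufprod_eq_translate: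
  assumes X: "filt X" and Y: "filt Y" and XY: "\<iota> ` X \<star> X = Y \<star> \<iota> ` Y" and s: "s \<in> X"
  shows "X \<star> Y = translate s Y"
proof
  have XC: "X \<subseteq> carrier S" and YC: "Y \<subseteq> carrier S"
    using X Y filt_closed by blast+
  show "translate s Y \<subseteq> X \<star> Y"
    using s unfolding translate_def mem_ufprod by (intro subsetI CollectI) (auto simp: mem_ufprod)
  show "X \<star> Y \<subseteq> translate s Y"
  proof
    fix t assume "t \<in> X \<star> Y"
    then obtain x y where t: "x \<in> X" "y \<in> Y" "x \<cdot> y \<preceq> t" "t \<in> carrier S"
      by (auto simp: mem_ufprod)
    have "x \<in> translate s (\<iota> ` X \<star> X)"
      using t filt_translate_dom X s by simp
    then obtain a where a: "a \<in> Y \<star> \<iota> ` Y" "s \<cdot> a \<preceq> x"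
      using XY by (auto simp: translate_def)
    then have aC: "a \<in> carrier S"
      using ufprod_closed by blast
    have "a \<cdot> y \<in> (Y \<star> \<iota> ` Y) \<star> Y"
      using a t YC ufprodI ufprod_closed by blast
    then have "a \<cdot> y \<in> Y"
      using filt_ufprod_sinv_ufprod[OF Y] YC by (simp add: ufprod_assoc sinv_image_closed)
    moreover have C: "s \<in> carrier S" "x \<in> carrier S" "y \<in> carrier S"
      using s t XC YC by auto
    then have "s \<cdot> a \<cdot> y \<preceq> x \<cdot> y"
      using a by (intro le_mult) auto
    then have "s \<cdot> (a \<cdot> y) \<preceq> t"
      using le_trans[OF _ t(3,4)] smult_assoc[OF C(1) aC C(3)] by simp
    ultimately show "t \<in> translate s Y"
      using t by (auto simp: translate_def)
  qed
qed

lemma uf_ufprod: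
  assumes X: "X \<in> ultrafilters S" and Y: "Y \<in> ultrafilters S" and XY: "\<iota> ` X \<star> X = Y \<star> \<iota> ` Y"
  shows "X \<star> Y \<in> ultrafilters S"
proof -
  obtain s where s: "s \<in> X"
    using filt_nonempty[OF uf_filt[OF X]] ..
  have fX: "filt X" and fY: "filt Y"
    using X Y by (simp_all add: uf_filt)
  have "translate s Y \<in> ultrafilters S"
    using uf_translate[OF Y filt_closed[OF fX s]] dom_mem_filt[OF fX s] XY by simp
  then show ?thesis
    by (simp only: ufprod_eq_translate[OF fX fY XY s])
qed

lemma filt_translate_self: "filt Y \<Longrightarrow> s \<in> carrier S \<Longrightarrow> \<iota> s \<cdot> s \<in> Y \<Longrightarrow> s \<in> translate s Y"
  unfolding translate_def using mult_sinv_mult[of s] le_refl[of s] by auto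

section \<open>The groupoid axioms\<close>

lemma carrier_UG [simp]: "carrier (UG S) = ultrafilters S"
  and ginv_UG [simp]: "ginv (UG S) X = \<iota> ` X"
  and gdom_UG: "gdom (UG S) X = \<iota> ` X \<star> X"
  and gran_UG: "gran (UG S) X = X \<star> \<iota> ` X"
  by (simp_all add: UG_def gdom_def gran_def)

text \<open>Beyond closure under products, everything is computed from associativity, the inversion
  rule and the unit law. Domains and ranges are themselves products of composable ultrafilters,
  hence ultrafilters.\<close>

lemma is_groupoid_UG: "is_groupoid (UG S)"
proof -
  let ?d = "gdom (UG S)" and ?r = "gran (UG S)"
  have C: "X \<subseteq> carrier S" "\<iota> ` X \<subseteq> carrier S" if "X \<in> ultrafilters S" for X
    using that filt_closed by blast+
  have inv: "\<iota> ` X \<in> ultrafilters S \<and> ?d (\<iota> ` X) = ?r X \<and> ?r (\<iota> ` X) = ?d X"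
    if "X \<in> ultrafilters S" for X
    using that C by (simp add: uf_sinv_image gdom_UG gran_UG)
  have idem: "X \<star> ?d X = X" "?r X \<star> X = X" if X: "X \<in> ultrafilters S" for X
    using filt_ufprod_sinv_ufprod[of X] uf_filt[OF X] C[OF X]
    by (simp_all add: gdom_UG gran_UG ufprod_assoc)
  have prod: "X \<star> Y \<in> ultrafilters S \<and> ?d (X \<star> Y) = ?d Y \<and> ?r (X \<star> Y) = ?r X"
    if X: "X \<in> ultrafilters S" and Y: "Y \<in> ultrafilters S" and XY: "?d X = ?r Y" for X Y
  proof -
    note c = C[OF X] C[OF Y]
    have "X \<star> Y \<in> ultrafilters S"
      using that uf_ufprod by (simp add: gdom_UG gran_UG)
    moreover have "?d (X \<star> Y) = \<iota> ` Y \<star> ((\<iota> ` X \<star> X) \<star> Y)"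
      using c by (simp add: gdom_UG sinv_image_ufprod ufprod_assoc)
    then have "?d (X \<star> Y) = ?d Y"
      using XY idem(2)[OF Y] by (simp add: gdom_UG gran_UG)
    moreover have "?r (X \<star> Y) = X \<star> ((Y \<star> \<iota> ` Y) \<star> \<iota> ` X)"
      using c by (simp add: gran_UG sinv_image_ufprod ufprod_assoc)
    then have "?r (X \<star> Y) = X \<star> (?d X \<star> \<iota> ` X)"
      using XY by (simp add: gran_UG)
    then have "?r (X \<star> Y) = ?r X"
      using idem(1)[OF X] c by (simp add: gdom_UG gran_UG flip: ufprod_assoc)
    ultimately show ?thesis
      by blast
  qed
  have dom: "?d X \<in> ultrafilters S \<and> ?d (?d X) = ?d X \<and> ?r (?d X) = ?d X"
    if X: "X \<in> ultrafilters S" for X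
    using prod[of "\<iota> ` X" X] inv[OF X] X by (simp add: gdom_UG)
  have ran: "?r X \<in> ultrafilters S \<and> ?d (?r X) = ?r X \<and> ?r (?r X) = ?r X"
    if X: "X \<in> ultrafilters S" for X
    using dom[of "\<iota> ` X"] inv[OF X] by simp
  have comp: "(X, Y) \<in> composable (UG S) \<longleftrightarrow>
      X \<in> ultrafilters S \<and> Y \<in> ultrafilters S \<and> ?d X = ?r Y" for X Y
    by (simp add: composable_def)
  show ?thesis
    unfolding is_groupoid_def
  proof (intro conjI ballI allI impI)
    show "case p of (X, Y) \<Rightarrow> X \<star> Y \<in> carrier (UG S) \<and> ?d (X \<star> Y) = ?d Y \<and> ?r (X \<star> Y) = ?r X"
      if "p \<in> composable (UG S)" for p
      using that prod by (cases p) (simp add: comp)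
    show "X \<star> Y \<star> Z = X \<star> (Y \<star> Z)"
      if "(X, Y) \<in> composable (UG S) \<and> (Y, Z) \<in> composable (UG S)" for X Y Z
      using that C(1) by (simp add: comp ufprod_assoc)
  qed (use dom ran idem inv in simp_all)
qed

section \<open>Arrows through a given element\<close>

lemma uf_eqI_dom:
  assumes "X \<in> ultrafilters S" "Y \<in> ultrafilters S" "s \<in> X" "s \<in> Y"
    and "gdom (UG S) X = gdom (UG S) Y"
  shows "X = Y"
proof -
  have "X = translate s (\<iota> ` X \<star> X)"
    by (rule filt_translate_dom[OF uf_filt[OF assms(1)] assms(3), symmetric])
  also have "\<dots> = translate s (\<iota> ` Y \<star> Y)"
    using assms(5) by (simp only: gdom_UG)
  also have "\<dots> = Y"
    by (rule filt_translate_dom[OF uf_filt[OF assms(2)] assms(4)])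
  finally show ?thesis .
qed

lemma uf_eqI_ran:
  assumes X: "X \<in> ultrafilters S" and Y: "Y \<in> ultrafilters S" and s: "s \<in> X" "s \<in> Y"
    and eq: "gran (UG S) X = gran (UG S) Y"
  shows "X = Y"
proof -
  have C: "X \<subseteq> carrier S" "Y \<subseteq> carrier S"
    using X Y filt_closed by blast+
  have "\<iota> ` X = \<iota> ` Y"
    by (rule uf_eqI_dom[of _ _ "\<iota> s"])
      (use assms C uf_sinv_image in \<open>simp_all add: gdom_UG gran_UG\<close>)
  then show ?thesis
    using C by (metis sinv_image_sinv_image)
qed

text \<open>What lies below \<open>e\<close> is idempotent, so \<open>F\<close> is generated by
  idempotents. Therefore \<open>F\<close> is contained in F^-1 and in F F, and by maximality equals
  both.\<close>

lemma uf_dom_idem: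
  assumes F: "F \<in> ultrafilters S" and e: "e \<in> F" "e \<in> E"
  shows "gdom (UG S) F = F" "gran (UG S) F = F"
proof -
  have fF: "filt F" and FC: "F \<subseteq> carrier S"
    using F filt_closed by blast+
  have *: "\<exists>z\<in>F. z \<in> E \<and> z \<preceq> x" if "x \<in> F" for x
    using that filt_directed[OF fF that e(1)] e(2) le_idem by blast
  have "x \<in> \<iota> ` F" if x: "x \<in> F" for x
  proof -
    obtain z where z: "z \<in> F" "z \<in> E" "z \<preceq> x"
      using *[OF x] by blast
    then have "z \<preceq> \<iota> x"
      using le_sinv[of z x] FC x by auto
    then have "\<iota> x \<in> F"
      using z x FC filt_upward[OF fF] by blast
    then show ?thesis
      using x FC by (simp add: mem_sinv_image subset_iff)
  qed
  then have inv: "\<iota> ` F = F"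
    using uf_max[OF F] filt_sinv_image[OF fF] by blast
  have "s \<in> F \<star> F" if s: "s \<in> F" for s
  proof -
    obtain z where "z \<in> F" "z \<in> E" "z \<preceq> s"
      using * s by blast
    then show ?thesis
      using s FC by (force simp: mem_ufprod)
  qed
  moreover have "filt (\<iota> ` F \<star> F)"
    using is_groupoid_UG F by (auto simp: is_groupoid_def gdom_UG)
  ultimately have "F \<star> F = F"
    using uf_max[OF F] inv by auto
  then show "gdom (UG S) F = F" "gran (UG S) F = F"
    using inv by (simp_all add: gdom_UG gran_UG)
qed

text \<open>If \<open>z \<in> Y\<close> is fixed by \<open>\<iota> s \<cdot> s\<close>, then
  \<open>s \<cdot> z\<close> has the same domain idempotent as \<open>z\<close>. This gives one
  inclusion, and maximality of the domain of \<open>Y\<close> gives equality.\<close>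

lemma gdom_translate:
  assumes Y: "Y \<in> ultrafilters S" and s: "s \<in> carrier S" "\<iota> s \<cdot> s \<in> Y \<star> \<iota> ` Y"
  shows "gdom (UG S) (translate s Y) = gdom (UG S) Y"
proof -
  have fY: "filt Y"
    using Y uf_filt by simp
  have W: "translate s Y \<in> ultrafilters S"
    using uf_translate[OF Y s] .
  then have fW: "filt (translate s Y)"
    using uf_filt by simp
  have "gdom (UG S) Y \<subseteq> gdom (UG S) (translate s Y)"
  proof
    fix a assume "a \<in> gdom (UG S) Y"
    then obtain y where a: "a \<in> carrier S" "y \<in> Y" "\<iota> y \<cdot> y \<preceq> a"
      using mem_dom_filt[OF fY] by (auto simp: gdom_UG)
    obtain z where z: "z \<in> Y" "z \<preceq> y" "\<iota> s \<cdot> (s \<cdot> z) = z"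
      using translate_ran_aux[OF fY s a(2)] .
    have C: "y \<in> carrier S" "z \<in> carrier S"
      using a z filt_closed[OF fY] by auto
    have "\<iota> (s \<cdot> z) \<cdot> (s \<cdot> z) = \<iota> z \<cdot> z"
      using s z(3) C by (simp add: sinv_mult smult_assoc)
    then have "\<iota> (s \<cdot> z) \<cdot> (s \<cdot> z) \<preceq> a"
      using le_trans[OF le_dom_mono[OF z(2) C(1)] a(3,1)] by simp
    moreover have "s \<cdot> z \<in> translate s Y"
      using z s C by (auto simp: translate_def)
    ultimately show "a \<in> gdom (UG S) (translate s Y)"
      using mem_dom_filt[OF fW] a(1) by (auto simp: gdom_UG)
  qed
  moreover have "gdom (UG S) Y \<in> ultrafilters S" "filt (gdom (UG S) (translate s Y))"
    using is_groupoid_UG W Y uf_filt by (auto simp: is_groupoid_def)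
  ultimately show ?thesis
    using uf_max by blast
qed

text \<open>The existence half of the claim that \<open>ultrafilters_at S s\<close> is a section of
  the domain map over the ultrafilters through \<open>\<iota> s \<cdot> s\<close>. It yields the
  domain image of a basic slice and, later, star-surjectivity.\<close>

lemma uf_at_dom:
  assumes F: "F \<in> ultrafilters S" and s: "s \<in> carrier S" "\<iota> s \<cdot> s \<in> F"
  shows "translate s F \<in> ultrafilters S" "s \<in> translate s F" "gdom (UG S) (translate s F) = F"
proof -
  have F': "gdom (UG S) F = F" "gran (UG S) F = F"
    using uf_dom_idem[OF F s(2)] s(1) by auto
  then have s': "\<iota> s \<cdot> s \<in> F \<star> \<iota> ` F"
    using s by (simp add: gran_UG)
  show "translate s F \<in> ultrafilters S"
    using uf_translate[OF F s(1) s'] .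
  show "s \<in> translate s F"
    using filt_translate_self[OF uf_filt[OF F] s] .
  show "gdom (UG S) (translate s F) = F"
    using gdom_translate[OF F s(1) s'] F' by simp
qed

end

section \<open>Graded-Boolean inverse meet-semigroups\<close>

text \<open>The lattice operations are indefinite descriptions, so a bound found by hand determines
  their value with no lattice structure assumed on the order.\<close>

lemma (in partial_order) meet_eqI: "greatest L m (Lower L {x, y}) \<Longrightarrow> x \<sqinter> y = m"
  unfolding meet_def Lattice.inf_def by (rule some_equality) (auto intro: greatest_unique)

lemma (in partial_order) join_eqI: "least L j (Upper L {x, y}) \<Longrightarrow> x \<squnion> y = j"
  unfolding join_def Lattice.sup_def by (rule some_equality) (auto intro: least_unique)

lemma (in partial_order) bottom_eqI: "least L b (carrier L) \<Longrightarrow> \<bottom> = b"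
  unfolding bottom_def by (rule some_equality) (auto intro: least_unique)

lemma (in partial_order) top_eqI: "greatest L b (carrier L) \<Longrightarrow> \<top> = b"
  unfolding top_def by (rule some_equality) (auto intro: greatest_unique)

lemma least_Upper_pair_iff:
  assumes "x \<in> carrier L" "y \<in> carrier L"
  shows "least L j (Upper L {x, y}) \<longleftrightarrow> j \<in> carrier L \<and> x \<sqsubseteq>\<^bsub>L\<^esub> j \<and> y \<sqsubseteq>\<^bsub>L\<^esub> j \<and>
    (\<forall>u\<in>carrier L. x \<sqsubseteq>\<^bsub>L\<^esub> u \<longrightarrow> y \<sqsubseteq>\<^bsub>L\<^esub> u \<longrightarrow> j \<sqsubseteq>\<^bsub>L\<^esub> u)"
  using assms by (auto simp: least_def Upper_def)

lemma greatest_Lower_pair_iff: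
  assumes "x \<in> carrier L" "y \<in> carrier L"
  shows "greatest L m (Lower L {x, y}) \<longleftrightarrow> m \<in> carrier L \<and> m \<sqsubseteq>\<^bsub>L\<^esub> x \<and> m \<sqsubseteq>\<^bsub>L\<^esub> y \<and>
    (\<forall>u\<in>carrier L. u \<sqsubseteq>\<^bsub>L\<^esub> x \<longrightarrow> u \<sqsubseteq>\<^bsub>L\<^esub> y \<longrightarrow> u \<sqsubseteq>\<^bsub>L\<^esub> m)"
  using assms by (auto simp: greatest_def Lower_def)

section \<open>Order ideals of idempotents\<close>

context inv_semigroup
begin

lemma idem_order_simps [simp]:
  "carrier (idem_order S) = E"
  "x \<sqsubseteq>\<^bsub>idem_order S\<^esub> y \<longleftrightarrow> x \<preceq> y"
  "carrier (idem_ideal S e) = {f \<in> E. f \<preceq> e}"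
  "x \<sqsubseteq>\<^bsub>idem_ideal S e\<^esub> y \<longleftrightarrow> x \<preceq> y"
  "(.=\<^bsub>idem_order S\<^esub>) = (=)"
  "(.=\<^bsub>idem_ideal S e\<^esub>) = (=)"
  by (simp_all add: idem_order_def idem_ideal_def nat_order_def)

lemma partial_order_idem_order: "partial_order (idem_order S)"
  and partial_order_idem_ideal: "partial_order (idem_ideal S e)"
  by unfold_locales (auto intro: le_antisym le_trans)

lemma idem_mult_greatest:
  assumes "e \<in> E" "f \<in> E" "h \<in> E"
  shows "h \<preceq> e \<cdot> f \<longleftrightarrow> h \<preceq> e \<and> h \<preceq> f"
proof
  assume "h \<preceq> e \<cdot> f"
  moreover have "e \<cdot> f \<preceq> e" "e \<cdot> f \<preceq> f"
    using assms by auto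
  ultimately show "h \<preceq> e \<and> h \<preceq> f"
    using assms le_trans by blast
next
  assume "h \<preceq> e \<and> h \<preceq> f"
  then show "h \<preceq> e \<cdot> f"
    using assms le_mult[of h e h f] by simp
qed

lemma meet_idem_order: "e \<in> E \<Longrightarrow> f \<in> E \<Longrightarrow> e \<sqinter>\<^bsub>idem_order S\<^esub> f = e \<cdot> f"
  by (rule partial_order.meet_eqI[OF partial_order_idem_order])
    (auto simp: greatest_Lower_pair_iff idem_mult_greatest)

lemma meet_idem_ideal:
  assumes "f \<in> E" "g \<in> E" "f \<preceq> e" "g \<preceq> e" "e \<in> E"
  shows "f \<sqinter>\<^bsub>idem_ideal S e\<^esub> g = f \<cdot> g"
proof (rule partial_order.meet_eqI[OF partial_order_idem_ideal])
  have "f \<cdot> g \<preceq> e"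
    using assms le_trans[of "f \<cdot> g" f e] by auto
  then show "greatest (idem_ideal S e) (f \<cdot> g) (Lower (idem_ideal S e) {f, g})"
    using assms by (auto simp: greatest_Lower_pair_iff idem_mult_greatest)
qed

lemma bottom_idem_ideal: "e \<in> E \<Longrightarrow> \<bottom>\<^bsub>idem_ideal S e\<^esub> = \<zero>"
  by (rule partial_order.bottom_eqI[OF partial_order_idem_ideal]) (auto simp: least_def)

lemma top_idem_ideal: "e \<in> E \<Longrightarrow> \<top>\<^bsub>idem_ideal S e\<^esub> = e"
  by (rule partial_order.top_eqI[OF partial_order_idem_ideal]) (auto simp: greatest_def)

text \<open>Quantifying the join over all of \<open>E\<close> rather than over the ideal makes the condition
  visibly invariant under isomorphism.\<close>

lemma complement_in_iff:
  assumes e: "e \<in> E" and lat: "e \<noteq> \<zero> \<Longrightarrow> lattice (idem_ideal S e)"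
  shows "complement_in (idem_ideal S e) f g \<longleftrightarrow>
    f \<in> E \<and> g \<in> E \<and> f \<preceq> e \<and> g \<preceq> e \<and> f \<cdot> g = \<zero> \<and> (\<forall>h\<in>E. f \<preceq> h \<longrightarrow> g \<preceq> h \<longrightarrow> e \<preceq> h)"
    (is "?L \<longleftrightarrow> ?R")
proof -
  let ?I = "idem_ideal S e"
  have "f \<squnion>\<^bsub>?I\<^esub> g = e \<longleftrightarrow> (\<forall>h\<in>E. f \<preceq> h \<longrightarrow> g \<preceq> h \<longrightarrow> e \<preceq> h)"
    if fg: "f \<in> E" "g \<in> E" "f \<preceq> e" "g \<preceq> e"
  proof
    assume *: "f \<squnion>\<^bsub>?I\<^esub> g = e"
    have lub: "least ?I e (Upper ?I {f, g})"
    \<comment> \<open>The Boolean condition speaks of nonzero idempotents only, so the one-point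
      ideal below zero is checked directly.\<close>
    proof (cases "e = \<zero>")
      case True
      then show ?thesis
        using fg by (subst least_Upper_pair_iff) (simp_all add: le_zero)
    next
      case False
      then interpret lattice ?I
        by (rule lat)
      show ?thesis
        using sup_of_two_least[of f g] * fg by (simp add: join_def)
    qed
    show "\<forall>h\<in>E. f \<preceq> h \<longrightarrow> g \<preceq> h \<longrightarrow> e \<preceq> h"
    proof (intro ballI impI)
      fix h assume h: "h \<in> E" "f \<preceq> h" "g \<preceq> h"
      \<comment> \<open>An upper bound \<open>h\<close> outside the ideal is cut down to
        \<open>h \<cdot> e\<close>, which lies inside it.\<close>
      then have "f \<preceq> h \<cdot> e" "g \<preceq> h \<cdot> e" "h \<cdot> e \<in> E" "h \<cdot> e \<preceq> e"
        using fg e by (auto simp: idem_mult_greatest)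
      then have "e \<preceq> h \<cdot> e"
        using lub fg by (auto simp: least_Upper_pair_iff)
      then show "e \<preceq> h"
        using h e by (simp add: idem_mult_greatest)
    qed
  next
    assume "\<forall>h\<in>E. f \<preceq> h \<longrightarrow> g \<preceq> h \<longrightarrow> e \<preceq> h"
    then show "f \<squnion>\<^bsub>?I\<^esub> g = e"
      using fg e
      by (intro partial_order.join_eqI[OF partial_order_idem_ideal])
        (auto simp: least_Upper_pair_iff)
  qed
  then show ?thesis
    using e by (auto simp: complement_in_def bottom_idem_ideal top_idem_ideal meet_idem_ideal)
qed

end

locale graded_boolean_semigroup = inv_semigroup S
  for S :: "('s, 'c) graded_semigroup" (structure) +
  fixes \<Gamma> :: "('c, 'm) monoid_scheme"
  assumes group: "group \<Gamma>"
    and graded: "is_graded_semigroup \<Gamma> S"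
    and lower_semilattice: "lower_semilattice (nat_order S)"
    and boolean: "graded_boolean \<Gamma> S"

lemma GrIS_ob_iff:
  "group \<Gamma> \<Longrightarrow> S \<in> GrIS_ob \<Gamma> \<longleftrightarrow> graded_boolean_semigroup S \<Gamma>"
  by (auto simp: GrIS_ob_def graded_boolean_semigroup_def graded_boolean_semigroup_axioms_def
      inv_semigroup_def)

section \<open>Meets and ultrafilters\<close>

context graded_boolean_semigroup
begin

abbreviation nmeet :: "'s \<Rightarrow> 's \<Rightarrow> 's" (infixl \<open>\<triangle>\<close> 70) where
  "x \<triangle> y \<equiv> x \<sqinter>\<^bsub>nat_order S\<^esub> y"

lemma meet_closed [simp, intro]: "x \<in> carrier S \<Longrightarrow> y \<in> carrier S \<Longrightarrow> x \<triangle> y \<in> carrier S"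
  and meet_left [simp, intro]: "x \<in> carrier S \<Longrightarrow> y \<in> carrier S \<Longrightarrow> x \<triangle> y \<preceq> x"
  and meet_right [simp, intro]: "x \<in> carrier S \<Longrightarrow> y \<in> carrier S \<Longrightarrow> x \<triangle> y \<preceq> y"
  and meet_greatest: "z \<preceq> x \<Longrightarrow> z \<preceq> y \<Longrightarrow> x \<in> carrier S \<Longrightarrow> y \<in> carrier S \<Longrightarrow> z \<preceq> x \<triangle> y"
proof -
  interpret L: lower_semilattice "nat_order S"
    by (rule lower_semilattice)
  show "x \<in> carrier S \<Longrightarrow> y \<in> carrier S \<Longrightarrow> x \<triangle> y \<in> carrier S"
    and "x \<in> carrier S \<Longrightarrow> y \<in> carrier S \<Longrightarrow> x \<triangle> y \<preceq> x"
    and "x \<in> carrier S \<Longrightarrow> y \<in> carrier S \<Longrightarrow> x \<triangle> y \<preceq> y"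
    and "z \<preceq> x \<Longrightarrow> z \<preceq> y \<Longrightarrow> x \<in> carrier S \<Longrightarrow> y \<in> carrier S \<Longrightarrow> z \<preceq> x \<triangle> y"
    using L.meet_closed[of x y] L.meet_left[of x y] L.meet_right[of x y] L.meet_le[of z x y]
      le_closed[of z x]
    by simp_all
qed

lemma meet_zeroI:
  assumes "x \<triangle> y = \<zero>" "z \<preceq> x" "z \<preceq> y" "x \<in> carrier S" "y \<in> carrier S"
  shows "z = \<zero>"
  using assms meet_greatest[of z x y] le_zero by simp

lemma filt_meet: "filt X \<Longrightarrow> x \<in> X \<Longrightarrow> y \<in> X \<Longrightarrow> x \<triangle> y \<in> X"
proof -
  assume X: "filt X" "x \<in> X" "y \<in> X"
  then obtain z where "z \<in> X" "z \<preceq> x" "z \<preceq> y"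
    using filt_directed by blast
  moreover have "x \<in> carrier S" "y \<in> carrier S"
    using X filt_closed by auto
  ultimately show ?thesis
    using X filt_upward[of X z "x \<triangle> y"] meet_greatest by auto
qed

text \<open>Otherwise the meets of \<open>t\<close> with the elements of \<open>X\<close> form a
  filter base, and the filter it generates contains both \<open>X\<close> and \<open>t\<close>,
  against maximality.\<close>

lemma uf_meet_zero:
  assumes X: "X \<in> ultrafilters S" and t: "t \<in> carrier S" "t \<notin> X"
  shows "\<exists>x\<in>X. x \<triangle> t = \<zero>"
proof (rule ccontr)
  assume no: "\<not> (\<exists>x\<in>X. x \<triangle> t = \<zero>)"
  have fX: "filt X"
    using X uf_filt by simp
  then have C: "x \<in> carrier S" if "x \<in> X" for x
    using that filt_closed by simp
  let ?W = "{s \<in> carrier S. \<exists>x\<in>(\<lambda>x. x \<triangle> t) ` X. x \<preceq> s}"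
  obtain x0 where x0: "x0 \<in> X"
    using filt_nonempty[OF fX] ..
  have "filt ?W"
  proof (rule filt_up)
    show "x0 \<triangle> t \<in> (\<lambda>x. x \<triangle> t) ` X" "(\<lambda>x. x \<triangle> t) ` X \<subseteq> carrier S" "\<zero> \<notin> (\<lambda>x. x \<triangle> t) ` X"
      using x0 C t no by force+
    show "\<exists>z\<in>(\<lambda>x. x \<triangle> t) ` X. z \<preceq> x \<and> z \<preceq> y"
      if xy: "x \<in> (\<lambda>x. x \<triangle> t) ` X" "y \<in> (\<lambda>x. x \<triangle> t) ` X" for x y
    proof -
      obtain a b where ab: "a \<in> X" "b \<in> X" "x = a \<triangle> t" "y = b \<triangle> t"
        using xy by auto
      obtain c where c: "c \<in> X" "c \<preceq> a" "c \<preceq> b"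
        using filt_directed[OF fX ab(1,2)] by blast
      have "c \<triangle> t \<preceq> a" "c \<triangle> t \<preceq> b"
        using le_trans[OF meet_left c(2)] le_trans[OF meet_left c(3)] C c ab t by auto
      then have "c \<triangle> t \<preceq> x" "c \<triangle> t \<preceq> y"
        using ab c t C by (auto intro: meet_greatest)
      then show ?thesis
        using c by blast
    qed
  qed
  moreover have "X \<subseteq> ?W"
  proof
    fix x assume "x \<in> X"
    then show "x \<in> ?W"
      using C t meet_left[of x t] by blast
  qed
  ultimately have "?W = X"
    by (rule uf_max[OF X])
  moreover have "t \<in> ?W"
    using C t x0 meet_right[of x0 t] by blast
  ultimately show False
    using t by simp
qed

section \<open>Complements and differences\<close>

lemma lattice_idem_ideal: "e \<in> E \<Longrightarrow> e \<noteq> \<zero> \<Longrightarrow> lattice (idem_ideal S e)"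
  using boolean unfolding graded_boolean_def boolean_lattice_def bounded_lattice_def by blast

lemma complement_iff:
  "e \<in> E \<Longrightarrow> complement_in (idem_ideal S e) f g \<longleftrightarrow>
    f \<in> E \<and> g \<in> E \<and> f \<preceq> e \<and> g \<preceq> e \<and> f \<cdot> g = \<zero> \<and> (\<forall>h\<in>E. f \<preceq> h \<longrightarrow> g \<preceq> h \<longrightarrow> e \<preceq> h)"
  by (rule complement_in_iff) (auto intro: lattice_idem_ideal)

lemma complement_exists:
  assumes "e \<in> E" "f \<in> E" "f \<preceq> e"
  shows "\<exists>g. complement_in (idem_ideal S e) f g"
proof (cases "e = \<zero>")
  case True
  then have "f = \<zero>"
    using assms le_zero by simp
  then show ?thesis
    using True assms by (auto simp: complement_iff)
next
  case False
  then show ?thesis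
    using assms boolean unfolding graded_boolean_def boolean_lattice_def by auto
qed

text \<open>Distributivity: \<open>h\<close> is its meet with the join of \<open>f\<close> and
  \<open>g\<close>, and its part in \<open>f\<close> vanishes.\<close>

lemma complement_maximal:
  assumes e: "e \<in> E" and fg: "complement_in (idem_ideal S e) f g"
    and h: "h \<in> E" "h \<preceq> e" "h \<cdot> f = \<zero>"
  shows "h \<preceq> g"
proof (cases "e = \<zero>")
  case True
  then show ?thesis
    using h fg e by (auto simp: le_zero complement_iff)
next
  case False
  let ?I = "idem_ideal S e"
  have *: "bounded_lattice ?I" "distributive_lattice ?I"
    using boolean e False unfolding graded_boolean_def boolean_lattice_def by auto
  interpret I: bounded_lattice ?I
    by (rule *)
  have FG: "f \<in> E" "g \<in> E" "f \<preceq> e" "g \<preceq> e" "f \<squnion>\<^bsub>?I\<^esub> g = e"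
    using fg e unfolding complement_in_def by (simp_all add: top_idem_ideal)
  have "h \<cdot> g \<preceq> e"
    using h FG e le_trans[of "h \<cdot> g" g e] by auto
  have "h = h \<sqinter>\<^bsub>?I\<^esub> (f \<squnion>\<^bsub>?I\<^esub> g)"
    using h FG e idem_le_iff[of h e] idem_comm[of e h] by (simp add: meet_idem_ideal)
  also have "\<dots> = (h \<sqinter>\<^bsub>?I\<^esub> f) \<squnion>\<^bsub>?I\<^esub> (h \<sqinter>\<^bsub>?I\<^esub> g)"
    using *(2) h(1,2) FG(1-4) unfolding distributive_lattice_def by simp
  also have "\<dots> = \<bottom>\<^bsub>?I\<^esub> \<squnion>\<^bsub>?I\<^esub> (h \<cdot> g)"
    using h FG e by (simp add: meet_idem_ideal bottom_idem_ideal)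
  also have "\<dots> = h \<cdot> g"
    using I.bottom_join[of "h \<cdot> g"] \<open>h \<cdot> g \<preceq> e\<close> h FG by simp
  finally show ?thesis
    using h FG idem_mult_le[of g h] by simp
qed

text \<open>\<open>s \<cdot> g\<close> is the difference \<open>s - a\<close> in the Boolean algebra of elements below \<open>s\<close>.\<close>

lemma difference:
  assumes s: "s \<in> carrier S" and a: "a \<preceq> s"
    and g: "complement_in (idem_ideal S (\<iota> s \<cdot> s)) (\<iota> a \<cdot> a) g"
  shows "s \<cdot> g \<preceq> s" "a \<triangle> (s \<cdot> g) = \<zero>"
    "y \<preceq> s \<Longrightarrow> y \<triangle> a = \<zero> \<Longrightarrow> y \<preceq> s \<cdot> g"
    "s \<cdot> g = \<zero> \<Longrightarrow> a = s"
proof -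
  have aC [simp]: "a \<in> carrier S"
    using a s le_closed by blast
  have G: "g \<in> E" "g \<preceq> \<iota> s \<cdot> s" "\<iota> a \<cdot> a \<cdot> g = \<zero>"
      "\<And>h. h \<in> E \<Longrightarrow> \<iota> a \<cdot> a \<preceq> h \<Longrightarrow> g \<preceq> h \<Longrightarrow> \<iota> s \<cdot> s \<preceq> h"
    using g s by (auto simp: complement_iff)
  \<comment> \<open>As \<open>g\<close> lies below the domain idempotent of \<open>s\<close>, it is
    itself the domain idempotent of \<open>s \<cdot> g\<close>, so questions about
    \<open>s \<cdot> g\<close> can be settled on \<open>g\<close>.\<close>
  have dsg: "\<iota> (s \<cdot> g) \<cdot> (s \<cdot> g) = g"
  proof -
    have "\<iota> (s \<cdot> g) \<cdot> (s \<cdot> g) = g \<cdot> ((\<iota> s \<cdot> s) \<cdot> g)"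
      using s G by (simp add: sinv_mult smult_assoc)
    also have "\<dots> = g"
      using s G(1,2) idem_le_iff[of g "\<iota> s \<cdot> s"] by simp
    finally show ?thesis .
  qed
  show sg: "s \<cdot> g \<preceq> s"
    using s G by simp
  show "a \<triangle> (s \<cdot> g) = \<zero>"
  proof -
    define z where "z = a \<triangle> (s \<cdot> g)"
    have z: "z \<preceq> a" "z \<preceq> s \<cdot> g" "z \<in> carrier S"
      using s G by (auto simp: z_def)
    then have "\<iota> z \<cdot> z \<preceq> \<iota> a \<cdot> a" "\<iota> z \<cdot> z \<preceq> g"
      using le_dom_mono[of z a] le_dom_mono[of z "s \<cdot> g"] s G dsg by auto
    then have "\<iota> z \<cdot> z \<preceq> \<zero>"
      using z G idem_mult_greatest[of "\<iota> a \<cdot> a" g "\<iota> z \<cdot> z"] by simp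
    then show ?thesis
      using dom_zero z by (simp add: z_def le_zero)
  qed
  show "y \<preceq> s \<cdot> g" if y: "y \<preceq> s" "y \<triangle> a = \<zero>"
  proof -
    have yC: "y \<in> carrier S"
      using y s le_closed by blast
    \<comment> \<open>\<open>?e\<close> is the common domain of \<open>y\<close> and
      \<open>a\<close>. Both are restrictions of \<open>s\<close>, so they agree there:
      \<open>s \<cdot> ?e\<close> lies below each of them, hence is zero, and with it
      \<open>?e\<close>.\<close>
    let ?e = "(\<iota> y \<cdot> y) \<cdot> (\<iota> a \<cdot> a)"
    have eE: "?e \<in> E"
      using yC by auto
    have "s \<cdot> ?e = (s \<cdot> (\<iota> y \<cdot> y)) \<cdot> (\<iota> a \<cdot> a)"
      using s yC by (simp add: smult_assoc)
    then have 1: "s \<cdot> ?e = y \<cdot> (\<iota> a \<cdot> a)"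
      using le_dom y s by simp
    have "?e = (\<iota> a \<cdot> a) \<cdot> (\<iota> y \<cdot> y)"
      using yC by (intro idem_comm) auto
    then have "s \<cdot> ?e = (s \<cdot> (\<iota> a \<cdot> a)) \<cdot> (\<iota> y \<cdot> y)"
      using s yC by (simp add: smult_assoc)
    then have 2: "s \<cdot> ?e = a \<cdot> (\<iota> y \<cdot> y)"
      using le_dom a s by simp
    have "s \<cdot> ?e \<preceq> y"
      unfolding 1 using yC by simp
    moreover have "s \<cdot> ?e \<preceq> a"
      unfolding 2 using yC by simp
    ultimately have "s \<cdot> ?e = \<zero>"
      using meet_zeroI[OF y(2)] yC aC by blast
    then have "\<iota> s \<cdot> (s \<cdot> ?e) = \<zero>"
      using s by simp
    moreover have "\<iota> s \<cdot> (s \<cdot> ?e) = ?e"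
    proof -
      have "(\<iota> s \<cdot> s) \<cdot> (\<iota> y \<cdot> y) = \<iota> y \<cdot> y"
        using le_dom_mono[OF y(1) s] idem_le_iff s yC by simp
      then have "((\<iota> s \<cdot> s) \<cdot> (\<iota> y \<cdot> y)) \<cdot> (\<iota> a \<cdot> a) = ?e"
        by simp
      then show ?thesis
        using s yC by (simp add: smult_assoc)
    qed
    ultimately have "?e = \<zero>"
      by simp
    then have "\<iota> y \<cdot> y \<preceq> g"
      using complement_maximal[OF _ g] s yC le_dom_mono[OF y(1) s] by simp
    then have "s \<cdot> (\<iota> y \<cdot> y) \<preceq> s \<cdot> g"
      using s G by (intro le_mult) auto
    then show ?thesis
      using le_dom y s by simp
  qed
  show "a = s" if "s \<cdot> g = \<zero>"
  proof -
    have "g = \<zero>"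
      using dsg that by simp
    then have "\<iota> s \<cdot> s \<preceq> \<iota> a \<cdot> a"
      using G by simp
    then have "s \<cdot> (\<iota> s \<cdot> s) \<preceq> s \<cdot> (\<iota> a \<cdot> a)"
      using s by (intro le_mult[of s s "\<iota> s \<cdot> s" "\<iota> a \<cdot> a"]) auto
    then have "s \<preceq> a"
      using le_dom[OF a s] s by simp
    then show ?thesis
      using le_antisym a aC by blast
  qed
qed

text \<open>If \<open>a \<notin> X\<close>, some \<open>x \<in> X\<close> has meet zero with
  \<open>a\<close>. Then \<open>x \<triangle> s\<close> belongs to \<open>X\<close>, is still
  disjoint from \<open>a\<close>, and so lies below the difference.\<close>

lemma uf_difference:
  assumes X: "X \<in> ultrafilters S" and s: "s \<in> X" and a: "a \<preceq> s"
    and g: "complement_in (idem_ideal S (\<iota> s \<cdot> s)) (\<iota> a \<cdot> a) g"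
  shows "a \<in> X \<or> s \<cdot> g \<in> X"
proof -
  have fX: "filt X"
    using X uf_filt by simp
  have sC: "s \<in> carrier S"
    using filt_closed[OF fX s] .
  have aC: "a \<in> carrier S"
    using le_closed[OF a sC] .
  have "s \<cdot> g \<in> X" if a': "a \<notin> X"
  proof -
    obtain x where x: "x \<in> X" "x \<triangle> a = \<zero>"
      using uf_meet_zero[OF X aC a'] by blast
    have xC: "x \<in> carrier S"
      using filt_closed[OF fX x(1)] .
    have y: "x \<triangle> s \<in> X"
      using filt_meet[OF fX x(1) s] .
    have "(x \<triangle> s) \<triangle> a \<preceq> x" "(x \<triangle> s) \<triangle> a \<preceq> a"
      using le_trans[OF meet_left meet_left] xC sC aC by auto
    then have "(x \<triangle> s) \<triangle> a = \<zero>"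
      using meet_zeroI[OF x(2)] xC aC by blast
    then have "x \<triangle> s \<preceq> s \<cdot> g"
      using difference(3)[OF sC a g] xC sC by simp
    moreover have "s \<cdot> g \<in> carrier S"
      using le_closed[OF difference(1)[OF sC a g] sC] .
    ultimately show ?thesis
      using filt_upward[OF fX y] by simp
  qed
  then show ?thesis
    by blast
qed

text \<open>Hides the complement \<open>g\<close>, which matters only when a difference is
  transported along a morphism.\<close>

lemma difference_exists:
  assumes s: "s \<in> carrier S" and a: "a \<preceq> s"
  obtains c where "c \<in> carrier S" "c \<preceq> s" "a \<triangle> c = \<zero>" "\<And>y. y \<preceq> s \<Longrightarrow> y \<triangle> a = \<zero> \<Longrightarrow> y \<preceq> c"
    "c = \<zero> \<Longrightarrow> a = s" "\<And>X. X \<in> ultrafilters S \<Longrightarrow> s \<in> X \<Longrightarrow> a \<in> X \<or> c \<in> X"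
proof -
  have "a \<in> carrier S"
    using a s le_closed by blast
  then obtain g where g: "complement_in (idem_ideal S (\<iota> s \<cdot> s)) (\<iota> a \<cdot> a) g"
    using complement_exists[of "\<iota> s \<cdot> s" "\<iota> a \<cdot> a"] le_dom_mono[OF a s] s by auto
  note d = difference[OF s a g]
  show ?thesis
    by (rule that[of "s \<cdot> g"]) (use d le_closed[OF d(1) s] uf_difference[OF _ _ a g] in auto)
qed

text \<open>Suppose a filter \<open>Z\<close> above \<open>X\<close> contains \<open>z\<close>, with
  \<open>s \<triangle> z\<close> outside \<open>X\<close>. The hypothesis supplies an element of
  \<open>X\<close>, hence of \<open>Z\<close>, disjoint from \<open>s \<triangle> z\<close>, which
  belongs to \<open>Z\<close> as well.\<close>

lemma uf_criterion:
  assumes X: "filt X"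
    and diff: "\<And>s a. s \<in> X \<Longrightarrow> a \<preceq> s \<Longrightarrow> a \<notin> X \<Longrightarrow> \<exists>c\<in>X. a \<triangle> c = \<zero>"
  shows "X \<in> ultrafilters S"
proof (rule ufI)
  show "filt X"
    by (rule X)
  fix Z assume Z: "filt Z" "X \<subseteq> Z"
  show "Z \<subseteq> X"
  proof
    fix z assume z: "z \<in> Z"
    obtain s where s: "s \<in> X"
      using filt_nonempty[OF X] ..
    have C: "s \<in> carrier S" "z \<in> carrier S"
      using s z Z X filt_closed by auto
    have m: "s \<triangle> z \<in> Z"
      using filt_meet[OF Z(1)] s z Z(2) by blast
    have "s \<triangle> z \<in> X"
    proof (rule ccontr)
      assume "s \<triangle> z \<notin> X"
      then obtain c where "c \<in> X" "(s \<triangle> z) \<triangle> c = \<zero>"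
        using diff[OF s, of "s \<triangle> z"] C by auto
      then show False
        using filt_meet[OF Z(1) m, of c] Z filt_not_zero[OF Z(1)] by auto
    qed
    then show "z \<in> X"
      using filt_upward[OF X _ meet_right] C by blast
  qed
qed

lemma uf_disjoint: "filt X \<Longrightarrow> x \<in> X \<Longrightarrow> y \<in> X \<Longrightarrow> x \<triangle> y \<noteq> \<zero>"
  using filt_meet[of X x y] filt_not_zero by auto

text \<open>If the difference of \<open>s\<close> and \<open>s \<triangle> t\<close> were nonzero,
  an ultrafilter through it would contain \<open>s\<close> but not \<open>t\<close>. The injectivity
  of \<open>nu\<close> rests on this.\<close>

lemma uf_at_subset_iff:
  assumes C: "s \<in> carrier S" "t \<in> carrier S"
  shows "ultrafilters_at S s \<subseteq> ultrafilters_at S t \<longleftrightarrow> s \<preceq> t"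
proof
  show "ultrafilters_at S s \<subseteq> ultrafilters_at S t" if "s \<preceq> t"
    using that C filt_upward by (auto simp: ultrafilters_at_def)
  assume sub: "ultrafilters_at S s \<subseteq> ultrafilters_at S t"
  obtain c where c: "c \<in> carrier S" "c \<preceq> s" "(s \<triangle> t) \<triangle> c = \<zero>" "c = \<zero> \<Longrightarrow> s \<triangle> t = s"
    by (rule difference_exists[OF C(1) meet_left[OF C]]) blast
  have "c = \<zero>"
  proof (rule ccontr)
    assume "c \<noteq> \<zero>"
    then obtain X where X: "X \<in> ultrafilters S" "c \<in> X"
      using uf_containing c by blast
    have fX: "filt X"
      using X uf_filt by simp
    have "s \<in> X"
      using filt_upward[OF fX X(2) c(2) C(1)] .
    moreover from this have "t \<in> X"
      using sub X by (auto simp: ultrafilters_at_def)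
    ultimately have "s \<triangle> t \<in> X"
      using filt_meet[OF fX] by blast
    then show False
      using uf_disjoint[OF fX _ X(2)] c by blast
  qed
  then show "s \<preceq> t"
    using c(4) meet_right[OF C] by simp
qed

text \<open>If both \<open>s\<close> and \<open>t\<close> were missing, meets would give
  \<open>z \<in> Y\<close> below \<open>j\<close> and disjoint from both. The difference of
  \<open>j\<close> and \<open>z\<close> then bounds \<open>s\<close> and \<open>t\<close>, hence
  also \<open>j\<close>, so \<open>z\<close> lies below an element disjoint from it.\<close>

lemma uf_lub:
  assumes j: "least (nat_order S) j (Upper (nat_order S) {s, t})"
    and C: "s \<in> carrier S" "t \<in> carrier S"
    and Y: "Y \<in> ultrafilters S" "j \<in> Y"
  shows "s \<in> Y \<or> t \<in> Y"
proof (rule ccontr)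
  assume "\<not> (s \<in> Y \<or> t \<in> Y)"
  then obtain x y where x: "x \<in> Y" "x \<triangle> s = \<zero>" and y: "y \<in> Y" "y \<triangle> t = \<zero>"
    using uf_meet_zero Y C by meson
  have J: "j \<in> carrier S" "s \<preceq> j" "t \<preceq> j" "\<And>u. u \<in> carrier S \<Longrightarrow> s \<preceq> u \<Longrightarrow> t \<preceq> u \<Longrightarrow> j \<preceq> u"
    using j C by (auto simp: least_Upper_pair_iff)
  have fY: "filt Y"
    using Y uf_filt by simp
  define z where "z = j \<triangle> (x \<triangle> y)"
  have zY: "z \<in> Y"
    using filt_meet[OF fY Y(2) filt_meet[OF fY x(1) y(1)]] by (simp add: z_def)
  have xC: "x \<in> carrier S" "y \<in> carrier S" and zC: "z \<in> carrier S"
    using x y zY filt_closed[OF fY] by auto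
  have zle: "z \<preceq> j" "z \<preceq> x" "z \<preceq> y"
    using J xC le_trans[OF meet_right[of j "x \<triangle> y"] meet_left[of x y]]
      le_trans[OF meet_right[of j "x \<triangle> y"] meet_right[of x y]]
    by (auto simp: z_def)
  obtain c where c: "c \<in> carrier S" "z \<triangle> c = \<zero>" "\<And>y. y \<preceq> j \<Longrightarrow> y \<triangle> z = \<zero> \<Longrightarrow> y \<preceq> c"
    by (rule difference_exists[OF J(1) zle(1)]) blast
  have "s \<triangle> z = \<zero>"
    using meet_zeroI[OF x(2), of "s \<triangle> z"] le_trans[OF meet_right zle(2), of s] C zC xC by auto
  moreover have "t \<triangle> z = \<zero>"
    using meet_zeroI[OF y(2), of "t \<triangle> z"] le_trans[OF meet_right zle(3), of t] C zC xC by auto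
  ultimately have "j \<preceq> c"
    using c J by blast
  then have "z \<preceq> c"
    using le_trans[OF zle(1)] c by blast
  then have "z = \<zero>"
    using meet_zeroI[OF c(2)] zC c(1) by blast
  then show False
    using zY filt_not_zero[OF fY] by simp
qed

end

section \<open>Groupoids\<close>

locale groupoid =
  fixes G :: "('a, 'c) graded_groupoid" (structure)
  assumes is_groupoid: "is_groupoid G"
begin

abbreviation d :: "'a \<Rightarrow> 'a" where "d \<equiv> gdom G"
abbreviation r :: "'a \<Rightarrow> 'a" where "r \<equiv> gran G"
abbreviation \<iota> :: "'a \<Rightarrow> 'a" where "\<iota> \<equiv> ginv G"

lemma gdom_closed [simp, intro]: "x \<in> carrier G \<Longrightarrow> d x \<in> carrier G"
  and gran_closed [simp, intro]: "x \<in> carrier G \<Longrightarrow> r x \<in> carrier G"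
  and gdom_gdom [simp]: "x \<in> carrier G \<Longrightarrow> d (d x) = d x"
  and gran_gdom [simp]: "x \<in> carrier G \<Longrightarrow> r (d x) = d x"
  and gdom_gran [simp]: "x \<in> carrier G \<Longrightarrow> d (r x) = r x"
  and gran_gran [simp]: "x \<in> carrier G \<Longrightarrow> r (r x) = r x"
  and mult_gdom [simp]: "x \<in> carrier G \<Longrightarrow> x \<bullet> d x = x"
  and gran_mult [simp]: "x \<in> carrier G \<Longrightarrow> r x \<bullet> x = x"
  and ginv_closed [simp, intro]: "x \<in> carrier G \<Longrightarrow> \<iota> x \<in> carrier G"
  and gdom_ginv [simp]: "x \<in> carrier G \<Longrightarrow> d (\<iota> x) = r x"
  and gran_ginv [simp]: "x \<in> carrier G \<Longrightarrow> r (\<iota> x) = d x"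
  using is_groupoid unfolding is_groupoid_def by simp_all

lemma composable_iff [simp]:
  "(x, y) \<in> composable G \<longleftrightarrow> x \<in> carrier G \<and> y \<in> carrier G \<and> d x = r y"
  by (simp add: composable_def)

lemma gmult_closed [simp, intro]:
    "x \<in> carrier G \<Longrightarrow> y \<in> carrier G \<Longrightarrow> d x = r y \<Longrightarrow> x \<bullet> y \<in> carrier G"
  and gdom_gmult [simp]:
    "x \<in> carrier G \<Longrightarrow> y \<in> carrier G \<Longrightarrow> d x = r y \<Longrightarrow> d (x \<bullet> y) = d y"
  and gran_gmult [simp]:
    "x \<in> carrier G \<Longrightarrow> y \<in> carrier G \<Longrightarrow> d x = r y \<Longrightarrow> r (x \<bullet> y) = r x"
proof -
  have "\<forall>(x, y)\<in>composable G. x \<bullet> y \<in> carrier G \<and> d (x \<bullet> y) = d y \<and> r (x \<bullet> y) = r x"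
    using is_groupoid unfolding is_groupoid_def by (elim conjE)
  then show "x \<in> carrier G \<Longrightarrow> y \<in> carrier G \<Longrightarrow> d x = r y \<Longrightarrow> x \<bullet> y \<in> carrier G"
    "x \<in> carrier G \<Longrightarrow> y \<in> carrier G \<Longrightarrow> d x = r y \<Longrightarrow> d (x \<bullet> y) = d y"
    "x \<in> carrier G \<Longrightarrow> y \<in> carrier G \<Longrightarrow> d x = r y \<Longrightarrow> r (x \<bullet> y) = r x"
    unfolding Ball_def by (simp_all add: split_paired_all)
qed

lemma gmult_assoc:
  assumes "x \<in> carrier G" "y \<in> carrier G" "z \<in> carrier G" "d x = r y" "d y = r z"
  shows "x \<bullet> y \<bullet> z = x \<bullet> (y \<bullet> z)"
proof -
  have "\<forall>x y z. (x, y) \<in> composable G \<and> (y, z) \<in> composable G \<longrightarrow> x \<bullet> y \<bullet> z = x \<bullet> (y \<bullet> z)"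
    using is_groupoid unfolding is_groupoid_def by (elim conjE)
  then show ?thesis
    using assms by simp
qed

lemma ginv_gmult [simp]: "\<iota> x \<bullet> x = d x"
  and gmult_ginv [simp]: "x \<bullet> \<iota> x = r x"
  by (simp_all add: gdom_def gran_def)

lemma gmult_gdom_eq [simp]: "x \<in> carrier G \<Longrightarrow> d x = u \<Longrightarrow> x \<bullet> u = x"
  and gran_gmult_eq [simp]: "x \<in> carrier G \<Longrightarrow> r x = u \<Longrightarrow> u \<bullet> x = x"
  using mult_gdom[of x] gran_mult[of x] by auto

lemma gmult_ginv_cancel [simp]:
  assumes "x \<in> carrier G" "y \<in> carrier G"
  shows "d x = r y \<Longrightarrow> (x \<bullet> y) \<bullet> \<iota> y = x"
    and "d x = d y \<Longrightarrow> (x \<bullet> \<iota> y) \<bullet> y = x"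
    and "r x = r y \<Longrightarrow> x \<bullet> (\<iota> x \<bullet> y) = y"
    and "d x = r y \<Longrightarrow> \<iota> x \<bullet> (x \<bullet> y) = y"
proof -
  show "d x = r y \<Longrightarrow> (x \<bullet> y) \<bullet> \<iota> y = x"
    using assms by (subst gmult_assoc) auto
  show "d x = d y \<Longrightarrow> (x \<bullet> \<iota> y) \<bullet> y = x"
    using assms by (subst gmult_assoc) auto
  show "r x = r y \<Longrightarrow> x \<bullet> (\<iota> x \<bullet> y) = y"
    using assms by (subst gmult_assoc[symmetric]) auto
  show "d x = r y \<Longrightarrow> \<iota> x \<bullet> (x \<bullet> y) = y"
    using assms by (subst gmult_assoc[symmetric]) auto
qed

lemma ginv_ginv [simp]:
  assumes [simp]: "x \<in> carrier G"
  shows "\<iota> (\<iota> x) = x"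
proof -
  have "\<iota> (\<iota> x) = \<iota> (\<iota> x) \<bullet> (\<iota> x \<bullet> x)"
    by (subst ginv_gmult, subst gmult_gdom_eq) simp_all
  also have "\<dots> = x"
    by (rule gmult_ginv_cancel(4)) simp_all
  finally show ?thesis .
qed

lemma ginv_unique:
  assumes "x \<in> carrier G" "y \<in> carrier G" "d x = r y" "x \<bullet> y = r x"
  shows "y = \<iota> x"
proof -
  have "y = \<iota> x \<bullet> (x \<bullet> y)"
    using assms(1-3) by simp
  also have "\<dots> = \<iota> x"
    unfolding assms(4) using assms(1) by simp
  finally show ?thesis .
qed

lemma gunits_iff: "u \<in> gunits G \<longleftrightarrow> u \<in> carrier G \<and> d u = u"
  unfolding gunits_def by (auto simp: image_iff) (metis)

lemma gunits_closed [intro]: "u \<in> gunits G \<Longrightarrow> u \<in> carrier G"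
  and gdom_unit [simp]: "u \<in> gunits G \<Longrightarrow> d u = u"
  by (simp_all add: gunits_iff)

lemma gran_unit [simp]: "u \<in> gunits G \<Longrightarrow> r u = u"
  by (metis gran_gdom gunits_iff)

lemma gdom_gunits [simp, intro]: "x \<in> carrier G \<Longrightarrow> d x \<in> gunits G"
  and gran_gunits [simp, intro]: "x \<in> carrier G \<Longrightarrow> r x \<in> gunits G"
  by (simp_all add: gunits_iff)

lemma idempotent_unit:
  assumes "x \<in> carrier G" "d x = r x" "x \<bullet> x = x"
  shows "x \<in> gunits G"
  using assms gmult_ginv_cancel(4)[of x x] gdom_gunits[of x] by simp

end

section \<open>The topology of the ultrafilter groupoid\<close>

context graded_boolean_semigroup
begin

sublocale UG: groupoid "UG S"
  by unfold_locales (rule is_groupoid_UG)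

section \<open>The basic open sets\<close>

abbreviation uf_at :: "'s \<Rightarrow> 's set set" where "uf_at \<equiv> ultrafilters_at S"

lemma mem_uf_at: "X \<in> uf_at s \<longleftrightarrow> X \<in> ultrafilters S \<and> s \<in> X"
  by (simp add: ultrafilters_at_def)

lemma uf_at_subset: "uf_at s \<subseteq> ultrafilters S"
  by (auto simp: mem_uf_at)

lemma uf_closed: "X \<in> ultrafilters S \<Longrightarrow> s \<in> X \<Longrightarrow> s \<in> carrier S"
  using uf_filt filt_closed by blast

lemma uf_nonempty: "X \<in> ultrafilters S \<Longrightarrow> \<exists>s. s \<in> X"
  using uf_filt filt_nonempty by blast

lemma uf_at_meet: "s \<in> carrier S \<Longrightarrow> t \<in> carrier S \<Longrightarrow> uf_at s \<inter> uf_at t = uf_at (s \<triangle> t)"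
proof -
  assume C: "s \<in> carrier S" "t \<in> carrier S"
  have "s \<triangle> t \<in> X \<longleftrightarrow> s \<in> X \<and> t \<in> X" if "X \<in> ultrafilters S" for X
    using filt_meet[OF uf_filt[OF that], of s t] C
      filt_upward[OF uf_filt[OF that] _ meet_left[OF C]]
      filt_upward[OF uf_filt[OF that] _ meet_right[OF C]] by blast
  then show ?thesis
    by (auto simp: mem_uf_at)
qed

lemma uf_at_zero: "uf_at \<zero> = {}"
  using uf_filt filt_not_zero by (auto simp: mem_uf_at)

text \<open>Meets make the basic sets closed under intersection. The quantifier over
  \<open>s\<close> may be left unrestricted, because \<open>uf_at s\<close> is empty unless
  \<open>s\<close> lies in the carrier.\<close>

lemma openin_UG:
  "openin (gtop (UG S)) W \<longleftrightarrow> (\<forall>X\<in>W. \<exists>s. X \<in> uf_at s \<and> uf_at s \<subseteq> W)"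
proof -
  have "istopology (arbitrary union_of (\<lambda>U. \<exists>s\<in>carrier S. U = uf_at s))"
    by (rule istopology_base) (metis uf_at_meet meet_closed)
  then have "openin (gtop (UG S)) W \<longleftrightarrow>
      (\<forall>X\<in>W. \<exists>U. (\<exists>s\<in>carrier S. U = uf_at s) \<and> X \<in> U \<and> U \<subseteq> W)"
    by (simp add: UG_def arbitrary_union_of_alt)
  also have "\<dots> \<longleftrightarrow> (\<forall>X\<in>W. \<exists>s\<in>carrier S. X \<in> uf_at s \<and> uf_at s \<subseteq> W)"
    by blast
  also have "\<dots> \<longleftrightarrow> (\<forall>X\<in>W. \<exists>s. X \<in> uf_at s \<and> uf_at s \<subseteq> W)"
    using uf_closed mem_uf_at by meson
  finally show ?thesis .
qed

lemma openin_uf_at [simp, intro]: "openin (gtop (UG S)) (uf_at s)"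
  using openin_UG by blast

lemma topspace_UG [simp]: "topspace (gtop (UG S)) = ultrafilters S"
proof
  show "topspace (gtop (UG S)) \<subseteq> ultrafilters S"
    using openin_topspace[of "gtop (UG S)"] unfolding openin_UG by (auto simp: mem_uf_at)
  show "ultrafilters S \<subseteq> topspace (gtop (UG S))"
    using openin_subset[OF openin_uf_at] uf_nonempty by (fastforce simp: mem_uf_at)
qed

text \<open>Used for inversion, multiplication, the domain map, preimages along morphisms and
  \<open>mu\<close>: in each case whatever witnesses \<open>s \<in> f x\<close> is a witness for all
  nearby points too.\<close>

lemma continuous_map_into_UG:
  assumes "\<And>x. x \<in> topspace T \<Longrightarrow> f x \<in> ultrafilters S"
    and "\<And>x s. x \<in> topspace T \<Longrightarrow> s \<in> f x \<Longrightarrow>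
      \<exists>N. openin T N \<and> x \<in> N \<and> (\<forall>y\<in>N. s \<in> f y)"
  shows "continuous_map T (gtop (UG S)) f"
  unfolding continuous_map_def
proof (intro conjI allI impI)
  show "f \<in> topspace T \<rightarrow> topspace (gtop (UG S))"
    using assms(1) by simp
  fix W assume W: "openin (gtop (UG S)) W"
  show "openin T {x \<in> topspace T. f x \<in> W}"
  proof (subst openin_subopen, intro ballI)
    fix x assume x: "x \<in> {x \<in> topspace T. f x \<in> W}"
    then obtain s where s: "f x \<in> uf_at s" "uf_at s \<subseteq> W"
      using W openin_UG by blast
    then obtain N where N: "openin T N" "x \<in> N" "\<forall>y\<in>N. s \<in> f y"
      using assms(2)[of x s] x by (auto simp: mem_uf_at)
    have "y \<in> topspace T" "f y \<in> uf_at s" if "y \<in> N" for y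
      using that N openin_subset[OF N(1)] assms(1) by (auto simp: mem_uf_at)
    then have "N \<subseteq> {x \<in> topspace T. f x \<in> W}"
      using s(2) by blast
    then show "\<exists>N. openin T N \<and> x \<in> N \<and> N \<subseteq> {x \<in> topspace T. f x \<in> W}"
      using N by blast
  qed
qed

text \<open>If no finite part of an open cover \<open>\<U>\<close> covers \<open>uf_at s\<close>, then the \<open>c \<le> s\<close> such that
  finitely many members of \<open>\<U>\<close> cover \<open>uf_at s - uf_at c\<close> generate a filter; an ultrafilter
  extending it is missed by \<open>\<U>\<close>.\<close>

lemma compactin_uf_at:
  assumes s: "s \<in> carrier S"
  shows "compactin (gtop (UG S)) (uf_at s)"
  unfolding compactin_def
proof (intro conjI allI impI)
  show "uf_at s \<subseteq> topspace (gtop (UG S))"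
    using uf_at_subset by simp
  fix \<U> assume \<U>: "(\<forall>W\<in>\<U>. openin (gtop (UG S)) W) \<and> uf_at s \<subseteq> \<Union>\<U>"
  show "\<exists>\<F>. finite \<F> \<and> \<F> \<subseteq> \<U> \<and> uf_at s \<subseteq> \<Union>\<F>"
  proof (rule ccontr)
    assume no: "\<not> (\<exists>\<F>. finite \<F> \<and> \<F> \<subseteq> \<U> \<and> uf_at s \<subseteq> \<Union>\<F>)"
    define B where "B = {c \<in> carrier S. c \<preceq> s \<and>
      (\<exists>\<F>. finite \<F> \<and> \<F> \<subseteq> \<U> \<and> uf_at s \<subseteq> \<Union>\<F> \<union> uf_at c)}"
    have sB: "s \<in> B"
      using s by (auto simp: B_def intro!: exI[of _ "{}"])
    have "filt {t \<in> carrier S. \<exists>x\<in>B. x \<preceq> t}"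
    proof (rule filt_up)
      show "B \<subseteq> carrier S" "s \<in> B"
        using sB by (auto simp: B_def)
      show "\<zero> \<notin> B"
        using no by (auto simp: B_def uf_at_zero)
      fix x y assume "x \<in> B" "y \<in> B"
      then obtain \<F> \<F>' where x: "x \<in> carrier S" "x \<preceq> s" "finite \<F>" "\<F> \<subseteq> \<U>" "uf_at s \<subseteq> \<Union>\<F> \<union> uf_at x"
        and y: "y \<in> carrier S" "y \<preceq> s" "finite \<F>'" "\<F>' \<subseteq> \<U>" "uf_at s \<subseteq> \<Union>\<F>' \<union> uf_at y"
        by (auto simp: B_def)
      have "uf_at s \<subseteq> \<Union>(\<F> \<union> \<F>') \<union> uf_at (x \<triangle> y)"
        using x(5) y(5) uf_at_meet[OF x(1) y(1)] by blast
      moreover have "x \<triangle> y \<preceq> s"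
        using le_trans[OF meet_left x(2)] x y s by auto
      moreover have "finite (\<F> \<union> \<F>')" "\<F> \<union> \<F>' \<subseteq> \<U>"
        using x y by auto
      ultimately have "x \<triangle> y \<in> B"
        using x y unfolding B_def by blast
      then show "\<exists>z\<in>B. z \<preceq> x \<and> z \<preceq> y"
        using x y by blast
    qed
    then obtain Y where Y: "Y \<in> ultrafilters S" "{t \<in> carrier S. \<exists>x\<in>B. x \<preceq> t} \<subseteq> Y"
      by (rule uf_extend)
    have BY: "B \<subseteq> Y"
    proof
      fix x assume "x \<in> B"
      moreover from this have "x \<in> carrier S"
        by (simp add: B_def)
      ultimately show "x \<in> Y"
        using Y(2) le_refl by blast
    qed
    have sY: "s \<in> Y"
      using sB BY by blast
    then obtain W where W: "W \<in> \<U>" "Y \<in> W"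
      using Y \<U> by (auto simp: mem_uf_at)
    then have "openin (gtop (UG S)) W"
      using \<U> by blast
    then obtain t where t: "Y \<in> uf_at t" "uf_at t \<subseteq> W"
      unfolding openin_UG using W(2) by blast
    have tC: "t \<in> carrier S"
      using t(1) uf_closed by (auto simp: mem_uf_at)
    have fY: "filt Y"
      using Y uf_filt by simp
    have aY: "s \<triangle> t \<in> Y"
      using filt_meet[OF fY sY] t by (simp add: mem_uf_at)
    \<comment> \<open>\<open>W\<close> covers the part of \<open>uf_at s\<close> lying in
      \<open>uf_at (s \<triangle> t)\<close>, so the difference \<open>c\<close> is one of the
      elements of \<open>B\<close>, although it is disjoint from an element of
      \<open>Y\<close>.\<close>
    obtain c where c: "c \<in> carrier S" "c \<preceq> s" "(s \<triangle> t) \<triangle> c = \<zero>"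
        "\<And>X. X \<in> ultrafilters S \<Longrightarrow> s \<in> X \<Longrightarrow> s \<triangle> t \<in> X \<or> c \<in> X"
      by (rule difference_exists[OF s meet_left[OF s tC]]) blast
    have "uf_at s \<subseteq> \<Union>{W} \<union> uf_at c"
    proof
      fix X assume X: "X \<in> uf_at s"
      then have "X \<in> uf_at (s \<triangle> t) \<or> X \<in> uf_at c"
        using c(4)[of X] by (simp add: mem_uf_at)
      then show "X \<in> \<Union>{W} \<union> uf_at c"
        using t(2) uf_at_meet[OF s tC] by blast
    qed
    moreover have "finite {W}" "{W} \<subseteq> \<U>"
      using W by auto
    ultimately have "c \<in> B"
      using c(1,2) unfolding B_def by blast
    then have "c \<in> Y"
      using BY by blast
    then show False
      using uf_disjoint[OF fY aY] c(3) by blast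
  qed
qed

text \<open>Maximality gives \<open>t\<close> in \<open>Y\<close> but not in \<open>X\<close>, and
  then an element of \<open>X\<close> disjoint from \<open>t\<close>; disjoint elements have
  disjoint basic sets.\<close>

lemma Hausdorff_space_UG: "Hausdorff_space (gtop (UG S))"
  unfolding Hausdorff_space_def
proof (intro allI impI)
  fix X Y assume "X \<in> topspace (gtop (UG S)) \<and> Y \<in> topspace (gtop (UG S)) \<and> X \<noteq> Y"
  then have XY: "X \<in> ultrafilters S" "Y \<in> ultrafilters S" "X \<noteq> Y"
    by auto
  then obtain t where t: "t \<in> Y" "t \<notin> X"
    using uf_max[OF XY(2) uf_filt[OF XY(1)]] by blast
  have tC: "t \<in> carrier S"
    using uf_closed[OF XY(2) t(1)] .
  obtain x where x: "x \<in> X" "x \<triangle> t = \<zero>"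
    using uf_meet_zero[OF XY(1) tC t(2)] by blast
  have "x \<in> carrier S"
    using uf_closed[OF XY(1) x(1)] .
  then have "disjnt (uf_at x) (uf_at t)"
    using uf_at_meet[of x t] tC x uf_at_zero by (simp add: disjnt_def)
  then show "\<exists>U V. openin (gtop (UG S)) U \<and> openin (gtop (UG S)) V \<and> X \<in> U \<and> Y \<in> V \<and> disjnt U V"
    using XY x t by (intro exI[of _ "uf_at x"] exI[of _ "uf_at t"]) (simp add: mem_uf_at)
qed

lemma topological_groupoid_UG: "topological_groupoid (UG S)"
  unfolding topological_groupoid_def
proof (intro conjI)
  show "is_groupoid (UG S)"
    by (rule is_groupoid_UG)
  show "topspace (gtop (UG S)) = carrier (UG S)"
    by simp
  show "continuous_map (gtop (UG S)) (gtop (UG S)) (ginv (UG S))"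
  proof (rule continuous_map_into_UG)
    fix X assume X: "X \<in> topspace (gtop (UG S))"
    then show "ginv (UG S) X \<in> ultrafilters S"
      by (simp add: uf_sinv_image)
    fix s assume "s \<in> ginv (UG S) X"
    then obtain x where x: "x \<in> X" "s = \<iota> x"
      by auto
    then show "\<exists>N. openin (gtop (UG S)) N \<and> X \<in> N \<and> (\<forall>Y\<in>N. s \<in> ginv (UG S) Y)"
      using X by (intro exI[of _ "uf_at x"]) (auto simp: mem_uf_at)
  qed
  let ?P = "subtopology (prod_topology (gtop (UG S)) (gtop (UG S))) (composable (UG S))"
  show "continuous_map ?P (gtop (UG S)) (\<lambda>(X, Y). X \<star> Y)"
  proof (rule continuous_map_into_UG)
    fix p assume p: "p \<in> topspace ?P"
    then obtain X Y where XY: "p = (X, Y)" "X \<in> ultrafilters S" "Y \<in> ultrafilters S"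
        "gdom (UG S) X = gran (UG S) Y"
      by auto
    show "(case p of (X, Y) \<Rightarrow> X \<star> Y) \<in> ultrafilters S"
      using XY UG.gmult_closed[of X Y] by simp
    fix s assume "s \<in> (case p of (X, Y) \<Rightarrow> X \<star> Y)"
    then obtain x y where s: "s \<in> carrier S" "x \<in> X" "y \<in> Y" "x \<cdot> y \<preceq> s"
      using XY by (auto simp: mem_ufprod)
    let ?N = "(uf_at x \<times> uf_at y) \<inter> composable (UG S)"
    have "openin ?P ?N"
      by (simp add: openin_subtopology_Int openin_prod_Times_iff)
    moreover have "p \<in> ?N"
      using XY s by (simp add: mem_uf_at)
    moreover have "s \<in> (case q of (X, Y) \<Rightarrow> X \<star> Y)" if "q \<in> ?N" for q
    proof -
      obtain X' Y' where q: "q = (X', Y')"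
        by (cases q)
      then have "x \<in> X'" "y \<in> Y'"
        using that by (simp_all add: mem_uf_at)
      then have "s \<in> X' \<star> Y'"
        using s unfolding mem_ufprod by blast
      then show ?thesis
        using q by simp
    qed
    ultimately show "\<exists>N. openin ?P N \<and> p \<in> N \<and> (\<forall>q\<in>N. s \<in> (case q of (X, Y) \<Rightarrow> X \<star> Y))"
      by blast
  qed
qed

lemma gdom_uf_at: "s \<in> carrier S \<Longrightarrow> gdom (UG S) ` uf_at s = uf_at (\<iota> s \<cdot> s)"
proof (intro equalityI subsetI)
  assume s: "s \<in> carrier S"
  show "F \<in> uf_at (\<iota> s \<cdot> s)" if "F \<in> gdom (UG S) ` uf_at s" for F
    using that UG.gdom_closed dom_mem_filt[OF uf_filt] by (auto simp: mem_uf_at gdom_UG)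
  fix F assume "F \<in> uf_at (\<iota> s \<cdot> s)"
  then have F: "F \<in> ultrafilters S" "\<iota> s \<cdot> s \<in> F"
    by (auto simp: mem_uf_at)
  then have "translate s F \<in> uf_at s" "F = gdom (UG S) (translate s F)"
    using uf_at_dom[OF F(1) s F(2)] by (simp_all add: mem_uf_at)
  then show "F \<in> gdom (UG S) ` uf_at s"
    by blast
qed

lemma slice_uf_at: "slice (UG S) (uf_at s)"
  unfolding slice_def
proof (intro conjI inj_onI)
  show "X = Y" if "X \<in> uf_at s" "Y \<in> uf_at s" "gdom (UG S) X = gdom (UG S) Y" for X Y
    using that uf_eqI_dom[of X Y s] by (simp add: mem_uf_at)
  show "X = Y" if "X \<in> uf_at s" "Y \<in> uf_at s" "gran (UG S) X = gran (UG S) Y" for X Y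
    using that uf_eqI_ran[of X Y s] by (simp add: mem_uf_at)
qed simp

lemma etale_groupoid_UG: "etale_groupoid (UG S)"
  unfolding etale_groupoid_def local_homeomorphism_map_def
proof (intro conjI ballI)
  show "topological_groupoid (UG S)"
    by (rule topological_groupoid_UG)
  fix X assume X: "X \<in> topspace (gtop (UG S))"
  then obtain s where s: "s \<in> X"
    using uf_nonempty by auto
  then have sC: "s \<in> carrier S"
    using X uf_closed by auto
  let ?O = "gtop (UG S)" and ?d = "gdom (UG S)"
  have units: "uf_at (\<iota> s \<cdot> s) \<subseteq> gunits (UG S)"
    unfolding gdom_uf_at[OF sC, symmetric] gunits_def carrier_UG
    using uf_at_subset by (rule image_mono)
  have top: "subtopology (unit_topology (UG S)) (?d ` uf_at s) = subtopology ?O (uf_at (\<iota> s \<cdot> s))"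
    using units gdom_uf_at[OF sC]
    by (simp add: unit_topology_def subtopology_subtopology inf.absorb2)
  have "openin (unit_topology (UG S)) (?d ` uf_at s)"
    using units gdom_uf_at[OF sC] unfolding unit_topology_def
    by (metis openin_subtopology_Int inf.absorb1 openin_uf_at)
  moreover have "homeomorphic_map (subtopology ?O (uf_at s)) (subtopology ?O (uf_at (\<iota> s \<cdot> s))) ?d"
  proof (rule bijective_open_imp_homeomorphic_map)
    have "continuous_map ?O ?O ?d"
    proof (rule continuous_map_into_UG)
      fix X assume X: "X \<in> topspace ?O"
      then show "?d X \<in> ultrafilters S"
        using UG.gdom_closed by simp
      fix a assume "a \<in> ?d X"
      then obtain x where x: "x \<in> X" "\<iota> x \<cdot> x \<preceq> a" "a \<in> carrier S"
        using X mem_dom_filt[OF uf_filt, of X a] by (auto simp: gdom_UG)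
      have "a \<in> ?d Y" if "Y \<in> uf_at x" for Y
        using that x mem_dom_filt[OF uf_filt, of Y a] by (auto simp: gdom_UG mem_uf_at)
      then show "\<exists>N. openin ?O N \<and> X \<in> N \<and> (\<forall>Y\<in>N. a \<in> ?d Y)"
        using X x by (intro exI[of _ "uf_at x"]) (simp add: mem_uf_at)
    qed
    then show "continuous_map (subtopology ?O (uf_at s)) (subtopology ?O (uf_at (\<iota> s \<cdot> s))) ?d"
      using gdom_uf_at[OF sC] uf_at_subset
      by (auto simp: continuous_map_in_subtopology continuous_map_from_subtopology)
    show "open_map (subtopology ?O (uf_at s)) (subtopology ?O (uf_at (\<iota> s \<cdot> s))) ?d"
      unfolding open_map_def
    proof (intro allI impI)
      fix V assume "openin (subtopology ?O (uf_at s)) V"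
      then have V: "openin ?O V" "V \<subseteq> uf_at s"
        by (simp_all add: openin_open_subtopology)
      \<comment> \<open>Images are computed one basic set at a time: the domain map sends
        \<open>uf_at t\<close> onto \<open>uf_at (\<iota> t \<cdot> t)\<close>, which is again
        basic.\<close>
      have "\<exists>t. F \<in> uf_at t \<and> uf_at t \<subseteq> ?d ` V" if F: "F \<in> ?d ` V" for F
      proof -
        obtain Y where Y: "Y \<in> V" "F = ?d Y"
          using F by blast
        then obtain t where t: "Y \<in> uf_at t" "uf_at t \<subseteq> V"
          using V openin_UG by blast
        have "t \<in> carrier S"
          using t uf_closed by (auto simp: mem_uf_at)
        then have eq: "uf_at (\<iota> t \<cdot> t) = ?d ` uf_at t"
          by (simp add: gdom_uf_at)
        show ?thesis
        proof (intro exI conjI)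
          show "F \<in> uf_at (\<iota> t \<cdot> t)"
            unfolding eq Y(2) using t(1) by (rule imageI)
          show "uf_at (\<iota> t \<cdot> t) \<subseteq> ?d ` V"
            unfolding eq using t(2) by (rule image_mono)
        qed
      qed
      then have "openin ?O (?d ` V)"
        unfolding openin_UG by (rule ballI)
      moreover have "?d ` V \<subseteq> uf_at (\<iota> s \<cdot> s)"
        using V gdom_uf_at[OF sC] by blast
      ultimately show "openin (subtopology ?O (uf_at (\<iota> s \<cdot> s))) (?d ` V)"
        by (simp add: openin_open_subtopology)
    qed
    show "?d ` topspace (subtopology ?O (uf_at s)) = topspace (subtopology ?O (uf_at (\<iota> s \<cdot> s)))"
      using gdom_uf_at[OF sC] uf_at_subset by (simp add: inf.absorb2)
    show "inj_on ?d (topspace (subtopology ?O (uf_at s)))"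
      using slice_uf_at[of s] uf_at_subset[of s] by (simp add: slice_def inf.absorb2)
  qed
  ultimately show "\<exists>U. openin ?O U \<and> X \<in> U \<and> openin (unit_topology (UG S)) (?d ` U) \<and>
      homeomorphic_map (subtopology ?O U) (subtopology (unit_topology (UG S)) (?d ` U)) ?d"
    using top X s by (intro exI[of _ "uf_at s"]) (simp add: mem_uf_at)
qed

lemma ample_groupoid_UG: "ample_groupoid (UG S)"
  unfolding ample_groupoid_def
proof (intro conjI)
  show "etale_groupoid (UG S)"
    by (rule etale_groupoid_UG)
  show "Hausdorff_space (unit_topology (UG S))"
    unfolding unit_topology_def by (rule Hausdorff_space_subtopology) (rule Hausdorff_space_UG)
  show "openin (gtop (UG S)) =
      arbitrary union_of (\<lambda>U. slice (UG S) U \<and> compactin (gtop (UG S)) U)"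
  proof (intro ext iffI)
    fix W assume W: "openin (gtop (UG S)) W"
    show "(arbitrary union_of (\<lambda>U. slice (UG S) U \<and> compactin (gtop (UG S)) U)) W"
      unfolding arbitrary_union_of_alt
    proof
      fix X assume "X \<in> W"
      then obtain s where s: "X \<in> uf_at s" "uf_at s \<subseteq> W"
        using W openin_UG by blast
      then have "s \<in> carrier S"
        using uf_closed by (auto simp: mem_uf_at)
      then show "\<exists>U. (slice (UG S) U \<and> compactin (gtop (UG S)) U) \<and> X \<in> U \<and> U \<subseteq> W"
        using s slice_uf_at compactin_uf_at by blast
    qed
  next
    fix W assume "(arbitrary union_of (\<lambda>U. slice (UG S) U \<and> compactin (gtop (UG S)) U)) W"
    then show "openin (gtop (UG S)) W"
      unfolding arbitrary_union_of_alt slice_def by (subst openin_subopen) blast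
  qed
qed

section \<open>Degrees of ultrafilters\<close>

lemma sdeg_closed: "s \<in> carrier S \<Longrightarrow> s \<noteq> \<zero> \<Longrightarrow> sdeg S s \<in> carrier \<Gamma>"
  and sdeg_mult: "s \<in> carrier S \<Longrightarrow> t \<in> carrier S \<Longrightarrow> s \<cdot> t \<noteq> \<zero> \<Longrightarrow>
    sdeg S (s \<cdot> t) = sdeg S s \<otimes>\<^bsub>\<Gamma>\<^esub> sdeg S t"
  using graded unfolding is_graded_semigroup_def by blast+

text \<open>A nonzero idempotent has the identity as its degree, by cancellation in e = e e;
  multiplying by it changes no degree unless the product is zero.\<close>

lemma sdeg_le:
  assumes z: "z \<preceq> x" "z \<noteq> \<zero>" and x: "x \<in> carrier S"
  shows "sdeg S z = sdeg S x"
proof -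
  interpret \<Gamma>: group \<Gamma>
    by (rule group)
  obtain e where e: "e \<in> E" "z = x \<cdot> e"
    using z nle_iff by blast
  have nz: "e \<noteq> \<zero>" "x \<noteq> \<zero>"
    using z x e by auto
  have "sdeg S e = sdeg S e \<otimes>\<^bsub>\<Gamma>\<^esub> sdeg S e"
    using sdeg_mult[of e e] e nz by simp
  then have "sdeg S e = \<one>\<^bsub>\<Gamma>\<^esub>"
    using sdeg_closed[of e] e nz \<Gamma>.l_cancel_one'[of "sdeg S e" "sdeg S e"] by auto
  then show ?thesis
    using sdeg_mult[of x e] sdeg_closed[of x] e nz x z by simp
qed

text \<open>Any two elements of \<open>X\<close> have a nonzero common lower bound, so all degrees
  in \<open>X\<close> agree and the definite description has a value.\<close>

lemma gdeg_UG:
  assumes X: "X \<in> ultrafilters S" and x: "x \<in> X"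
  shows "gdeg (UG S) X = sdeg S x"
proof -
  have fX: "filt X"
    using X uf_filt by simp
  have deg: "sdeg S y = sdeg S x" if y: "y \<in> X" for y
  proof -
    obtain z where z: "z \<in> X" "z \<preceq> x" "z \<preceq> y"
      using filt_directed[OF fX x y] by blast
    then have "z \<noteq> \<zero>"
      using filt_not_zero[OF fX] by blast
    then show ?thesis
      using sdeg_le[OF z(2)] sdeg_le[OF z(3)] filt_closed[OF fX] x y by simp
  qed
  have "gdeg (UG S) X = (THE \<alpha>. \<forall>y\<in>X. sdeg S y = \<alpha>)"
    by (simp add: UG_def)
  also have "\<dots> = sdeg S x"
  proof (rule the_equality)
    show "\<forall>y\<in>X. sdeg S y = sdeg S x"
      using deg by blast
    show "\<alpha> = sdeg S x" if "\<forall>y\<in>X. sdeg S y = \<alpha>" for \<alpha>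
      using that x by simp
  qed
  finally show ?thesis .
qed

lemma uf_nonzero: "X \<in> ultrafilters S \<Longrightarrow> s \<in> X \<Longrightarrow> s \<noteq> \<zero>"
  using uf_filt filt_not_zero by blast

lemma is_graded_groupoid_UG: "is_graded_groupoid \<Gamma> (UG S)"
  unfolding is_graded_groupoid_def
proof (intro conjI)
  show "continuous_map (gtop (UG S)) (discrete_topology (carrier \<Gamma>)) (gdeg (UG S))"
    unfolding continuous_map_def
  proof (intro conjI allI impI)
    have "gdeg (UG S) X \<in> carrier \<Gamma>" if X: "X \<in> ultrafilters S" for X
      using uf_nonempty[OF X] gdeg_UG[OF X] sdeg_closed uf_closed[OF X] uf_nonzero[OF X] by auto
    then show "gdeg (UG S) \<in> topspace (gtop (UG S)) \<rightarrow> topspace (discrete_topology (carrier \<Gamma>))"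
      by simp
    fix V
    have "\<exists>s. X \<in> uf_at s \<and> uf_at s \<subseteq> {X \<in> ultrafilters S. gdeg (UG S) X \<in> V}"
      if X: "X \<in> ultrafilters S" and V: "gdeg (UG S) X \<in> V" for X
    proof -
      obtain s where s: "s \<in> X"
        using uf_nonempty[OF X] ..
      then show ?thesis
        using X V gdeg_UG by (intro exI[of _ s]) (auto simp: mem_uf_at)
    qed
    then show "openin (gtop (UG S)) {X \<in> topspace (gtop (UG S)). gdeg (UG S) X \<in> V}"
      by (auto simp: openin_UG)
  qed
  show "\<forall>(X, Y)\<in>composable (UG S).
      gdeg (UG S) (X \<star> Y) = gdeg (UG S) X \<otimes>\<^bsub>\<Gamma>\<^esub> gdeg (UG S) Y"
  proof clarify
    fix X Y assume "(X, Y) \<in> composable (UG S)"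
    then have XY: "X \<in> ultrafilters S" "Y \<in> ultrafilters S" "X \<star> Y \<in> ultrafilters S"
      using UG.gmult_closed[of X Y] by simp_all
    obtain x y where x: "x \<in> X" and y: "y \<in> Y"
      using uf_nonempty XY by meson
    have C: "x \<in> carrier S" "y \<in> carrier S"
      using uf_closed XY x y by auto
    then have "x \<cdot> y \<in> X \<star> Y"
      using x y XY le_refl[of "x \<cdot> y"] unfolding mem_ufprod by blast
    then show "gdeg (UG S) (X \<star> Y) = gdeg (UG S) X \<otimes>\<^bsub>\<Gamma>\<^esub> gdeg (UG S) Y"
      using gdeg_UG XY x y sdeg_mult C uf_nonzero by metis
  qed
qed

lemma UG_in_GrGp_ob: "UG S \<in> GrGp_ob \<Gamma>"
  unfolding GrGp_ob_def
  using ample_groupoid_UG Hausdorff_space_UG is_graded_groupoid_UG by blast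

text \<open>The substantial inclusion factors an ultrafilter \<open>Z\<close> through
  \<open>s \<cdot> t\<close>. Translating \<open>Z\<close> by \<open>\<iota> s\<close> gives a
  \<open>Y\<close> through \<open>t\<close> with the domain of \<open>Z\<close>, and
  \<open>X\<close> is then forced to be Z Y^-1.\<close>

lemma uf_at_mult:
  assumes s: "s \<in> carrier S" and t: "t \<in> carrier S"
  shows "uf_at (s \<cdot> t) =
    {X \<star> Y | X Y. X \<in> uf_at s \<and> Y \<in> uf_at t \<and> gdom (UG S) X = gran (UG S) Y}"
proof (intro equalityI subsetI)
  fix Z assume "Z \<in> {X \<star> Y | X Y. X \<in> uf_at s \<and> Y \<in> uf_at t \<and> gdom (UG S) X = gran (UG S) Y}"
  then obtain X Y where Z: "Z = X \<star> Y" "X \<in> uf_at s" "Y \<in> uf_at t" "gdom (UG S) X = gran (UG S) Y"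
    by blast
  moreover have "s \<cdot> t \<in> X \<star> Y"
    using Z s t le_refl[of "s \<cdot> t"] unfolding mem_ufprod by (auto simp: mem_uf_at)
  ultimately show "Z \<in> uf_at (s \<cdot> t)"
    using UG.gmult_closed[of X Y] by (simp add: mem_uf_at)
next
  fix Z assume "Z \<in> uf_at (s \<cdot> t)"
  then have Z: "Z \<in> ultrafilters S" "s \<cdot> t \<in> Z"
    by (auto simp: mem_uf_at)
  \<comment> \<open>This permits translation by \<open>\<iota> s\<close>: the range of
    \<open>Z\<close> contains the range idempotent of \<open>s \<cdot> t\<close>, which lies below
    \<open>s \<cdot> \<iota> s\<close>.\<close>
  have ran: "\<iota> (\<iota> s) \<cdot> \<iota> s \<in> Z \<star> \<iota> ` Z"
  proof -
    have "s \<cdot> t \<cdot> \<iota> (s \<cdot> t) = s \<cdot> ((t \<cdot> \<iota> t) \<cdot> \<iota> s)"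
      using s t by (simp add: sinv_mult smult_assoc)
    also have "\<dots> \<preceq> s \<cdot> \<iota> s"
      using s t by (intro le_mult) auto
    finally show ?thesis
      using mem_ran_filt[OF uf_filt[OF Z(1)]] s Z(2) by auto
  qed
  define Y where "Y = translate (\<iota> s) Z"
  have Y: "Y \<in> ultrafilters S" "gdom (UG S) Y = gdom (UG S) Z"
    unfolding Y_def using uf_translate[OF Z(1) _ ran] gdom_translate[OF Z(1) _ ran] s by simp_all
  have y: "\<iota> s \<cdot> (s \<cdot> t) \<in> Y"
    using Z s t le_refl[of "\<iota> s \<cdot> (s \<cdot> t)"] unfolding Y_def translate_def by blast
  have "\<iota> s \<cdot> (s \<cdot> t) \<preceq> t"
    using idem_mult_le[of t "\<iota> s \<cdot> s"] s t by (simp add: smult_assoc)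
  then have tY: "t \<in> Y"
    using filt_upward[OF uf_filt[OF Y(1)] y _ t] by blast
  define X where "X = Z \<star> ginv (UG S) Y"
  have X: "X \<in> ultrafilters S" "gdom (UG S) X = gran (UG S) Y" "X \<star> Y = Z"
    unfolding X_def
    using Z Y UG.gmult_closed[of Z "ginv (UG S) Y"] UG.gdom_gmult[of Z "ginv (UG S) Y"]
      UG.gran_ginv[of Y] UG.gdom_ginv[of Y] UG.gmult_ginv_cancel(2)[of Z Y] UG.ginv_closed[of Y]
    unfolding carrier_UG by metis+
  have "\<iota> (\<iota> s \<cdot> (s \<cdot> t)) \<in> ginv (UG S) Y"
    using y by simp
  moreover have "s \<cdot> t \<cdot> \<iota> (\<iota> s \<cdot> (s \<cdot> t)) \<preceq> s"
  proof -
    have "s \<cdot> t \<cdot> \<iota> (\<iota> s \<cdot> (s \<cdot> t)) = s \<cdot> ((t \<cdot> \<iota> t) \<cdot> (\<iota> s \<cdot> s))"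
      using s t by (simp add: sinv_mult smult_assoc)
    also have "\<dots> \<preceq> s"
      using s t by (intro mult_idem_le) auto
    finally show ?thesis .
  qed
  ultimately have "s \<in> X"
    using Z s unfolding X_def mem_ufprod by blast
  then have "X \<in> uf_at s" "Y \<in> uf_at t"
    using X Y tY by (simp_all add: mem_uf_at)
  then show "Z \<in> {X \<star> Y | X Y. X \<in> uf_at s \<and> Y \<in> uf_at t \<and> gdom (UG S) X = gran (UG S) Y}"
    using X by blast
qed

end

section \<open>The semigroup of homogeneous compact slices\<close>

locale graded_ample_groupoid = groupoid G
  for G :: "('a, 'c) graded_groupoid" (structure) +
  fixes \<Gamma> :: "('c, 'm) monoid_scheme"
  assumes group: "group \<Gamma>"
    and ample: "ample_groupoid G"
    and Hausdorff: "Hausdorff_space (gtop G)"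
    and graded: "is_graded_groupoid \<Gamma> G"

lemma GrGp_ob_iff: "group \<Gamma> \<Longrightarrow> G \<in> GrGp_ob \<Gamma> \<longleftrightarrow> graded_ample_groupoid G \<Gamma>"
  by (auto simp: GrGp_ob_def graded_ample_groupoid_def graded_ample_groupoid_axioms_def
      groupoid_def ample_groupoid_def etale_groupoid_def topological_groupoid_def)

context graded_ample_groupoid
begin

section \<open>Open and compact sets in an etale groupoid\<close>

abbreviation \<T> :: "'a topology" where "\<T> \<equiv> gtop G"

lemma topological: "topological_groupoid G" and etale: "etale_groupoid G"
  using ample by (simp_all add: ample_groupoid_def etale_groupoid_def)

lemma topspace_eq [simp]: "topspace \<T> = carrier G"
  and continuous_ginv: "continuous_map \<T> \<T> \<iota>"
  and continuous_gmult: "continuous_map (subtopology (prod_topology \<T> \<T>) (composable G)) \<T>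
    (\<lambda>(x, y). x \<bullet> y)"
  using topological by (simp_all add: topological_groupoid_def)

lemma open_closed: "openin \<T> X \<Longrightarrow> x \<in> X \<Longrightarrow> x \<in> carrier G"
  using openin_subset[of \<T> X] by auto

lemma continuous_gdom: "continuous_map \<T> \<T> d"
proof -
  have "continuous_map \<T> (subtopology (prod_topology \<T> \<T>) (composable G)) (\<lambda>x. (\<iota> x, x))"
    using continuous_ginv by (auto simp: continuous_map_in_subtopology continuous_map_paired)
  then have "continuous_map \<T> \<T> ((\<lambda>(x, y). x \<bullet> y) \<circ> (\<lambda>x. (\<iota> x, x)))"
    using continuous_gmult by (rule continuous_map_compose)
  then show ?thesis
    by (simp add: comp_def)
qed

lemma continuous_gran: "continuous_map \<T> \<T> r"
proof -
  have "continuous_map \<T> \<T> (d \<circ> \<iota>)"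
    using continuous_ginv continuous_gdom by (rule continuous_map_compose)
  then show ?thesis
    by (rule continuous_map_eq) simp
qed

lemma local_homeo:
  assumes "x \<in> carrier G"
  obtains U where "openin \<T> U" "x \<in> U" "inj_on d U"
    "\<And>V. openin \<T> V \<Longrightarrow> V \<subseteq> U \<Longrightarrow> openin (unit_topology G) (d ` V)"
proof -
  obtain U where U: "openin \<T> U" "x \<in> U" "openin (unit_topology G) (d ` U)"
      "homeomorphic_map (subtopology \<T> U) (subtopology (unit_topology G) (d ` U)) d"
    using etale assms unfolding etale_groupoid_def local_homeomorphism_map_def by auto
  have "topspace (subtopology \<T> U) = U"
    using openin_subset[OF U(1)] by auto
  then have "inj_on d U"
    using U(4) homeomorphic_imp_injective_map by fastforce
  moreover have "openin (unit_topology G) (d ` V)" if V: "openin \<T> V" "V \<subseteq> U" for V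
  proof -
    have "openin (subtopology \<T> U) V"
      using V U(1) by (simp add: openin_open_subtopology)
    then have "openin (subtopology (unit_topology G) (d ` U)) (d ` V)"
      using homeomorphic_imp_open_map[OF U(4)] by (simp add: open_map_def)
    then show ?thesis
      using U(3) by (simp add: openin_open_subtopology)
  qed
  ultimately show ?thesis
    using that U by blast
qed

text \<open>Near a unit choose \<open>U\<close> on which \<open>d\<close> is injective. If
  \<open>v\<close> and \<open>d v\<close> both lie in \<open>U\<close>, they have the same domain,
  so \<open>v\<close> is the unit \<open>d v\<close>; by continuity of \<open>d\<close> this is the
  case near the given unit.\<close>

lemma openin_gunits: "openin \<T> (gunits G)"
proof (subst openin_subopen, intro ballI)
  fix u assume u: "u \<in> gunits G"
  then obtain U where U: "openin \<T> U" "u \<in> U" "inj_on d U"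
    using local_homeo[of u] gunits_closed by metis
  let ?V = "U \<inter> {x \<in> topspace \<T>. d x \<in> U}"
  have "openin \<T> ?V"
    using U openin_continuous_map_preimage[OF continuous_gdom U(1)] by blast
  moreover have "u \<in> ?V"
    using u U gunits_closed by auto
  moreover have "?V \<subseteq> gunits G"
  proof
    fix v assume "v \<in> ?V"
    then have v: "v \<in> U" "v \<in> carrier G" "d v \<in> U"
      by auto
    then have "d v = v"
      using inj_onD[OF U(3), of "d v" v] by simp
    then show "v \<in> gunits G"
      using v gunits_iff by simp
  qed
  ultimately show "\<exists>T. openin \<T> T \<and> u \<in> T \<and> T \<subseteq> gunits G"
    by blast
qed

text \<open>A local homeomorphism onto the unit space is open, and the unit space is open in the
  groupoid.\<close>

lemma openin_gdom_image:
  assumes V: "openin \<T> V"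
  shows "openin \<T> (d ` V)"
proof (subst openin_subopen, intro ballI)
  fix u assume "u \<in> d ` V"
  then obtain x where x: "x \<in> V" "u = d x"
    by blast
  then have "x \<in> carrier G"
    using open_closed V by blast
  then obtain U where U: "openin \<T> U" "x \<in> U"
      "\<And>V. openin \<T> V \<Longrightarrow> V \<subseteq> U \<Longrightarrow> openin (unit_topology G) (d ` V)"
    by (rule local_homeo) blast
  have "openin (unit_topology G) (d ` (U \<inter> V))"
    using U V by auto
  then have "openin \<T> (d ` (U \<inter> V))"
    unfolding unit_topology_def using openin_gunits by (simp add: openin_open_subtopology)
  then show "\<exists>T. openin \<T> T \<and> u \<in> T \<and> T \<subseteq> d ` V"
    using x U by (intro exI[of _ "d ` (U \<inter> V)"]) auto
qed

definition setprod :: "'a set \<Rightarrow> 'a set \<Rightarrow> 'a set" (infixl \<open>\<odot>\<close> 70) where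
  "X \<odot> Y = {x \<bullet> y | x y. x \<in> X \<and> y \<in> Y \<and> d x = r y}"

text \<open>For \<open>z\<close> near \<open>z0\<close> there is \<open>y \<in> W\<close> near
  \<open>y0\<close> with the same domain, because \<open>d\<close> is open. By continuity z y^-1 is
  then in \<open>V\<close>, and \<open>z\<close> is the product of this arrow with
  \<open>y\<close>.\<close>

lemma openin_setprod:
  assumes V: "openin \<T> V" and W: "openin \<T> W"
  shows "openin \<T> (V \<odot> W)"
proof (subst openin_subopen, intro ballI)
  fix z0 assume "z0 \<in> V \<odot> W"
  then obtain x0 y0 where z0: "z0 = x0 \<bullet> y0" "x0 \<in> V" "y0 \<in> W" "d x0 = r y0"
    by (auto simp: setprod_def)
  have C: "x0 \<in> carrier G" "y0 \<in> carrier G"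
    using z0 V W open_closed by auto
  \<comment> \<open>\<open>?D\<close> is the set of pairs for which the quotient z y^-1 is
    defined.\<close>
  let ?P = "prod_topology \<T> \<T>" and ?D = "{(z, y). z \<in> carrier G \<and> y \<in> carrier G \<and> d z = d y}"
  have "continuous_map (subtopology ?P ?D) \<T> snd" "continuous_map (subtopology ?P ?D) \<T> fst"
    by (simp_all add: continuous_map_from_subtopology continuous_map_fst continuous_map_snd)
  then have "continuous_map (subtopology ?P ?D) ?P (\<lambda>p. (fst p, \<iota> (snd p)))"
    using continuous_map_compose[OF _ continuous_ginv, of "subtopology ?P ?D" snd]
    by (simp add: continuous_map_paired comp_def)
  then have "continuous_map (subtopology ?P ?D) (subtopology ?P (composable G))
      (\<lambda>p. (fst p, \<iota> (snd p)))"
    by (auto simp: continuous_map_in_subtopology)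
  then have "continuous_map (subtopology ?P ?D) \<T> ((\<lambda>(x, y). x \<bullet> y) \<circ> (\<lambda>p. (fst p, \<iota> (snd p))))"
    using continuous_gmult by (rule continuous_map_compose)
  then have "openin (subtopology ?P ?D)
      {p \<in> topspace (subtopology ?P ?D). ((\<lambda>(x, y). x \<bullet> y) \<circ> (\<lambda>p. (fst p, \<iota> (snd p)))) p \<in> V}"
    using V by (rule openin_continuous_map_preimage)
  then obtain T where T: "openin ?P T" and
      TD: "{p \<in> topspace (subtopology ?P ?D). ((\<lambda>(x, y). x \<bullet> y) \<circ> (\<lambda>p. (fst p, \<iota> (snd p)))) p \<in> V}
        = T \<inter> ?D"
    by (auto simp: openin_subtopology)
  have TD': "(z, y) \<in> T \<longleftrightarrow> z \<bullet> \<iota> y \<in> V"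
    if "z \<in> carrier G" "y \<in> carrier G" "d z = d y" for z y
    using that TD[THEN eqset_imp_iff, of "(z, y)"] by simp
  have z0T: "(z0, y0) \<in> T"
    using TD'[of z0 y0] C z0 by simp
  obtain A B where AB: "openin \<T> A" "openin \<T> B" "z0 \<in> A" "y0 \<in> B" "A \<times> B \<subseteq> T"
    using T[unfolded openin_prod_topology_alt, rule_format, OF z0T] by blast
  let ?N = "A \<inter> {z \<in> topspace \<T>. d z \<in> d ` (B \<inter> W)}"
  have "openin \<T> (d ` (B \<inter> W))"
    using AB W by (intro openin_gdom_image) blast
  then have "openin \<T> ?N"
    using openin_continuous_map_preimage[OF continuous_gdom] AB(1) by blast
  moreover have "z0 \<in> ?N"
    using AB z0 C by auto
  moreover have "?N \<subseteq> V \<odot> W"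
  proof
    fix z assume "z \<in> ?N"
    then obtain y where z: "z \<in> A" "z \<in> carrier G" "y \<in> B" "y \<in> W" "d z = d y"
      by auto
    have y: "y \<in> carrier G"
      using z W open_closed by blast
    have "(z, y) \<in> T"
      using AB(5) z by blast
    then have "z \<bullet> \<iota> y \<in> V"
      using TD' z y by blast
    moreover have "z = (z \<bullet> \<iota> y) \<bullet> y" "d (z \<bullet> \<iota> y) = r y"
      using z y by simp_all
    ultimately show "z \<in> V \<odot> W"
      using z unfolding setprod_def by blast
  qed
  ultimately show "\<exists>N. openin \<T> N \<and> z0 \<in> N \<and> N \<subseteq> V \<odot> W"
    by blast
qed

lemma compactin_closedin: "compactin \<T> X \<Longrightarrow> closedin \<T> X"
  using Hausdorff compactin_imp_closedin by blast

text \<open>By the Hausdorff property the pairs in which the domain of the first equals the range of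
  the second form a closed set, so those in the compact set \<open>X \<times> Y\<close> form a
  compact set.\<close>

lemma compactin_setprod:
  assumes X: "compactin \<T> X" and Y: "compactin \<T> Y"
  shows "compactin \<T> (X \<odot> Y)"
proof -
  let ?P = "prod_topology \<T> \<T>"
  have XY: "X \<subseteq> carrier G" "Y \<subseteq> carrier G"
    using X Y compactin_subset_topspace by fastforce+
  have "continuous_map ?P \<T> (d \<circ> fst)" "continuous_map ?P \<T> (r \<circ> snd)"
    using continuous_map_compose[OF continuous_map_fst continuous_gdom]
      continuous_map_compose[OF continuous_map_snd continuous_gran] by blast+
  then have "closedin ?P {p \<in> topspace ?P. (d \<circ> fst) p = (r \<circ> snd) p}"
    using Hausdorff closedin_continuous_maps_eq by blast
  moreover have "compactin ?P (X \<times> Y)"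
    using X Y by (simp add: compactin_Times)
  ultimately have "compactin ?P (X \<times> Y \<inter> {p \<in> topspace ?P. (d \<circ> fst) p = (r \<circ> snd) p})"
    by (rule compact_Int_closedin[rotated])
  moreover have "X \<times> Y \<inter> {p \<in> topspace ?P. (d \<circ> fst) p = (r \<circ> snd) p} = X \<times> Y \<inter> composable G"
    using XY by auto
  ultimately have "compactin (subtopology ?P (composable G)) (X \<times> Y \<inter> composable G)"
    by (simp add: compactin_subtopology)
  then have "compactin \<T> ((\<lambda>(x, y). x \<bullet> y) ` (X \<times> Y \<inter> composable G))"
    using continuous_gmult by (rule image_compactin)
  moreover have "(\<lambda>(x, y). x \<bullet> y) ` (X \<times> Y \<inter> composable G) = X \<odot> Y"
  proof (intro equalityI subsetI)
    fix z assume "z \<in> X \<odot> Y"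
    then obtain x y where "z = x \<bullet> y" "x \<in> X" "y \<in> Y" "d x = r y"
      by (auto simp: setprod_def)
    then show "z \<in> (\<lambda>(x, y). x \<bullet> y) ` (X \<times> Y \<inter> composable G)"
      using XY by (intro image_eqI[of _ _ "(x, y)"]) auto
  next
    fix z assume "z \<in> (\<lambda>(x, y). x \<bullet> y) ` (X \<times> Y \<inter> composable G)"
    then obtain x y where "z = x \<bullet> y" "x \<in> X" "y \<in> Y" "d x = r y"
      by auto
    then show "z \<in> X \<odot> Y"
      unfolding setprod_def by blast
  qed
  ultimately show ?thesis
    by simp
qed

lemma openin_ginv_image: "openin \<T> X \<Longrightarrow> openin \<T> (\<iota> ` X)"
proof -
  assume X: "openin \<T> X"
  have "\<iota> ` X = {x \<in> topspace \<T>. \<iota> x \<in> X}"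
    using open_closed[OF X] by (force simp: image_iff)
  then show ?thesis
    using openin_continuous_map_preimage[OF continuous_ginv X] by simp
qed

lemma compactin_ginv_image: "compactin \<T> X \<Longrightarrow> compactin \<T> (\<iota> ` X)"
  using continuous_ginv image_compactin by blast

lemma gdeg_closed: "x \<in> carrier G \<Longrightarrow> gdeg G x \<in> carrier \<Gamma>"
  using graded continuous_map_image_subset_topspace[of \<T> "discrete_topology (carrier \<Gamma>)" "gdeg G"]
  unfolding is_graded_groupoid_def by auto

lemma openin_gcomponent: "openin \<T> (gcomponent G \<alpha>)"
proof -
  have "openin \<T> {x \<in> topspace \<T>. gdeg G x \<in> {\<alpha>} \<inter> carrier \<Gamma>}"
    using graded unfolding is_graded_groupoid_def
    by (intro openin_continuous_map_preimage[of _ "discrete_topology (carrier \<Gamma>)"]) auto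
  moreover have "{x \<in> topspace \<T>. gdeg G x \<in> {\<alpha>} \<inter> carrier \<Gamma>} = gcomponent G \<alpha>"
    using gdeg_closed by (auto simp: gcomponent_def)
  ultimately show ?thesis
    by simp
qed

lemma gdeg_gmult:
  assumes "x \<in> carrier G" "y \<in> carrier G" "d x = r y"
  shows "gdeg G (x \<bullet> y) = gdeg G x \<otimes>\<^bsub>\<Gamma>\<^esub> gdeg G y"
proof -
  have "(x, y) \<in> composable G"
    using assms by simp
  then show ?thesis
    using graded unfolding is_graded_groupoid_def by blast
qed

lemma gdeg_unit: "u \<in> gunits G \<Longrightarrow> gdeg G u = \<one>\<^bsub>\<Gamma>\<^esub>"
proof -
  assume u: "u \<in> gunits G"
  interpret \<Gamma>: group \<Gamma>
    by (rule group)
  have C: "u \<in> carrier G"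
    using u gunits_closed by blast
  then have "gdeg G u = gdeg G u \<otimes>\<^bsub>\<Gamma>\<^esub> gdeg G u"
    using gdeg_gmult[of u u] gmult_gdom_eq[of u u] u by simp
  then show ?thesis
    using gdeg_closed[OF C] \<Gamma>.l_cancel_one'[of "gdeg G u" "gdeg G u"] by auto
qed

lemma gdeg_ginv: "x \<in> carrier G \<Longrightarrow> gdeg G (\<iota> x) = inv\<^bsub>\<Gamma>\<^esub> (gdeg G x)"
proof -
  assume x: "x \<in> carrier G"
  interpret \<Gamma>: group \<Gamma>
    by (rule group)
  have "gdeg G (\<iota> x) \<otimes>\<^bsub>\<Gamma>\<^esub> gdeg G x = \<one>\<^bsub>\<Gamma>\<^esub>"
    using gdeg_gmult[of "\<iota> x" x] gdeg_unit[of "d x"] x by simp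
  then show ?thesis
    using \<Gamma>.inv_equality[of "gdeg G (\<iota> x)" "gdeg G x"] gdeg_closed x by simp
qed

section \<open>The inverse semigroup of homogeneous compact slices\<close>

abbreviation Q :: "'a set set" where "Q \<equiv> carrier (Sgr \<Gamma> G)"

lemma mem_Sgr:
  "X \<in> Q \<longleftrightarrow> openin \<T> X \<and> compactin \<T> X \<and> inj_on d X \<and> inj_on r X \<and>
    (\<exists>\<alpha>\<in>carrier \<Gamma>. X \<subseteq> gcomponent G \<alpha>)"
  by (auto simp: Sgr_def slice_def)

lemma SgrI:
  "openin \<T> X \<Longrightarrow> compactin \<T> X \<Longrightarrow> inj_on d X \<Longrightarrow> inj_on r X \<Longrightarrow> \<alpha> \<in> carrier \<Gamma> \<Longrightarrow>
    X \<subseteq> gcomponent G \<alpha> \<Longrightarrow> X \<in> Q"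
  unfolding mem_Sgr by blast

lemma Sgr_open: "X \<in> Q \<Longrightarrow> openin \<T> X"
  and Sgr_compact: "X \<in> Q \<Longrightarrow> compactin \<T> X"
  and Sgr_inj_gdom: "X \<in> Q \<Longrightarrow> inj_on d X"
  and Sgr_inj_gran: "X \<in> Q \<Longrightarrow> inj_on r X"
  unfolding mem_Sgr by simp_all

lemma Sgr_closed: "X \<in> Q \<Longrightarrow> x \<in> X \<Longrightarrow> x \<in> carrier G"
  by (rule open_closed[OF Sgr_open])

lemma Sgr_gdomD: "X \<in> Q \<Longrightarrow> x \<in> X \<Longrightarrow> y \<in> X \<Longrightarrow> d x = d y \<Longrightarrow> x = y"
  by (rule inj_onD[OF Sgr_inj_gdom])

lemma Sgr_granD: "X \<in> Q \<Longrightarrow> x \<in> X \<Longrightarrow> y \<in> X \<Longrightarrow> r x = r y \<Longrightarrow> x = y"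
  by (rule inj_onD[OF Sgr_inj_gran])

lemma Sgr_subset:
  assumes "X \<in> Q" "Y \<subseteq> X" "openin \<T> Y" "compactin \<T> Y"
  shows "Y \<in> Q"
proof -
  obtain \<alpha> where "\<alpha> \<in> carrier \<Gamma>" "X \<subseteq> gcomponent G \<alpha>"
    using assms unfolding mem_Sgr by blast
  then show ?thesis
    using assms inj_on_subset[OF Sgr_inj_gdom[OF assms(1)] assms(2)]
      inj_on_subset[OF Sgr_inj_gran[OF assms(1)] assms(2)] by (intro SgrI[of _ \<alpha>]) simp_all
qed

lemma Sgr_Int: "X \<in> Q \<Longrightarrow> Y \<in> Q \<Longrightarrow> X \<inter> Y \<in> Q"
  by (rule Sgr_subset[of X])
    (auto simp: openin_Int Sgr_open intro: compactin_Int[OF Hausdorff] Sgr_compact)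

text \<open>By the Hausdorff property of the whole groupoid compact slices are closed, so a
  difference of two is again open and compact.\<close>

lemma Sgr_Diff:
  assumes "X \<in> Q" "Y \<in> Q"
  shows "X - Y \<in> Q"
proof (rule Sgr_subset[OF assms(1)])
  have "closedin \<T> X" "closedin \<T> Y"
    using assms Sgr_compact compactin_closedin by auto
  then show "openin \<T> (X - Y)" "compactin \<T> (X - Y)"
    using assms Sgr_compact Sgr_open closed_compactin[of \<T> X "X - Y"] by auto
qed auto

text \<open>Units have trivial degree, so homogeneity is automatic here and the idempotents do not
  see the grading.\<close>

lemma Sgr_units:
  assumes "openin \<T> X" "compactin \<T> X" "X \<subseteq> gunits G"
  shows "X \<in> Q"
proof (rule SgrI[of _ "\<one>\<^bsub>\<Gamma>\<^esub>"])
  interpret \<Gamma>: group \<Gamma>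
    by (rule group)
  show "\<one>\<^bsub>\<Gamma>\<^esub> \<in> carrier \<Gamma>"
    by simp
  show "inj_on d X" "inj_on r X"
    using inj_on_cong[of X d id] inj_on_cong[of X r id] assms(3) by (auto simp: subset_iff)
  show "X \<subseteq> gcomponent G \<one>\<^bsub>\<Gamma>\<^esub>"
    using assms gdeg_unit gunits_closed by (auto simp: gcomponent_def)
qed (use assms in auto)

text \<open>The components of the grading are open, so a neighbourhood may be shrunk to the
  component of \<open>x\<close> first, which makes the slice homogeneous.\<close>

lemma Sgr_base:
  assumes W: "openin \<T> W" and x: "x \<in> W"
  obtains K where "K \<in> Q" "x \<in> K" "K \<subseteq> W"
proof -
  have xC: "x \<in> carrier G"
    using open_closed W x .
  have "openin \<T> (W \<inter> gcomponent G (gdeg G x))"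
    using W openin_gcomponent by blast
  then have "(arbitrary union_of (\<lambda>U. slice G U \<and> compactin \<T> U)) (W \<inter> gcomponent G (gdeg G x))"
    using ample unfolding ample_groupoid_def by metis
  moreover have "x \<in> W \<inter> gcomponent G (gdeg G x)"
    using x xC by (simp add: gcomponent_def)
  ultimately obtain K where K: "slice G K" "compactin \<T> K" "x \<in> K" "K \<subseteq> W \<inter> gcomponent G (gdeg G x)"
    unfolding arbitrary_union_of_alt by blast
  then have "K \<in> Q"
    using gdeg_closed[OF xC] by (intro SgrI[of _ "gdeg G x"]) (auto simp: slice_def)
  then show ?thesis
    using that K by blast
qed

lemma smult_Sgr [simp]: "X \<cdot>\<^bsub>Sgr \<Gamma> G\<^esub> Y = X \<odot> Y"
  and szero_Sgr [simp]: "szero (Sgr \<Gamma> G) = {}"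
  by (simp_all add: Sgr_def setprod_def)

lemma setprodI: "x \<in> X \<Longrightarrow> y \<in> Y \<Longrightarrow> d x = r y \<Longrightarrow> x \<bullet> y \<in> X \<odot> Y"
  unfolding setprod_def by blast

lemma setprodE:
  assumes "z \<in> X \<odot> Y"
  obtains x y where "z = x \<bullet> y" "x \<in> X" "y \<in> Y" "d x = r y"
  using assms unfolding setprod_def by blast

lemma setprod_gcomponent:
  assumes "X \<subseteq> gcomponent G \<alpha>" "Y \<subseteq> gcomponent G \<beta>"
  shows "X \<odot> Y \<subseteq> gcomponent G (\<alpha> \<otimes>\<^bsub>\<Gamma>\<^esub> \<beta>)"
proof
  fix z assume "z \<in> X \<odot> Y"
  then obtain x y where "z = x \<bullet> y" "x \<in> X" "y \<in> Y" "d x = r y"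
    by (rule setprodE)
  then show "z \<in> gcomponent G (\<alpha> \<otimes>\<^bsub>\<Gamma>\<^esub> \<beta>)"
    using assms gdeg_gmult[of x y] by (auto simp: gcomponent_def)
qed

lemma Sgr_setprod:
  assumes X: "X \<in> Q" and Y: "Y \<in> Q"
  shows "X \<odot> Y \<in> Q"
proof -
  interpret \<Gamma>: group \<Gamma>
    by (rule group)
  obtain \<alpha> \<beta> where *: "\<alpha> \<in> carrier \<Gamma>" "X \<subseteq> gcomponent G \<alpha>" "\<beta> \<in> carrier \<Gamma>" "Y \<subseteq> gcomponent G \<beta>"
    using X Y unfolding mem_Sgr by blast
  note C = Sgr_closed[OF X] Sgr_closed[OF Y]
  show ?thesis
  proof (rule SgrI)
    show "openin \<T> (X \<odot> Y)" "compactin \<T> (X \<odot> Y)"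
      using X Y Sgr_open Sgr_compact openin_setprod compactin_setprod by simp_all
    show "X \<odot> Y \<subseteq> gcomponent G (\<alpha> \<otimes>\<^bsub>\<Gamma>\<^esub> \<beta>)" "\<alpha> \<otimes>\<^bsub>\<Gamma>\<^esub> \<beta> \<in> carrier \<Gamma>"
      using * setprod_gcomponent by auto
    show "inj_on d (X \<odot> Y)"
    proof (rule inj_onI)
      fix z z' assume z: "z \<in> X \<odot> Y" "z' \<in> X \<odot> Y" "d z = d z'"
      obtain x y where xy: "z = x \<bullet> y" "x \<in> X" "y \<in> Y" "d x = r y"
        using z(1) by (rule setprodE)
      obtain x' y' where xy': "z' = x' \<bullet> y'" "x' \<in> X" "y' \<in> Y" "d x' = r y'"
        using z(2) by (rule setprodE)
      have "y = y'"
        using Sgr_gdomD[OF Y xy(3) xy'(3)] xy xy' z C by simp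
      then have "x = x'"
        using Sgr_gdomD[OF X xy(2) xy'(2)] xy xy' by simp
      then show "z = z'"
        using \<open>y = y'\<close> xy xy' by simp
    qed
    show "inj_on r (X \<odot> Y)"
    proof (rule inj_onI)
      fix z z' assume z: "z \<in> X \<odot> Y" "z' \<in> X \<odot> Y" "r z = r z'"
      obtain x y where xy: "z = x \<bullet> y" "x \<in> X" "y \<in> Y" "d x = r y"
        using z(1) by (rule setprodE)
      obtain x' y' where xy': "z' = x' \<bullet> y'" "x' \<in> X" "y' \<in> Y" "d x' = r y'"
        using z(2) by (rule setprodE)
      have "x = x'"
        using Sgr_granD[OF X xy(2) xy'(2)] xy xy' z C by simp
      then have "y = y'"
        using Sgr_granD[OF Y xy(3) xy'(3)] xy xy' by simp
      then show "z = z'"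
        using \<open>x = x'\<close> xy xy' by simp
    qed
  qed
qed

lemma Sgr_ginv:
  assumes X: "X \<in> Q"
  shows "\<iota> ` X \<in> Q"
proof -
  interpret \<Gamma>: group \<Gamma>
    by (rule group)
  obtain \<alpha> where \<alpha>: "\<alpha> \<in> carrier \<Gamma>" "X \<subseteq> gcomponent G \<alpha>"
    using X unfolding mem_Sgr by blast
  note C = Sgr_closed[OF X]
  show ?thesis
  proof (rule SgrI)
    show "openin \<T> (\<iota> ` X)" "compactin \<T> (\<iota> ` X)"
      using X Sgr_open Sgr_compact openin_ginv_image compactin_ginv_image by simp_all
    show "\<iota> ` X \<subseteq> gcomponent G (inv\<^bsub>\<Gamma>\<^esub> \<alpha>)" "inv\<^bsub>\<Gamma>\<^esub> \<alpha> \<in> carrier \<Gamma>"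
      using \<alpha> gdeg_ginv by (auto simp: gcomponent_def)
    show "inj_on d (\<iota> ` X)"
    proof (rule inj_onI, elim imageE)
      fix v w x y assume "d v = d w" "v = \<iota> x" "w = \<iota> y" "x \<in> X" "y \<in> X"
      then show "v = w"
        using Sgr_granD[OF X, of x y] C by simp
    qed
    show "inj_on r (\<iota> ` X)"
    proof (rule inj_onI, elim imageE)
      fix v w x y assume "r v = r w" "v = \<iota> x" "w = \<iota> y" "x \<in> X" "y \<in> X"
      then show "v = w"
        using Sgr_gdomD[OF X, of x y] C by simp
    qed
  qed
qed

lemma setprod_assoc:
  assumes "X \<subseteq> carrier G" "Y \<subseteq> carrier G" "Z \<subseteq> carrier G"
  shows "X \<odot> Y \<odot> Z = X \<odot> (Y \<odot> Z)"
proof (intro equalityI subsetI)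
  fix w assume "w \<in> X \<odot> Y \<odot> Z"
  then obtain v z where v: "w = v \<bullet> z" "v \<in> X \<odot> Y" "z \<in> Z" "d v = r z"
    by (rule setprodE)
  obtain x y where x: "v = x \<bullet> y" "x \<in> X" "y \<in> Y" "d x = r y"
    using v(2) by (rule setprodE)
  have C: "x \<in> carrier G" "y \<in> carrier G" "z \<in> carrier G"
    using v x assms by auto
  have "d y = r z"
    using v x C by simp
  then have "w = x \<bullet> (y \<bullet> z)" "d x = r (y \<bullet> z)" "y \<bullet> z \<in> Y \<odot> Z"
    using v x C gmult_assoc by (simp_all add: setprodI)
  then show "w \<in> X \<odot> (Y \<odot> Z)"
    using x by (simp add: setprodI)
next
  fix w assume "w \<in> X \<odot> (Y \<odot> Z)"
  then obtain x v where v: "w = x \<bullet> v" "x \<in> X" "v \<in> Y \<odot> Z" "d x = r v"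
    by (rule setprodE)
  obtain y z where y: "v = y \<bullet> z" "y \<in> Y" "z \<in> Z" "d y = r z"
    using v(3) by (rule setprodE)
  have C: "x \<in> carrier G" "y \<in> carrier G" "z \<in> carrier G"
    using v y assms by auto
  have "d x = r y"
    using v y C by simp
  then have "w = (x \<bullet> y) \<bullet> z" "d (x \<bullet> y) = r z" "x \<bullet> y \<in> X \<odot> Y"
    using v y C gmult_assoc by (simp_all add: setprodI)
  then show "w \<in> X \<odot> Y \<odot> Z"
    using y by (simp add: setprodI)
qed

lemma Sgr_empty: "{} \<in> Q"
  by (rule Sgr_units) auto

lemma semigroup_with_zero_Sgr: "semigroup_with_zero (Sgr \<Gamma> G)"
proof -
  have "X \<subseteq> carrier G" if "X \<in> Q" for X
    using Sgr_closed[OF that] by blast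
  then show ?thesis
    unfolding semigroup_with_zero_def
    using Sgr_setprod Sgr_empty by (auto simp: setprod_assoc) (auto simp: setprod_def)
qed

lemma setprod_ginv_setprod:
  assumes X: "X \<in> Q"
  shows "X \<odot> \<iota> ` X \<odot> X = X"
proof (intro equalityI subsetI)
  note C = Sgr_closed[OF X]
  fix w assume "w \<in> X \<odot> \<iota> ` X \<odot> X"
  then obtain v z where v: "w = v \<bullet> z" "v \<in> X \<odot> \<iota> ` X" "z \<in> X" "d v = r z"
    by (rule setprodE)
  obtain x y where x: "v = x \<bullet> \<iota> y" "x \<in> X" "y \<in> X" "d x = r (\<iota> y)"
    using v(2) by (auto elim: setprodE)
  then have "x = y"
    using Sgr_gdomD[OF X] C by simp
  then show "w \<in> X"
    using v x C by simp
next
  fix x assume x: "x \<in> X"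
  then have xC: "x \<in> carrier G"
    using Sgr_closed[OF X] by blast
  then have "x \<bullet> \<iota> x \<in> X \<odot> \<iota> ` X"
    using x by (intro setprodI) auto
  then have "x \<bullet> \<iota> x \<bullet> x \<in> X \<odot> \<iota> ` X \<odot> X"
    using x xC by (intro setprodI) auto
  then show "x \<in> X \<odot> \<iota> ` X \<odot> X"
    using xC by simp
qed

lemma ginv_image_ginv_image: "X \<in> Q \<Longrightarrow> \<iota> ` \<iota> ` X = X"
  using Sgr_closed by (force simp: image_iff)

text \<open>Write \<open>x\<close> as a product a z b with a and b in \<open>X\<close> and z in
  \<open>Z\<close>. Injectivity of domain and range on \<open>X\<close> forces a = b = x, and then z
  can only be the inverse of \<open>x\<close>.\<close>

lemma ginv_image_subset:
  assumes X: "X \<in> Q" and Z: "Z \<in> Q" and XZX: "X \<odot> Z \<odot> X = X"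
  shows "\<iota> ` X \<subseteq> Z"
proof
  note C = Sgr_closed[OF X] Sgr_closed[OF Z]
  fix w assume "w \<in> \<iota> ` X"
  then obtain x where x: "x \<in> X" "w = \<iota> x"
    by blast
  then have "x \<in> X \<odot> Z \<odot> X"
    using XZX by simp
  then obtain v b where v: "x = v \<bullet> b" "v \<in> X \<odot> Z" "b \<in> X" "d v = r b"
    by (rule setprodE)
  obtain a z where a: "v = a \<bullet> z" "a \<in> X" "z \<in> Z" "d a = r z"
    using v(2) by (rule setprodE)
  have "x = b"
    using Sgr_gdomD[OF X x(1) v(3)] v a C by simp
  moreover have "x = a"
    using Sgr_granD[OF X x(1) a(2)] v a C by simp
  ultimately have x': "x \<bullet> z \<bullet> x = x" "d x = r z" "d z = r x"
    using v a C by simp_all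
  have xC: "x \<in> carrier G" "z \<in> carrier G"
    using x a C by auto
  have "x \<bullet> z = x \<bullet> z \<bullet> x \<bullet> \<iota> x"
    using x'(2,3) xC by simp
  also have "\<dots> = r x"
    using x' by simp
  finally show "w \<in> Z"
    using ginv_unique[OF xC x'(2)] x a by simp
qed

lemma is_sinv_Sgr_iff:
  assumes X: "X \<in> Q"
  shows "is_sinv (Sgr \<Gamma> G) X Z \<longleftrightarrow> Z = \<iota> ` X"
proof
  assume "is_sinv (Sgr \<Gamma> G) X Z"
  then have Z: "Z \<in> Q" "X \<odot> Z \<odot> X = X" "Z \<odot> X \<odot> Z = Z"
    by (simp_all add: is_sinv_def)
  \<comment> \<open>Being inverse to each other is symmetric, so the inclusion may be used with
    \<open>X\<close> and \<open>Z\<close> exchanged.\<close>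
  have "\<iota> ` \<iota> ` Z \<subseteq> \<iota> ` X"
    using ginv_image_subset[OF Z(1) X Z(3)] by (rule image_mono)
  then show "Z = \<iota> ` X"
    using ginv_image_subset[OF X Z(1,2)] ginv_image_ginv_image[OF Z(1)] by simp
next
  assume Z: "Z = \<iota> ` X"
  then show "is_sinv (Sgr \<Gamma> G) X Z"
    using Sgr_ginv[OF X] setprod_ginv_setprod[OF X] setprod_ginv_setprod[OF Sgr_ginv[OF X]]
      ginv_image_ginv_image[OF X] by (simp add: is_sinv_def)
qed

sublocale SG: inv_semigroup "Sgr \<Gamma> G"
  by unfold_locales
    (use semigroup_with_zero_Sgr is_sinv_Sgr_iff in \<open>auto simp: inverse_semigroup_def\<close>)

lemma sinv_Sgr: "X \<in> Q \<Longrightarrow> sinv (Sgr \<Gamma> G) X = \<iota> ` X"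
  using SG.is_sinv_sinv is_sinv_Sgr_iff by blast

text \<open>In an idempotent slice a factorisation x = y z forces x = y = z by injectivity of range
  and domain, and x x = x makes \<open>x\<close> a unit.\<close>

lemma mem_idempotents_Sgr:
  "X \<in> idempotents (Sgr \<Gamma> G) \<longleftrightarrow> openin \<T> X \<and> compactin \<T> X \<and> X \<subseteq> gunits G"
proof
  assume X: "X \<in> idempotents (Sgr \<Gamma> G)"
  then have XQ: "X \<in> Q" and XX: "X \<odot> X = X"
    using SG.idem_closed SG.idem_idem[of X] by auto
  have "x \<in> gunits G" if x: "x \<in> X" for x
  proof -
    have "x \<in> X \<odot> X"
      using x XX by simp
    then obtain y z where y: "x = y \<bullet> z" "y \<in> X" "z \<in> X" "d y = r z"
      by (rule setprodE)
    have xz: "x = z"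
      using Sgr_gdomD[OF XQ x y(3)] y Sgr_closed[OF XQ] by simp
    have xy: "x = y"
      using Sgr_granD[OF XQ x y(2)] y Sgr_closed[OF XQ] by simp
    have "x \<bullet> x = x" "d x = r x"
      using y(1,4) unfolding xz[symmetric] xy[symmetric] by simp_all
    then show ?thesis
      by (intro idempotent_unit[OF Sgr_closed[OF XQ x]])
  qed
  then show "openin \<T> X \<and> compactin \<T> X \<and> X \<subseteq> gunits G"
    using Sgr_open[OF XQ] Sgr_compact[OF XQ] by blast
next
  assume X: "openin \<T> X \<and> compactin \<T> X \<and> X \<subseteq> gunits G"
  then have "X \<in> Q"
    by (simp add: Sgr_units)
  moreover have "X \<odot> X = X"
  proof (intro equalityI subsetI)
    fix z assume "z \<in> X \<odot> X"
    then obtain x y where xy: "z = x \<bullet> y" "x \<in> X" "y \<in> X" "d x = r y"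
      by (rule setprodE)
    then have u: "x \<in> gunits G" "y \<in> gunits G"
      using X by auto
    then have "d x = y"
      using xy by simp
    then show "z \<in> X"
      using xy(1,2) gunits_closed[OF u(1)] by simp
  next
    fix x assume x: "x \<in> X"
    then have u: "x \<in> gunits G"
      using X by blast
    then show "x \<in> X \<odot> X"
      using setprodI[OF x x] gunits_closed[OF u] by simp
  qed
  ultimately show "X \<in> idempotents (Sgr \<Gamma> G)"
    by (intro SG.idemI) simp_all
qed

text \<open>If \<open>X \<subseteq> Y\<close>, the idempotent relating them is the set of domains of
  \<open>X\<close>: by injectivity, an element of \<open>Y\<close> with such a domain belongs to
  \<open>X\<close>. Order-theoretic questions about slices thereby become set-theoretic.\<close>

lemma le_Sgr_iff:
  assumes X: "X \<in> Q" and Y: "Y \<in> Q"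
  shows "X \<sqsubseteq>\<^bsub>nat_order (Sgr \<Gamma> G)\<^esub> Y \<longleftrightarrow> X \<subseteq> Y"
proof
  assume "X \<sqsubseteq>\<^bsub>nat_order (Sgr \<Gamma> G)\<^esub> Y"
  then obtain F where F: "F \<in> idempotents (Sgr \<Gamma> G)" "X = Y \<odot> F"
    unfolding SG.nle_iff by auto
  show "X \<subseteq> Y"
  proof
    fix x assume "x \<in> X"
    then obtain y u where y: "x = y \<bullet> u" "y \<in> Y" "u \<in> F" "d y = r u"
      unfolding F(2) by (rule setprodE)
    then have "d y = u"
      using F(1) gran_unit[of u] unfolding mem_idempotents_Sgr by auto
    then show "x \<in> Y"
      using y Sgr_closed[OF Y] by simp
  qed
next
  assume XY: "X \<subseteq> Y"
  have "d ` X \<subseteq> gunits G"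
    using Sgr_closed[OF X] by auto
  then have F: "d ` X \<in> idempotents (Sgr \<Gamma> G)"
    unfolding mem_idempotents_Sgr
    using openin_gdom_image[OF Sgr_open[OF X]] image_compactin[OF Sgr_compact[OF X] continuous_gdom]
    by blast
  have "X = Y \<odot> d ` X"
  proof (intro equalityI subsetI)
    fix x assume x: "x \<in> X"
    then have "x \<bullet> d x \<in> Y \<odot> d ` X"
      using XY Sgr_closed[OF X x] by (intro setprodI) auto
    then show "x \<in> Y \<odot> d ` X"
      using Sgr_closed[OF X x] by simp
  next
    fix z assume "z \<in> Y \<odot> d ` X"
    then obtain y u where y: "z = y \<bullet> u" "y \<in> Y" "u \<in> d ` X" "d y = r u"
      by (rule setprodE)
    then obtain x where x: "x \<in> X" "u = d x"
      by blast
    then have "d y = d x"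
      using y Sgr_closed[OF X x(1)] by simp
    then show "z \<in> X"
      using Sgr_gdomD[OF Y y(2), of x] XY x y Sgr_closed[OF Y y(2)] by auto
  qed
  then show "X \<sqsubseteq>\<^bsub>nat_order (Sgr \<Gamma> G)\<^esub> Y"
    unfolding SG.nle_iff using F by auto
qed

section \<open>Meets, degrees and joins of slices\<close>

lemma greatest_Sgr_Int:
  "X \<in> Q \<Longrightarrow> Y \<in> Q \<Longrightarrow> greatest (nat_order (Sgr \<Gamma> G)) (X \<inter> Y) (Lower (nat_order (Sgr \<Gamma> G)) {X, Y})"
  by (subst greatest_Lower_pair_iff) (auto simp: le_Sgr_iff Sgr_Int)

lemma meet_Sgr: "X \<in> Q \<Longrightarrow> Y \<in> Q \<Longrightarrow> X \<sqinter>\<^bsub>nat_order (Sgr \<Gamma> G)\<^esub> Y = X \<inter> Y"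
  by (rule partial_order.meet_eqI[OF SG.partial_order_nat_order greatest_Sgr_Int])

lemma lower_semilattice_Sgr: "lower_semilattice (nat_order (Sgr \<Gamma> G))"
  unfolding lower_semilattice_def lower_semilattice_axioms_def
  using SG.partial_order_nat_order greatest_Sgr_Int by auto

lemma sdeg_Sgr: "X \<noteq> {} \<Longrightarrow> \<alpha> \<in> carrier \<Gamma> \<Longrightarrow> X \<subseteq> gcomponent G \<alpha> \<Longrightarrow> sdeg (Sgr \<Gamma> G) X = \<alpha>"
  by (auto simp: Sgr_def gcomponent_def intro!: the_equality)

lemma sdeg_Sgr_mem: "X \<in> Q \<Longrightarrow> x \<in> X \<Longrightarrow> sdeg (Sgr \<Gamma> G) X = gdeg G x"
proof -
  assume X: "X \<in> Q" and x: "x \<in> X"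
  obtain \<alpha> where "\<alpha> \<in> carrier \<Gamma>" "X \<subseteq> gcomponent G \<alpha>"
    using X unfolding mem_Sgr by blast
  moreover from this have "gdeg G x = \<alpha>"
    using x by (auto simp: gcomponent_def)
  ultimately show ?thesis
    using sdeg_Sgr[of X \<alpha>] x by blast
qed

text \<open>The empty slice needs a case of its own: it belongs to every component, while its
  \<open>sdeg\<close> carries no information.\<close>

lemma mem_scomponent_Sgr:
  "\<alpha> \<in> carrier \<Gamma> \<Longrightarrow> X \<in> scomponent (Sgr \<Gamma> G) \<alpha> \<longleftrightarrow> X \<in> Q \<and> X \<subseteq> gcomponent G \<alpha>"
proof -
  assume \<alpha>: "\<alpha> \<in> carrier \<Gamma>"
  show ?thesis
  proof (cases "X = {}")
    case True
    then show ?thesis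
      using Sgr_empty by (simp add: scomponent_def)
  next
    case False
    then obtain x where x: "x \<in> X"
      by blast
    show ?thesis
    proof
      assume "X \<in> scomponent (Sgr \<Gamma> G) \<alpha>"
      then have X: "X \<in> Q" "sdeg (Sgr \<Gamma> G) X = \<alpha>"
        using False by (simp_all add: scomponent_def)
      have "y \<in> gcomponent G \<alpha>" if "y \<in> X" for y
        using sdeg_Sgr_mem[OF X(1) that] X(2) Sgr_closed[OF X(1) that] by (simp add: gcomponent_def)
      then show "X \<in> Q \<and> X \<subseteq> gcomponent G \<alpha>"
        using X(1) by blast
    next
      assume "X \<in> Q \<and> X \<subseteq> gcomponent G \<alpha>"
      then show "X \<in> scomponent (Sgr \<Gamma> G) \<alpha>"
        using False \<alpha> sdeg_Sgr[of X \<alpha>] by (simp add: scomponent_def)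
    qed
  qed
qed

lemma is_graded_semigroup_Sgr: "is_graded_semigroup \<Gamma> (Sgr \<Gamma> G)"
  unfolding is_graded_semigroup_def
proof (intro conjI ballI impI)
  fix X assume X: "X \<in> Q" "X \<noteq> szero (Sgr \<Gamma> G)"
  then obtain x where x: "x \<in> X"
    by auto
  then show "sdeg (Sgr \<Gamma> G) X \<in> carrier \<Gamma>"
    using sdeg_Sgr_mem[OF X(1) x] gdeg_closed[OF Sgr_closed[OF X(1) x]] by simp
next
  fix X Y assume X: "X \<in> Q" and Y: "Y \<in> Q" and ne: "X \<cdot>\<^bsub>Sgr \<Gamma> G\<^esub> Y \<noteq> szero (Sgr \<Gamma> G)"
  then obtain z where z: "z \<in> X \<odot> Y"
    by auto
  then obtain x y where xy: "z = x \<bullet> y" "x \<in> X" "y \<in> Y" "d x = r y"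
    by (rule setprodE)
  have "sdeg (Sgr \<Gamma> G) (X \<odot> Y) = gdeg G z" "sdeg (Sgr \<Gamma> G) X = gdeg G x"
    "sdeg (Sgr \<Gamma> G) Y = gdeg G y"
    using sdeg_Sgr_mem Sgr_setprod X Y z xy by simp_all
  then show "sdeg (Sgr \<Gamma> G) (X \<cdot>\<^bsub>Sgr \<Gamma> G\<^esub> Y) = sdeg (Sgr \<Gamma> G) X \<otimes>\<^bsub>\<Gamma>\<^esub> sdeg (Sgr \<Gamma> G) Y"
    using gdeg_gmult[of x y] xy Sgr_closed X Y by simp
qed

lemma Sgr_Un:
  assumes X: "X \<in> Q" and Y: "Y \<in> Q" and \<alpha>: "\<alpha> \<in> carrier \<Gamma>" "X \<subseteq> gcomponent G \<alpha>" "Y \<subseteq> gcomponent G \<alpha>"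
    and comp: "\<And>x y. x \<in> X \<Longrightarrow> y \<in> Y \<Longrightarrow> d x = d y \<or> r x = r y \<Longrightarrow> x = y"
  shows "X \<union> Y \<in> Q"
proof (rule SgrI)
  show "openin \<T> (X \<union> Y)" "compactin \<T> (X \<union> Y)"
    using X Y Sgr_open Sgr_compact by (auto intro: compactin_Un)
  show "inj_on d (X \<union> Y)"
    using Sgr_gdomD[OF X] Sgr_gdomD[OF Y] comp by (intro inj_onI) (metis UnE)
  show "inj_on r (X \<union> Y)"
    using Sgr_granD[OF X] Sgr_granD[OF Y] comp by (intro inj_onI) (metis UnE)
qed (use \<alpha> in auto)

lemma least_Sgr_Un:
  assumes "X \<in> Q" "Y \<in> Q" "X \<union> Y \<in> Q"
  shows "least (nat_order (Sgr \<Gamma> G)) (X \<union> Y) (Upper (nat_order (Sgr \<Gamma> G)) {X, Y})"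
  using assms by (subst least_Upper_pair_iff) (auto simp: le_Sgr_iff)

text \<open>A coincidence of ranges would make the inverse of \<open>x\<close> composable with
  \<open>y\<close>, and one of domains would make \<open>x\<close> composable with the inverse of
  \<open>y\<close>; either product would lie in an empty set.\<close>

lemma orthogonal_Sgr_disjoint:
  assumes X: "X \<in> Q" and Y: "Y \<in> Q" and orth: "orthogonal_in (Sgr \<Gamma> G) X Y"
    and xy: "x \<in> X" "y \<in> Y"
  shows "d x \<noteq> d y" "r x \<noteq> r y"
proof -
  have e: "\<iota> ` X \<odot> Y = {}" "X \<odot> \<iota> ` Y = {}"
    using orth sinv_Sgr X Y by (simp_all add: orthogonal_in_def)
  have C: "x \<in> carrier G" "y \<in> carrier G"
    using xy X Y Sgr_closed by auto
  show "r x \<noteq> r y"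
    using setprodI[of "\<iota> x" "\<iota> ` X" y Y] e xy C by auto
  show "d x \<noteq> d y"
    using setprodI[of x X "\<iota> y" "\<iota> ` Y"] e xy C by auto
qed

section \<open>The Boolean algebras of idempotent slices\<close>

abbreviation EQ :: "'a set set" where "EQ \<equiv> idempotents (Sgr \<Gamma> G)"

lemma EQ_Q: "X \<in> EQ \<Longrightarrow> X \<in> Q"
  by auto

lemma EQ_Un: "X \<in> EQ \<Longrightarrow> Y \<in> EQ \<Longrightarrow> X \<union> Y \<in> EQ"
  unfolding mem_idempotents_Sgr by (auto intro: compactin_Un)

lemma EQ_Int: "X \<in> EQ \<Longrightarrow> Y \<in> EQ \<Longrightarrow> X \<inter> Y \<in> EQ"
  unfolding mem_idempotents_Sgr by (auto intro: compactin_Int[OF Hausdorff])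

lemma EQ_Diff: "X \<in> EQ \<Longrightarrow> Y \<in> EQ \<Longrightarrow> X - Y \<in> EQ"
  using Sgr_Diff[of X Y] Sgr_open[of "X - Y"] Sgr_compact[of "X - Y"] EQ_Q[of X] EQ_Q[of Y]
  unfolding mem_idempotents_Sgr by blast

lemma le_EQ_iff: "X \<in> EQ \<Longrightarrow> Y \<in> EQ \<Longrightarrow> X \<sqsubseteq>\<^bsub>nat_order (Sgr \<Gamma> G)\<^esub> Y \<longleftrightarrow> X \<subseteq> Y"
  by (simp add: le_Sgr_iff)

text \<open>Computing with units is avoided: product and intersection are both the greatest lower
  bound in the order of idempotents.\<close>

lemma setprod_EQ:
  assumes "X \<in> EQ" "Y \<in> EQ"
  shows "X \<odot> Y = X \<inter> Y"
proof -
  have "X \<odot> Y = X \<sqinter>\<^bsub>idem_order (Sgr \<Gamma> G)\<^esub> Y"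
    using SG.meet_idem_order[OF assms] by simp
  also have "\<dots> = X \<inter> Y"
    by (rule partial_order.meet_eqI[OF SG.partial_order_idem_order], subst greatest_Lower_pair_iff)
      (use assms in \<open>auto simp: le_EQ_iff EQ_Int\<close>)
  finally show ?thesis .
qed

lemma lattice_idem_order_Sgr: "lattice (idem_order (Sgr \<Gamma> G))"
  unfolding lattice_def upper_semilattice_def lower_semilattice_def
    upper_semilattice_axioms_def lower_semilattice_axioms_def
proof (intro conjI allI impI)
  show "partial_order (idem_order (Sgr \<Gamma> G))" "partial_order (idem_order (Sgr \<Gamma> G))"
    by (rule SG.partial_order_idem_order)+
  fix X Y assume XY: "X \<in> carrier (idem_order (Sgr \<Gamma> G))" "Y \<in> carrier (idem_order (Sgr \<Gamma> G))"
  show "\<exists>s. least (idem_order (Sgr \<Gamma> G)) s (Upper (idem_order (Sgr \<Gamma> G)) {X, Y})"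
    using XY by (intro exI[of _ "X \<union> Y"], subst least_Upper_pair_iff) (auto simp: le_EQ_iff EQ_Un)
  show "\<exists>s. greatest (idem_order (Sgr \<Gamma> G)) s (Lower (idem_order (Sgr \<Gamma> G)) {X, Y})"
    using XY by (intro exI[of _ "X \<inter> Y"], subst greatest_Lower_pair_iff)
      (auto simp: le_EQ_iff EQ_Int)
qed

lemma join_idem_order_Sgr: "X \<in> EQ \<Longrightarrow> Y \<in> EQ \<Longrightarrow> X \<squnion>\<^bsub>idem_order (Sgr \<Gamma> G)\<^esub> Y = X \<union> Y"
  by (rule partial_order.join_eqI[OF SG.partial_order_idem_order], subst least_Upper_pair_iff)
    (auto simp: le_EQ_iff EQ_Un)

lemma meet_idem_order_Sgr: "X \<in> EQ \<Longrightarrow> Y \<in> EQ \<Longrightarrow> X \<sqinter>\<^bsub>idem_order (Sgr \<Gamma> G)\<^esub> Y = X \<inter> Y"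
  by (simp add: SG.meet_idem_order setprod_EQ)

lemma distributive_lattice_idem_order_Sgr: "distributive_lattice (idem_order (Sgr \<Gamma> G))"
  unfolding distributive_lattice_def
  using lattice_idem_order_Sgr by (auto simp: join_idem_order_Sgr meet_idem_order_Sgr EQ_Un EQ_Int)

text \<open>The ideal consists of the compact open subsets of \<open>F\<close>, which are closed
  under union, intersection and difference.\<close>

lemma boolean_lattice_idem_ideal_Sgr:
  assumes F: "F \<in> EQ"
  shows "boolean_lattice (idem_ideal (Sgr \<Gamma> G) F)"
proof -
  let ?I = "idem_ideal (Sgr \<Gamma> G) F"
  have carr: "carrier ?I = {X \<in> EQ. X \<subseteq> F}"
    using F by (auto simp: le_EQ_iff)
  have le: "X \<sqsubseteq>\<^bsub>?I\<^esub> Y \<longleftrightarrow> X \<subseteq> Y" if "X \<in> carrier ?I" "Y \<in> carrier ?I" for X Y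
    using that le_EQ_iff by simp
  have po: "partial_order ?I"
    by (rule SG.partial_order_idem_ideal)
  have Un: "X \<union> Y \<in> carrier ?I" and Int: "X \<inter> Y \<in> carrier ?I"
    if "X \<in> carrier ?I" "Y \<in> carrier ?I" for X Y
    using that EQ_Un EQ_Int unfolding carr by auto
  have lub: "least ?I (X \<union> Y) (Upper ?I {X, Y})" if "X \<in> carrier ?I" "Y \<in> carrier ?I" for X Y
    unfolding least_Upper_pair_iff[OF that] using that Un[OF that] le by auto
  have glb: "greatest ?I (X \<inter> Y) (Lower ?I {X, Y})" if "X \<in> carrier ?I" "Y \<in> carrier ?I" for X Y
    unfolding greatest_Lower_pair_iff[OF that] using that Int[OF that] le by auto
  have ends: "{} \<in> carrier ?I" "F \<in> carrier ?I"
    unfolding carr using F SG.zero_idem by auto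
  have bot: "least ?I {} (carrier ?I)" and top: "greatest ?I F (carrier ?I)"
    unfolding least_def greatest_def using ends le by (auto simp: carr)
  have lat: "lattice ?I"
    unfolding lattice_def upper_semilattice_def lower_semilattice_def
      upper_semilattice_axioms_def lower_semilattice_axioms_def
    using po lub glb by blast
  have join: "X \<squnion>\<^bsub>?I\<^esub> Y = X \<union> Y" and meet: "X \<sqinter>\<^bsub>?I\<^esub> Y = X \<inter> Y"
    if "X \<in> carrier ?I" "Y \<in> carrier ?I" for X Y
    using that
    by (simp_all add: partial_order.join_eqI[OF po lub] partial_order.meet_eqI[OF po glb])
  have b: "\<bottom>\<^bsub>?I\<^esub> = {}" and t: "\<top>\<^bsub>?I\<^esub> = F"
    using partial_order.bottom_eqI[OF po bot] partial_order.top_eqI[OF po top] by simp_all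
  have "bounded_lattice ?I"
    unfolding bounded_lattice_def weak_partial_order_bottom_def weak_partial_order_top_def
      weak_partial_order_bottom_axioms_def weak_partial_order_top_axioms_def
    using lat bot top partial_order.axioms(1)[OF po] by blast
  moreover have "distributive_lattice ?I"
    unfolding distributive_lattice_def
  proof (intro conjI ballI)
    fix X Y Z assume "X \<in> carrier ?I" "Y \<in> carrier ?I" "Z \<in> carrier ?I"
    then show "X \<sqinter>\<^bsub>?I\<^esub> (Y \<squnion>\<^bsub>?I\<^esub> Z) = (X \<sqinter>\<^bsub>?I\<^esub> Y) \<squnion>\<^bsub>?I\<^esub> (X \<sqinter>\<^bsub>?I\<^esub> Z)"
      by (simp only: join meet Un Int Int_Un_distrib)
  qed (rule lat)
  moreover have "complement_in ?I X (F - X)" if X: "X \<in> carrier ?I" for X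
  proof -
    have FX: "F - X \<in> carrier ?I"
      using X F EQ_Diff unfolding carr by auto
    have "X \<subseteq> F"
      using X unfolding carr by auto
    then show ?thesis
      unfolding complement_in_def join[OF X FX] meet[OF X FX] b t using X FX by blast
  qed
  ultimately show ?thesis
    unfolding boolean_lattice_def by blast
qed

lemma graded_boolean_Sgr: "graded_boolean \<Gamma> (Sgr \<Gamma> G)"
  unfolding graded_boolean_def
proof (intro conjI ballI impI)
  fix \<alpha> X Y assume \<alpha>: "\<alpha> \<in> carrier \<Gamma>"
    and "X \<in> scomponent (Sgr \<Gamma> G) \<alpha>" "Y \<in> scomponent (Sgr \<Gamma> G) \<alpha>"
    and orth: "orthogonal_in (Sgr \<Gamma> G) X Y"
  then have XY: "X \<in> Q" "X \<subseteq> gcomponent G \<alpha>" "Y \<in> Q" "Y \<subseteq> gcomponent G \<alpha>"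
    by (simp_all add: mem_scomponent_Sgr)
  then have "X \<union> Y \<in> Q"
    using orthogonal_Sgr_disjoint[OF XY(1,3) orth] \<alpha> by (intro Sgr_Un) auto
  then show "\<exists>j. least (nat_order (Sgr \<Gamma> G)) j (Upper (nat_order (Sgr \<Gamma> G)) {X, Y})"
    using least_Sgr_Un XY by blast
qed (use distributive_lattice_idem_order_Sgr boolean_lattice_idem_ideal_Sgr in auto)

text \<open>From here on the ultrafilter groupoid of the slices is at hand as \<open>SG.UG\<close>,
  with all that was proved about it.\<close>

sublocale SG: graded_boolean_semigroup "Sgr \<Gamma> G" \<Gamma>
  by (intro graded_boolean_semigroup.intro SG.inv_semigroup_axioms
      graded_boolean_semigroup_axioms.intro group is_graded_semigroup_Sgr lower_semilattice_Sgr
      graded_boolean_Sgr)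

text \<open>The union of \<open>A\<close> and \<open>B\<close> is itself an idempotent slice, hence
  the upper bound against which to test \<open>F\<close>.\<close>

lemma complement_Sgr_iff:
  assumes F: "F \<in> EQ"
  shows "complement_in (idem_ideal (Sgr \<Gamma> G) F) A B \<longleftrightarrow>
    A \<in> EQ \<and> B \<in> EQ \<and> A \<inter> B = {} \<and> A \<union> B = F"
proof
  assume "complement_in (idem_ideal (Sgr \<Gamma> G) F) A B"
  then have AB: "A \<in> EQ" "B \<in> EQ" "A \<subseteq> F" "B \<subseteq> F" "A \<inter> B = {}"
      and lub: "\<And>H. H \<in> EQ \<Longrightarrow> A \<subseteq> H \<Longrightarrow> B \<subseteq> H \<Longrightarrow> F \<subseteq> H"
    using F unfolding SG.complement_iff[OF F] by (auto simp: le_EQ_iff setprod_EQ)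
  then show "A \<in> EQ \<and> B \<in> EQ \<and> A \<inter> B = {} \<and> A \<union> B = F"
    using lub[OF EQ_Un[OF AB(1,2)]] by blast
next
  assume "A \<in> EQ \<and> B \<in> EQ \<and> A \<inter> B = {} \<and> A \<union> B = F"
  then show "complement_in (idem_ideal (Sgr \<Gamma> G) F) A B"
    using F unfolding SG.complement_iff[OF F] by (auto simp: le_EQ_iff setprod_EQ)
qed

end

section \<open>Proper covering partial functors\<close>

locale GrGp_morphism =
  G: graded_ample_groupoid G \<Gamma> + H: graded_ample_groupoid H \<Gamma>
  for G :: "('a, 'c) graded_groupoid" and H :: "('b, 'c) graded_groupoid"
    and \<Gamma> :: "('c, 'm) monoid_scheme" +
  fixes \<phi> :: "'a \<rightharpoonup> 'b"
  assumes hom: "\<phi> \<in> GrGp_hom \<Gamma> G H"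
begin

abbreviation D :: "'a set" where "D \<equiv> dom \<phi>"
abbreviation f :: "'a \<Rightarrow> 'b" where "f x \<equiv> the (\<phi> x)"

lemma partial_functor: "partial_functor G H \<phi>"
  and inj: "star_injective G \<phi>"
  and surj: "star_surjective G H \<phi>"
  and proper: "proper_partial G H \<phi>"
  and graded: "\<alpha> \<in> carrier \<Gamma> \<Longrightarrow> (the \<circ> \<phi>) ` (gcomponent G \<alpha> \<inter> dom \<phi>) \<subseteq> gcomponent H \<alpha>"
  using hom unfolding GrGp_hom_def by blast+

lemma open_D: "openin (gtop G) D"
  using partial_functor unfolding partial_functor_def open_subgroupoid_def by blast

lemma D_closed: "x \<in> D \<Longrightarrow> x \<in> carrier G"
  using G.open_closed[OF open_D] .

lemma D_gdom [simp]: "x \<in> D \<Longrightarrow> gdom G x \<in> D"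
  and D_gran [simp]: "x \<in> D \<Longrightarrow> gran G x \<in> D"
  and D_ginv [simp]: "x \<in> D \<Longrightarrow> ginv G x \<in> D"
  using partial_functor unfolding partial_functor_def open_subgroupoid_def by blast+

lemma D_gmult: "x \<in> D \<Longrightarrow> y \<in> D \<Longrightarrow> gdom G x = gran G y \<Longrightarrow> x \<bullet>\<^bsub>G\<^esub> y \<in> D"
  using partial_functor D_closed unfolding partial_functor_def open_subgroupoid_def by simp

lemma f_closed [simp]: "x \<in> D \<Longrightarrow> f x \<in> carrier H"
  using partial_functor unfolding partial_functor_def by (force simp: ran_def)

lemma f_gdom: "x \<in> D \<Longrightarrow> f (gdom G x) = gdom H (f x)"
  and f_gran: "x \<in> D \<Longrightarrow> f (gran G x) = gran H (f x)"
  using partial_functor unfolding partial_functor_def by blast+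

lemma f_gmult: "x \<in> D \<Longrightarrow> y \<in> D \<Longrightarrow> gdom G x = gran G y \<Longrightarrow> f (x \<bullet>\<^bsub>G\<^esub> y) = f x \<bullet>\<^bsub>H\<^esub> f y"
  using partial_functor D_closed unfolding partial_functor_def by simp

lemma f_ginv:
  assumes x: "x \<in> D"
  shows "f (ginv G x) = ginv H (f x)"
proof (rule H.ginv_unique)
  show "gdom H (f x) = gran H (f (ginv G x))"
    using x D_closed f_gdom[OF x] f_gran[of "ginv G x"] by simp
  show "f x \<bullet>\<^bsub>H\<^esub> f (ginv G x) = gran H (f x)"
    using x D_closed f_gran[OF x] f_gmult[of x "ginv G x"] by simp
qed (use x in auto)

lemma f_inj: "x \<in> D \<Longrightarrow> y \<in> D \<Longrightarrow> f x = f y \<Longrightarrow> gdom G x = gdom G y \<Longrightarrow> x = y"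
  using inj unfolding star_injective_def by (metis domD option.sel)

text \<open>Inversion exchanges domains and ranges, so star-injectivity also holds for arrows with a
  common range.\<close>

lemma f_inj_gran:
  assumes "x \<in> D" "y \<in> D" "f x = f y" "gran G x = gran G y"
  shows "x = y"
proof -
  have "ginv G x = ginv G y"
    by (rule f_inj) (use assms D_closed in \<open>simp_all add: f_ginv\<close>)
  then show ?thesis
    by (metis G.ginv_ginv[OF D_closed[OF assms(1)]] G.ginv_ginv[OF D_closed[OF assms(2)]])
qed

lemma f_surj:
  assumes "e \<in> D" "gdom G e = e" "y \<in> carrier H" "gdom H y = f e"
  obtains x where "x \<in> D" "gdom G x = e" "f x = y"
proof -
  have "e \<in> D \<inter> gunits G"
    using assms D_closed by (simp add: G.gunits_iff)
  then show ?thesis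
    using surj assms that unfolding star_surjective_def by blast
qed

lemma f_gdeg: "x \<in> D \<Longrightarrow> gdeg H (f x) = gdeg G x"
proof -
  assume x: "x \<in> D"
  then have C: "x \<in> carrier G"
    by (rule D_closed)
  then have "x \<in> gcomponent G (gdeg G x) \<inter> dom \<phi>"
    using x by (simp add: gcomponent_def)
  then have "(the \<circ> \<phi>) x \<in> gcomponent H (gdeg G x)"
    using graded[OF G.gdeg_closed[OF C]] by blast
  then show ?thesis
    by (simp add: gcomponent_def)
qed

lemma continuous: "continuous_map (subtopology (gtop G) D) (gtop H) (the \<circ> \<phi>)"
  and compact: "compactin (gtop H) K \<Longrightarrow> compactin (gtop G) (pvimage \<phi> K)"
  using proper unfolding proper_partial_def by blast+

section \<open>Inverse images of slices\<close>

lemma openin_pvimage: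
  assumes "openin (gtop H) X"
  shows "openin (gtop G) (pvimage \<phi> X)"
proof -
  have "openin (subtopology (gtop G) D) {x \<in> topspace (subtopology (gtop G) D). (the \<circ> \<phi>) x \<in> X}"
    using continuous assms by (rule openin_continuous_map_preimage)
  moreover have "{x \<in> topspace (subtopology (gtop G) D). (the \<circ> \<phi>) x \<in> X} = pvimage \<phi> X"
    using D_closed by (auto simp: pvimage_def)
  ultimately show ?thesis
    using open_D by (simp add: openin_open_subtopology)
qed

lemma mem_pvimage: "x \<in> pvimage \<phi> X \<longleftrightarrow> x \<in> D \<and> f x \<in> X"
  by (simp add: pvimage_def)

lemma pvimage_gcomponent: "X \<subseteq> gcomponent H \<alpha> \<Longrightarrow> pvimage \<phi> X \<subseteq> gcomponent G \<alpha>"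
proof
  fix x assume X: "X \<subseteq> gcomponent H \<alpha>" and "x \<in> pvimage \<phi> X"
  then have x: "x \<in> D" "f x \<in> X"
    by (simp_all add: mem_pvimage)
  then have "gdeg H (f x) = \<alpha>"
    using X by (auto simp: gcomponent_def)
  then show "x \<in> gcomponent G \<alpha>"
    using x f_gdeg D_closed by (simp add: gcomponent_def)
qed

text \<open>Arrows of the preimage with equal domains have images with equal domains in the slice
  \<open>X\<close>; the images coincide, and then star-injectivity applies. Openness and compactness
  are the two halves of properness.\<close>

lemma pvimage_Sgr:
  assumes X: "X \<in> carrier (Sgr \<Gamma> H)"
  shows "pvimage \<phi> X \<in> carrier (Sgr \<Gamma> G)"
proof -
  obtain \<alpha> where \<alpha>: "\<alpha> \<in> carrier \<Gamma>" "X \<subseteq> gcomponent H \<alpha>"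
    using X unfolding H.mem_Sgr by blast
  show ?thesis
  proof (rule G.SgrI)
    show "openin (gtop G) (pvimage \<phi> X)" "compactin (gtop G) (pvimage \<phi> X)"
      using X H.Sgr_open H.Sgr_compact openin_pvimage compact by simp_all
    show "inj_on (gdom G) (pvimage \<phi> X)"
    proof (rule inj_onI)
      fix x y assume "x \<in> pvimage \<phi> X" "y \<in> pvimage \<phi> X" and eq: "gdom G x = gdom G y"
      then have xy: "x \<in> D" "f x \<in> X" "y \<in> D" "f y \<in> X"
        by (simp_all add: mem_pvimage)
      then have "f x = f y"
        using H.Sgr_gdomD[OF X xy(2,4)] eq f_gdom by metis
      then show "x = y"
        using f_inj xy eq by blast
    qed
    show "inj_on (gran G) (pvimage \<phi> X)"
    proof (rule inj_onI)
      fix x y assume "x \<in> pvimage \<phi> X" "y \<in> pvimage \<phi> X" and eq: "gran G x = gran G y"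
      then have xy: "x \<in> D" "f x \<in> X" "y \<in> D" "f y \<in> X"
        by (simp_all add: mem_pvimage)
      then have "f x = f y"
        using H.Sgr_granD[OF X xy(2,4)] eq f_gran by metis
      then show "x = y"
        using f_inj_gran xy eq by blast
    qed
  qed (use \<alpha> pvimage_gcomponent in auto)
qed

text \<open>Star-surjectivity gives the nontrivial inclusion: if \<open>z\<close> is mapped to a
  product of \<open>x\<close> and \<open>y\<close>, lift \<open>y\<close> to an arrow
  \<open>b\<close> with the domain of \<open>z\<close>; then z b^-1 is a lift of
  \<open>x\<close>.\<close>

lemma pvimage_setprod:
  assumes X: "X \<in> carrier (Sgr \<Gamma> H)" and Y: "Y \<in> carrier (Sgr \<Gamma> H)"
  shows "pvimage \<phi> (H.setprod X Y) = G.setprod (pvimage \<phi> X) (pvimage \<phi> Y)"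
proof (intro equalityI subsetI)
  fix z assume "z \<in> pvimage \<phi> (H.setprod X Y)"
  then have z: "z \<in> D" "f z \<in> H.setprod X Y"
    by (simp_all add: mem_pvimage)
  then obtain x y where xy: "f z = x \<bullet>\<^bsub>H\<^esub> y" "x \<in> X" "y \<in> Y" "gdom H x = gran H y"
    using H.setprodE by blast
  have C: "x \<in> carrier H" "y \<in> carrier H" "z \<in> carrier G"
    using X Y H.Sgr_closed xy z D_closed by auto
  have "gdom H y = f (gdom G z)"
    using f_gdom[OF z(1)] xy C by simp
  then obtain b where b: "b \<in> D" "gdom G b = gdom G z" "f b = y"
    using f_surj[of "gdom G z" y] z C by auto
  have bC: "b \<in> carrier G"
    using b D_closed by simp
  define a where "a = z \<bullet>\<^bsub>G\<^esub> ginv G b"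
  have zb: "gdom G z = gran G (ginv G b)"
    using b bC by simp
  then have a: "a \<in> D" "z = a \<bullet>\<^bsub>G\<^esub> b" "gdom G a = gran G b"
    using z b bC C D_gmult[of z "ginv G b"] by (simp_all add: a_def)
  have "f a = (x \<bullet>\<^bsub>H\<^esub> y) \<bullet>\<^bsub>H\<^esub> ginv H y"
    unfolding a_def using f_gmult[OF z(1) D_ginv[OF b(1)] zb] f_ginv[OF b(1)] xy b by simp
  then have "f a = x"
    using C xy by simp
  then show "z \<in> G.setprod (pvimage \<phi> X) (pvimage \<phi> Y)"
    unfolding a(2) using a b xy by (intro G.setprodI) (simp_all add: mem_pvimage)
next
  fix z assume "z \<in> G.setprod (pvimage \<phi> X) (pvimage \<phi> Y)"
  then obtain x y where xy: "z = x \<bullet>\<^bsub>G\<^esub> y" "x \<in> D" "f x \<in> X" "y \<in> D" "f y \<in> Y" "gdom G x = gran G y"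
    by (rule G.setprodE) (simp add: mem_pvimage)
  then have "f z = f x \<bullet>\<^bsub>H\<^esub> f y" "gdom H (f x) = gran H (f y)"
    using f_gmult f_gdom[of x] f_gran[of y] by simp_all
  then show "z \<in> pvimage \<phi> (H.setprod X Y)"
    using xy D_gmult H.setprodI by (simp add: mem_pvimage)
qed

lemma pvimage_idempotents:
  assumes "X \<in> idempotents (Sgr \<Gamma> H)"
  shows "pvimage \<phi> X \<in> idempotents (Sgr \<Gamma> G)"
proof (rule G.SG.idemI)
  have XQ: "X \<in> carrier (Sgr \<Gamma> H)" and XX: "H.setprod X X = X"
    using assms H.SG.idem_closed H.SG.idem_idem[OF assms] by simp_all
  then show "pvimage \<phi> X \<in> carrier (Sgr \<Gamma> G)"
    by (simp add: pvimage_Sgr)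
  show "pvimage \<phi> X \<cdot>\<^bsub>Sgr \<Gamma> G\<^esub> pvimage \<phi> X = pvimage \<phi> X"
    using pvimage_setprod[OF XQ XQ] XX by simp
qed

lemma pvimage_Un: "pvimage \<phi> (X \<union> Y) = pvimage \<phi> X \<union> pvimage \<phi> Y"
  and pvimage_Int: "pvimage \<phi> (X \<inter> Y) = pvimage \<phi> X \<inter> pvimage \<phi> Y"
  and pvimage_empty: "pvimage \<phi> {} = {}"
  by (auto simp: pvimage_def)

lemma Sgr_map_eq: "X \<in> carrier (Sgr \<Gamma> H) \<Longrightarrow> Sgr_map \<Gamma> H \<phi> X = pvimage \<phi> X"
  by (simp add: Sgr_map_def)

lemma Sgr_map_hom: "Sgr_map \<Gamma> H \<phi> \<in> GrIS_hom \<Gamma> (Sgr \<Gamma> H) (Sgr \<Gamma> G)"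
  unfolding GrIS_hom_def mem_Collect_eq
proof (intro conjI ballI allI impI)
  let ?F = "Sgr_map \<Gamma> H \<phi>"
  show "?F \<in> carrier (Sgr \<Gamma> H) \<rightarrow>\<^sub>E carrier (Sgr \<Gamma> G)"
    using pvimage_Sgr by (auto simp: Sgr_map_def)
  show "?F (X \<cdot>\<^bsub>Sgr \<Gamma> H\<^esub> Y) = ?F X \<cdot>\<^bsub>Sgr \<Gamma> G\<^esub> ?F Y"
    if "X \<in> carrier (Sgr \<Gamma> H)" "Y \<in> carrier (Sgr \<Gamma> H)" for X Y
    using that pvimage_setprod H.Sgr_setprod by (simp add: Sgr_map_eq)
  show "?F ` scomponent (Sgr \<Gamma> H) \<alpha> \<subseteq> scomponent (Sgr \<Gamma> G) \<alpha>" if \<alpha>: "\<alpha> \<in> carrier \<Gamma>" for \<alpha>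
  proof
    fix Y assume "Y \<in> ?F ` scomponent (Sgr \<Gamma> H) \<alpha>"
    then obtain X where "X \<in> carrier (Sgr \<Gamma> H)" "X \<subseteq> gcomponent H \<alpha>" "Y = pvimage \<phi> X"
      using \<alpha> by (auto simp: H.mem_scomponent_Sgr Sgr_map_eq)
    then show "Y \<in> scomponent (Sgr \<Gamma> G) \<alpha>"
      using \<alpha> pvimage_Sgr pvimage_gcomponent by (simp add: G.mem_scomponent_Sgr)
  qed
  show "?F (X \<sqinter>\<^bsub>nat_order (Sgr \<Gamma> H)\<^esub> Y) = ?F X \<sqinter>\<^bsub>nat_order (Sgr \<Gamma> G)\<^esub> ?F Y"
    if "X \<in> carrier (Sgr \<Gamma> H)" "Y \<in> carrier (Sgr \<Gamma> H)" for X Y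
    using that by (simp add: Sgr_map_eq H.meet_Sgr G.meet_Sgr H.Sgr_Int pvimage_Sgr pvimage_Int)
  have idem: "?F X = pvimage \<phi> X" if "X \<in> idempotents (Sgr \<Gamma> H)" for X
    using that by (intro Sgr_map_eq) simp
  show "join_pres (idem_order (Sgr \<Gamma> H)) (idem_order (Sgr \<Gamma> G)) ?F"
    unfolding join_pres_def using G.lattice_idem_order_Sgr H.lattice_idem_order_Sgr
    by (simp add: idem H.join_idem_order_Sgr G.join_idem_order_Sgr H.EQ_Un
        pvimage_idempotents pvimage_Un)
  show "meet_pres (idem_order (Sgr \<Gamma> H)) (idem_order (Sgr \<Gamma> G)) ?F"
    unfolding meet_pres_def using G.lattice_idem_order_Sgr H.lattice_idem_order_Sgr
    by (simp add: idem H.meet_idem_order_Sgr G.meet_idem_order_Sgr H.EQ_Int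
        pvimage_idempotents pvimage_Int)
  show "complement_in (idem_ideal (Sgr \<Gamma> G) (?F X)) (?F A) (?F B)"
    if X: "X \<in> idempotents (Sgr \<Gamma> H)" and AB: "complement_in (idem_ideal (Sgr \<Gamma> H) X) A B" for X A B
  proof -
    have *: "A \<in> idempotents (Sgr \<Gamma> H)" "B \<in> idempotents (Sgr \<Gamma> H)" "A \<inter> B = {}" "A \<union> B = X"
      using AB unfolding H.complement_Sgr_iff[OF X] by simp_all
    have "pvimage \<phi> A \<inter> pvimage \<phi> B = {}" "pvimage \<phi> A \<union> pvimage \<phi> B = pvimage \<phi> X"
      using pvimage_Int[of A B] pvimage_Un[of A B] pvimage_empty unfolding *(3,4) by simp_all
    then show ?thesis
      unfolding idem[OF X] idem[OF *(1)] idem[OF *(2)]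
        G.complement_Sgr_iff[OF pvimage_idempotents[OF X]]
      using * by (simp add: pvimage_idempotents)
  qed
qed

end

lemma GrGp_morphismI:
  "group \<Gamma> \<Longrightarrow> G \<in> GrGp_ob \<Gamma> \<Longrightarrow> H \<in> GrGp_ob \<Gamma> \<Longrightarrow> \<phi> \<in> GrGp_hom \<Gamma> G H \<Longrightarrow> GrGp_morphism G H \<Gamma> \<phi>"
  by (simp add: GrGp_morphism_def GrGp_morphism_axioms_def GrGp_ob_iff)

section \<open>Composition and isomorphisms of partial functors\<close>

lemma dom_map_comp: "dom (\<psi> \<circ>\<^sub>m \<phi>) = pvimage \<phi> (dom \<psi>)"
  by (auto simp: pvimage_def map_comp_def split: option.splits)

lemma the_map_comp: "x \<in> dom \<phi> \<Longrightarrow> the ((\<psi> \<circ>\<^sub>m \<phi>) x) = the (\<psi> (the (\<phi> x)))"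
  by (auto simp: map_comp_def)

lemma pvimage_map_comp: "pvimage (\<psi> \<circ>\<^sub>m \<phi>) K = pvimage \<phi> (pvimage \<psi> K)"
  by (auto simp: pvimage_def map_comp_def split: option.splits)

lemma GrGp_comp_hom:
  assumes \<phi>: "GrGp_morphism G H \<Gamma> \<phi>" and \<psi>: "GrGp_morphism H K \<Gamma> \<psi>"
  shows "\<psi> \<circ>\<^sub>m \<phi> \<in> GrGp_hom \<Gamma> G K"
proof -
  interpret p: GrGp_morphism G H \<Gamma> \<phi>
    by (rule \<phi>)
  interpret q: GrGp_morphism H K \<Gamma> \<psi>
    by (rule \<psi>)
  let ?c = "\<psi> \<circ>\<^sub>m \<phi>"
  have D: "x \<in> dom ?c \<longleftrightarrow> x \<in> dom \<phi> \<and> the (\<phi> x) \<in> dom \<psi>" for x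
    by (simp add: dom_map_comp pvimage_def)
  have f: "the (?c x) = the (\<psi> (the (\<phi> x)))" if "x \<in> dom ?c" for x
    using that D the_map_comp by metis
  have open_D: "openin (gtop G) (dom ?c)"
    unfolding dom_map_comp by (intro p.openin_pvimage q.open_D)
  have gd: "gdom G x \<in> dom ?c" "gran G x \<in> dom ?c" "ginv G x \<in> dom ?c" if "x \<in> dom ?c" for x
    using that by (simp_all add: D p.f_gdom p.f_gran p.f_ginv)
  have gm: "x \<bullet>\<^bsub>G\<^esub> y \<in> dom ?c"
    if "x \<in> dom ?c" "y \<in> dom ?c" "gdom G x = gran G y" for x y
    using that p.f_gdom[of x] p.f_gran[of y] by (simp add: D p.D_gmult p.f_gmult q.D_gmult)
  have fg: "the (?c (gdom G x)) = gdom K (the (?c x))" "the (?c (gran G x)) = gran K (the (?c x))"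
    if x: "x \<in> dom ?c" for x
    using x gd[OF x] by (simp_all add: f D p.f_gdom p.f_gran q.f_gdom q.f_gran)
  have fm: "the (?c (x \<bullet>\<^bsub>G\<^esub> y)) = the (?c x) \<bullet>\<^bsub>K\<^esub> the (?c y)"
    if xy: "x \<in> dom ?c" "y \<in> dom ?c" "gdom G x = gran G y" for x y
  proof -
    have D': "x \<in> dom \<phi>" "the (\<phi> x) \<in> dom \<psi>" "y \<in> dom \<phi>" "the (\<phi> y) \<in> dom \<psi>"
      using xy(1,2) D by simp_all
    then have "gdom H (the (\<phi> x)) = gran H (the (\<phi> y))"
      using xy(3) p.f_gdom[of x] p.f_gran[of y] by simp
    then show ?thesis
      unfolding f[OF gm[OF xy]] f[OF xy(1)] f[OF xy(2)]
      using D' xy(3) by (simp add: p.f_gmult q.f_gmult)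
  qed
  show ?thesis
    unfolding GrGp_hom_def mem_Collect_eq
  proof (intro conjI ballI)
    show "partial_functor G K ?c"
      unfolding partial_functor_def open_subgroupoid_def
    proof (intro conjI ballI impI)
      show "ran ?c \<subseteq> carrier K"
      proof
        fix z assume "z \<in> ran ?c"
        then obtain x where "?c x = Some z"
          by (auto simp: ran_def)
        then have x: "x \<in> dom ?c" and z: "z = the (?c x)"
          by auto
        show "z \<in> carrier K"
          unfolding z f[OF x] using x D by simp
      qed
    qed (use open_D gd gm fg fm in simp_all)
    show "star_injective G ?c"
      unfolding star_injective_def
    proof (intro ballI impI)
      fix x y assume xy: "x \<in> dom ?c" "y \<in> dom ?c" "?c x = ?c y \<and> gdom G x = gdom G y"
      have "the (?c x) = the (?c y)"
        using xy by simp
      then have "the (\<psi> (the (\<phi> x))) = the (\<psi> (the (\<phi> y)))"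
        unfolding f[OF xy(1)] f[OF xy(2)] .
      moreover have "gdom H (the (\<phi> x)) = gdom H (the (\<phi> y))"
        using xy D p.f_gdom by metis
      ultimately have "the (\<phi> x) = the (\<phi> y)"
        using xy D q.f_inj by blast
      then show "x = y"
        using xy D p.f_inj by blast
    qed
    show "star_surjective G K ?c"
      unfolding star_surjective_def
    proof (intro ballI impI)
      fix e y assume "e \<in> dom ?c \<inter> gunits G" and y: "y \<in> carrier K" "gdom K y = the (?c e)"
      then have e: "e \<in> dom ?c" "e \<in> dom \<phi>" "the (\<phi> e) \<in> dom \<psi>" "gdom G e = e"
        by (simp_all add: D)
      \<comment> \<open>Lifts are taken backwards, first along \<open>\<psi>\<close> and then along
        \<open>\<phi>\<close>.\<close>
      obtain b where b: "b \<in> dom \<psi>" "gdom H b = the (\<phi> e)" "the (\<psi> b) = y"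
      proof (rule q.f_surj[OF e(3) _ y(1)])
        show "gdom H (the (\<phi> e)) = the (\<phi> e)"
          using p.f_gdom[OF e(2)] e(4) by simp
        show "gdom K y = the (\<psi> (the (\<phi> e)))"
          using y(2) f[OF e(1)] by simp
      qed
      obtain a where "a \<in> dom \<phi>" "gdom G a = e" "the (\<phi> a) = b"
        by (rule p.f_surj[OF e(2,4) q.D_closed[OF b(1)] b(2)])
      then show "\<exists>x\<in>dom ?c. gdom G x = e \<and> the (?c x) = y"
        using b by (intro bexI[of _ a]) (simp_all add: D f)
    qed
    show "proper_partial G K ?c"
      unfolding proper_partial_def
    proof (intro conjI allI impI)
      show "continuous_map (subtopology (gtop G) (dom ?c)) (gtop K) (the \<circ> ?c)"
        unfolding continuous_map_def
      proof (intro conjI allI impI)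
        show "the \<circ> ?c \<in> topspace (subtopology (gtop G) (dom ?c)) \<rightarrow> topspace (gtop K)"
        proof
          fix x assume "x \<in> topspace (subtopology (gtop G) (dom ?c))"
          then have x: "x \<in> dom ?c"
            by (simp only: topspace_subtopology) blast
          show "(the \<circ> ?c) x \<in> topspace (gtop K)"
            unfolding comp_def f[OF x] using x D by simp
        qed
        fix U assume "openin (gtop K) U"
        then have "openin (gtop G) (pvimage ?c U)"
          unfolding pvimage_map_comp by (intro p.openin_pvimage q.openin_pvimage)
        moreover have "{x \<in> topspace (subtopology (gtop G) (dom ?c)). (the \<circ> ?c) x \<in> U}
            = pvimage ?c U"
          using openin_subset[OF open_D] by (auto simp: pvimage_def)
        ultimately show "openin (subtopology (gtop G) (dom ?c))
            {x \<in> topspace (subtopology (gtop G) (dom ?c)). (the \<circ> ?c) x \<in> U}"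
          using open_D by (simp add: openin_open_subtopology pvimage_def)
      qed
      show "compactin (gtop G) (pvimage ?c L)" if "compactin (gtop K) L" for L
        unfolding pvimage_map_comp using that by (intro p.compact q.compact)
    qed
    show "(the \<circ> ?c) ` (gcomponent G \<alpha> \<inter> dom ?c) \<subseteq> gcomponent K \<alpha>" if "\<alpha> \<in> carrier \<Gamma>" for \<alpha>
    proof (rule image_subsetI)
      fix x assume "x \<in> gcomponent G \<alpha> \<inter> dom ?c"
      then have x: "x \<in> gcomponent G \<alpha>" "x \<in> dom ?c"
        by blast+
      then show "(the \<circ> ?c) x \<in> gcomponent K \<alpha>"
        using f[OF x(2)] D[of x] p.f_gdeg[of x] q.f_gdeg[of "the (\<phi> x)"]
        by (simp add: gcomponent_def)
    qed
  qed
qed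

text \<open>Serves the identities, \<open>mu\<close> and the inverse of \<open>mu\<close>. The
  continuous inverse \<open>g\<close> supplies star-surjectivity, and also the compactness of
  preimages, since these are images under \<open>g\<close>.\<close>

lemma GrGp_total_hom:
  assumes G: "graded_ample_groupoid G \<Gamma>" and H: "graded_ample_groupoid H \<Gamma>"
    and homeo: "homeomorphic_maps (gtop G) (gtop H) f g"
    and f: "\<And>x. x \<in> carrier G \<Longrightarrow> f (gdom G x) = gdom H (f x)"
      "\<And>x. x \<in> carrier G \<Longrightarrow> f (gran G x) = gran H (f x)"
      "\<And>x y. (x, y) \<in> composable G \<Longrightarrow> f (x \<bullet>\<^bsub>G\<^esub> y) = f x \<bullet>\<^bsub>H\<^esub> f y"
      "\<And>x. x \<in> carrier G \<Longrightarrow> gdeg H (f x) = gdeg G x"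
  shows "(\<lambda>x. Some (f x)) |` carrier G \<in> GrGp_hom \<Gamma> G H"
proof -
  interpret G: graded_ample_groupoid G \<Gamma>
    by (rule G)
  interpret H: graded_ample_groupoid H \<Gamma>
    by (rule H)
  let ?f = "(\<lambda>x. Some (f x)) |` carrier G"
  have cont: "continuous_map (gtop G) (gtop H) f" "continuous_map (gtop H) (gtop G) g"
    and gf: "\<And>x. x \<in> carrier G \<Longrightarrow> g (f x) = x" and fg: "\<And>y. y \<in> carrier H \<Longrightarrow> f (g y) = y"
    using homeo unfolding homeomorphic_maps_def by simp_all
  have fC: "f x \<in> carrier H" if "x \<in> carrier G" for x
    using continuous_map_funspace[OF cont(1)] that by auto
  have gC: "g y \<in> carrier G" if "y \<in> carrier H" for y
    using continuous_map_funspace[OF cont(2)] that by auto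
  have dom: "dom ?f = carrier G"
    by auto
  have top: "subtopology (gtop G) (carrier G) = gtop G"
    using subtopology_topspace[of "gtop G"] by simp
  show ?thesis
    unfolding GrGp_hom_def mem_Collect_eq
  proof (intro conjI ballI)
    show "partial_functor G H ?f"
      unfolding partial_functor_def open_subgroupoid_def dom
    proof (intro conjI ballI impI)
      show "openin (gtop G) (carrier G)"
        using openin_topspace[of "gtop G"] by simp
      show "ran ?f \<subseteq> carrier H"
        using fC by (auto simp: ran_def restrict_map_def)
    qed (use f in simp_all)
    show "star_injective G ?f"
      unfolding star_injective_def dom using gf by (simp, metis)
    show "star_surjective G H ?f"
      unfolding star_surjective_def dom
    proof (intro ballI impI)
      fix e y assume "e \<in> carrier G \<inter> gunits G" and y: "y \<in> carrier H" "gdom H y = the (?f e)"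
      then have e: "e \<in> carrier G" "gdom H y = f e"
        by simp_all
      then have "f (gdom G (g y)) = f e"
        using f(1) gC fg y by simp
      then have "gdom G (g y) = e"
        using gf e gC y G.gdom_closed by metis
      then show "\<exists>x\<in>carrier G. gdom G x = e \<and> the (?f x) = y"
        using y gC fg by (intro bexI[of _ "g y"]) simp_all
    qed
    show "proper_partial G H ?f"
      unfolding proper_partial_def dom top
    proof (intro conjI allI impI)
      show "continuous_map (gtop G) (gtop H) (the \<circ> ?f)"
        using cont(1) by (rule continuous_map_eq) simp
      fix K assume K: "compactin (gtop H) K"
      then have KC: "K \<subseteq> carrier H"
        using compactin_subset_topspace by fastforce
      have "pvimage ?f K = g ` K"
      proof (intro equalityI subsetI)
        fix x assume "x \<in> pvimage ?f K"
        then have "x \<in> carrier G" "f x \<in> K"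
          by (auto simp: pvimage_def)
        then show "x \<in> g ` K"
          using gf by (metis imageI)
      next
        fix x assume "x \<in> g ` K"
        then show "x \<in> pvimage ?f K"
          using KC gC fg by (auto simp: pvimage_def dom)
      qed
      then show "compactin (gtop G) (pvimage ?f K)"
        using image_compactin[OF K cont(2)] by simp
    qed
    show "(the \<circ> ?f) ` (gcomponent G \<alpha> \<inter> dom ?f) \<subseteq> gcomponent H \<alpha>" if "\<alpha> \<in> carrier \<Gamma>" for \<alpha>
      unfolding dom using fC f(4) by (auto simp: gcomponent_def)
  qed
qed

lemma GrGp_total_iso:
  assumes G: "graded_ample_groupoid G \<Gamma>" and H: "graded_ample_groupoid H \<Gamma>"
    and homeo: "homeomorphic_maps (gtop G) (gtop H) f g"
    and f: "\<And>x. x \<in> carrier G \<Longrightarrow> f (gdom G x) = gdom H (f x)"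
      "\<And>x. x \<in> carrier G \<Longrightarrow> f (gran G x) = gran H (f x)"
      "\<And>x y. (x, y) \<in> composable G \<Longrightarrow> f (x \<bullet>\<^bsub>G\<^esub> y) = f x \<bullet>\<^bsub>H\<^esub> f y"
      "\<And>x. x \<in> carrier G \<Longrightarrow> gdeg H (f x) = gdeg G x"
  shows "GrGp_iso \<Gamma> G H ((\<lambda>x. Some (f x)) |` carrier G)"
proof -
  interpret G: graded_ample_groupoid G \<Gamma>
    by (rule G)
  interpret H: graded_ample_groupoid H \<Gamma>
    by (rule H)
  have cont: "continuous_map (gtop G) (gtop H) f" "continuous_map (gtop H) (gtop G) g"
    and gf: "\<And>x. x \<in> carrier G \<Longrightarrow> g (f x) = x" and fg: "\<And>y. y \<in> carrier H \<Longrightarrow> f (g y) = y"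
    using homeo unfolding homeomorphic_maps_def by simp_all
  have fC: "f x \<in> carrier H" if "x \<in> carrier G" for x
    using continuous_map_funspace[OF cont(1)] that by auto
  have gC: "g y \<in> carrier G" if "y \<in> carrier H" for y
    using continuous_map_funspace[OF cont(2)] that by auto
  \<comment> \<open>Each equation required of \<open>g\<close> is checked after applying
    \<open>f\<close>, where it reduces to the corresponding equation for \<open>f\<close>.\<close>
  have geq: "g y = x" if "x \<in> carrier G" "f x = y" for x y
    using that gf by blast
  have "(\<lambda>y. Some (g y)) |` carrier H \<in> GrGp_hom \<Gamma> H G"
  proof (rule GrGp_total_hom[OF H G])
    show "homeomorphic_maps (gtop H) (gtop G) g f"
      using homeo unfolding homeomorphic_maps_def by blast
    fix y assume y: "y \<in> carrier H"
    show "g (gdom H y) = gdom G (g y)"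
      by (rule geq) (use gC[OF y] in \<open>simp_all add: f(1)[OF gC[OF y]] fg[OF y]\<close>)
    show "g (gran H y) = gran G (g y)"
      by (rule geq) (use gC[OF y] in \<open>simp_all add: f(2)[OF gC[OF y]] fg[OF y]\<close>)
    show "gdeg G (g y) = gdeg H y"
      using f(4)[OF gC[OF y]] fg[OF y] by simp
  next
    fix y z assume yz: "(y, z) \<in> composable H"
    then have C: "y \<in> carrier H" "z \<in> carrier H" "gdom H y = gran H z"
      by simp_all
    have "gdom G (g y) = g (gdom H y)"
      by (rule geq[symmetric]) (use f(1)[OF gC[OF C(1)]] fg[OF C(1)] gC[OF C(1)] in simp_all)
    moreover have "gran G (g z) = g (gran H z)"
      by (rule geq[symmetric]) (use f(2)[OF gC[OF C(2)]] fg[OF C(2)] gC[OF C(2)] in simp_all)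
    ultimately have comp: "(g y, g z) \<in> composable G"
      using C gC by simp
    show "g (y \<bullet>\<^bsub>H\<^esub> z) = g y \<bullet>\<^bsub>G\<^esub> g z"
      by (rule geq) (use f(3)[OF comp] comp fg C in simp_all)
  qed
  moreover have "((\<lambda>y. Some (g y)) |` carrier H) \<circ>\<^sub>m ((\<lambda>x. Some (f x)) |` carrier G) = GrGp_id G"
    using gf fC by (auto simp: GrGp_id_def map_comp_def restrict_map_def fun_eq_iff)
  moreover have "((\<lambda>x. Some (f x)) |` carrier G) \<circ>\<^sub>m ((\<lambda>y. Some (g y)) |` carrier H) = GrGp_id H"
    using fg gC by (auto simp: GrGp_id_def map_comp_def restrict_map_def fun_eq_iff)
  ultimately show ?thesis
    unfolding GrGp_iso_def using GrGp_total_hom[OF G H homeo f] by blast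
qed

lemma GrGp_id_hom: "graded_ample_groupoid G \<Gamma> \<Longrightarrow> GrGp_id G \<in> GrGp_hom \<Gamma> G G"
  using GrGp_total_hom[of G \<Gamma> G "\<lambda>x. x" "\<lambda>x. x"]
  by (simp add: GrGp_id_def homeomorphic_maps_def)

section \<open>Morphisms of graded-Boolean inverse meet-semigroups\<close>

lemma (in graded_boolean_semigroup) lattice_idem_order: "lattice (idem_order S)"
  using boolean unfolding graded_boolean_def distributive_lattice_def by blast

lemma (in graded_boolean_semigroup) join_idem_order_closed:
  "e \<in> E \<Longrightarrow> f \<in> E \<Longrightarrow> e \<squnion>\<^bsub>idem_order S\<^esub> f \<in> E"
proof -
  interpret L: lattice "idem_order S"
    by (rule lattice_idem_order)
  show "e \<in> E \<Longrightarrow> f \<in> E \<Longrightarrow> e \<squnion>\<^bsub>idem_order S\<^esub> f \<in> E"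
    using L.join_closed[of e f] by simp
qed

locale GrIS_morphism =
  S: graded_boolean_semigroup S \<Gamma> + T: graded_boolean_semigroup T \<Gamma>
  for S :: "('s, 'c) graded_semigroup" and T :: "('t, 'c) graded_semigroup"
    and \<Gamma> :: "('c, 'm) monoid_scheme" +
  fixes \<phi> :: "'s \<Rightarrow> 't"
  assumes hom: "\<phi> \<in> GrIS_hom \<Gamma> S T"
begin

lemma PiE: "\<phi> \<in> carrier S \<rightarrow>\<^sub>E carrier T"
  and mult: "x \<in> carrier S \<Longrightarrow> y \<in> carrier S \<Longrightarrow> \<phi> (x \<cdot>\<^bsub>S\<^esub> y) = \<phi> x \<cdot>\<^bsub>T\<^esub> \<phi> y"
  and scomponent: "\<alpha> \<in> carrier \<Gamma> \<Longrightarrow> \<phi> ` scomponent S \<alpha> \<subseteq> scomponent T \<alpha>"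
  and meet: "x \<in> carrier S \<Longrightarrow> y \<in> carrier S \<Longrightarrow>
    \<phi> (x \<sqinter>\<^bsub>nat_order S\<^esub> y) = \<phi> x \<sqinter>\<^bsub>nat_order T\<^esub> \<phi> y"
  and join_pres: "join_pres (idem_order S) (idem_order T) \<phi>"
  and meet_pres: "meet_pres (idem_order S) (idem_order T) \<phi>"
  and complement: "f \<in> idempotents S \<Longrightarrow> complement_in (idem_ideal S f) e g \<Longrightarrow>
    complement_in (idem_ideal T (\<phi> f)) (\<phi> e) (\<phi> g)"
  using hom unfolding GrIS_hom_def mem_Collect_eq by blast+

lemma closed [simp, intro]: "x \<in> carrier S \<Longrightarrow> \<phi> x \<in> carrier T"
  using PiE by (rule PiE_mem)

lemma idem [simp, intro]: "e \<in> idempotents S \<Longrightarrow> \<phi> e \<in> idempotents T"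
  using mult[of e e] by (intro T.idemI) simp_all

text \<open>Multiplicativity alone would not give this. In the one-point ideal, zero is its own
  complement, so its image is an idempotent disjoint from itself.\<close>

lemma zero [simp]: "\<phi> (szero S) = szero T"
proof -
  have "complement_in (idem_ideal S (szero S)) (szero S) (szero S)"
    unfolding S.complement_iff[OF S.zero_idem] by simp
  then have "complement_in (idem_ideal T (\<phi> (szero S))) (\<phi> (szero S)) (\<phi> (szero S))"
    by (rule complement[OF S.zero_idem])
  then have "\<phi> (szero S) \<cdot>\<^bsub>T\<^esub> \<phi> (szero S) = szero T"
    unfolding T.complement_iff[OF idem[OF S.zero_idem]] by blast
  then show ?thesis
    using idem[OF S.zero_idem] by simp
qed

lemma mono: "x \<sqsubseteq>\<^bsub>nat_order S\<^esub> y \<Longrightarrow> y \<in> carrier S \<Longrightarrow> \<phi> x \<sqsubseteq>\<^bsub>nat_order T\<^esub> \<phi> y"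
  unfolding S.nle_iff T.nle_iff using mult idem by blast

lemma sinv: "x \<in> carrier S \<Longrightarrow> \<phi> (sinv S x) = sinv T (\<phi> x)"
proof -
  assume x: "x \<in> carrier S"
  have "\<phi> x \<cdot>\<^bsub>T\<^esub> (\<phi> (sinv S x) \<cdot>\<^bsub>T\<^esub> \<phi> x) = \<phi> x"
    "\<phi> (sinv S x) \<cdot>\<^bsub>T\<^esub> (\<phi> x \<cdot>\<^bsub>T\<^esub> \<phi> (sinv S x)) = \<phi> (sinv S x)"
    using x by (simp_all flip: mult)
  then show ?thesis
    using x by (intro T.sinv_eqI[symmetric]) simp_all
qed

lemma sdeg:
  assumes x: "x \<in> carrier S" "\<phi> x \<noteq> szero T"
  shows "sdeg T (\<phi> x) = sdeg S x"
proof -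
  have "x \<noteq> szero S"
    using x by auto
  then have "x \<in> scomponent S (sdeg S x)" "sdeg S x \<in> carrier \<Gamma>"
    using x S.sdeg_closed by (simp_all add: scomponent_def)
  then have "\<phi> x \<in> scomponent T (sdeg S x)"
    using scomponent by blast
  then show ?thesis
    using x by (simp add: scomponent_def)
qed

section \<open>Inverse images of ultrafilters\<close>

definition pre :: "'t set \<Rightarrow> 's set" where "pre X = {s \<in> carrier S. \<phi> s \<in> X}"

lemma mem_pre: "s \<in> pre X \<longleftrightarrow> s \<in> carrier S \<and> \<phi> s \<in> X"
  by (simp add: pre_def)

text \<open>\<open>uf_criterion\<close> applies because a morphism preserves complements and
  therefore differences: one of \<open>a\<close> and \<open>t \<cdot> g\<close> is mapped into
  \<open>X\<close>.\<close>

lemma pre_uf: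
  assumes X: "X \<in> ultrafilters T" and ne: "s \<in> pre X"
  shows "pre X \<in> ultrafilters S"
proof (rule S.uf_criterion)
  have fX: "T.filt X"
    using X T.uf_filt by simp
  show "S.filt (pre X)"
  proof (rule S.filtI)
    show "pre X \<subseteq> carrier S" "s \<in> pre X"
      using ne by (auto simp: mem_pre)
    show "szero S \<notin> pre X"
      using T.filt_not_zero[OF fX] by (simp add: mem_pre)
    show "y \<in> pre X" if "x \<in> pre X" "y \<in> carrier S" "x \<sqsubseteq>\<^bsub>nat_order S\<^esub> y" for x y
      using that T.filt_upward[OF fX, of "\<phi> x" "\<phi> y"] mono[of x y] by (simp add: mem_pre)
    show "\<exists>z\<in>pre X. z \<sqsubseteq>\<^bsub>nat_order S\<^esub> x \<and> z \<sqsubseteq>\<^bsub>nat_order S\<^esub> y"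
      if xy: "x \<in> pre X" "y \<in> pre X" for x y
    proof -
      have C: "x \<in> carrier S" "y \<in> carrier S" "\<phi> x \<in> X" "\<phi> y \<in> X"
        using xy by (simp_all add: mem_pre)
      then have "S.nmeet x y \<in> pre X"
        using T.filt_meet[OF fX C(3,4)] meet[OF C(1,2)] by (simp add: mem_pre)
      then show ?thesis
        using S.meet_left[OF C(1,2)] S.meet_right[OF C(1,2)] by blast
    qed
  qed
  fix t a assume t: "t \<in> pre X" and a: "a \<sqsubseteq>\<^bsub>nat_order S\<^esub> t" "a \<notin> pre X"
  have tC: "t \<in> carrier S" "\<phi> t \<in> X"
    using t by (simp_all add: mem_pre)
  have aC: "a \<in> carrier S"
    using S.le_closed[OF a(1) tC(1)] .
  let ?dt = "sinv S t \<cdot>\<^bsub>S\<^esub> t" and ?da = "sinv S a \<cdot>\<^bsub>S\<^esub> a"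
  obtain g where g: "complement_in (idem_ideal S ?dt) ?da g"
    using S.complement_exists[of ?dt ?da] S.le_dom_mono[OF a(1) tC(1)] tC aC by auto
  have gE: "g \<in> idempotents S"
    using g tC by (simp add: S.complement_iff)
  have "complement_in (idem_ideal T (\<phi> ?dt)) (\<phi> ?da) (\<phi> g)"
    using g tC by (intro complement) auto
  \<comment> \<open>Domain idempotents are sent to domain idempotents, so \<open>\<phi> g\<close>
    defines the difference of \<open>\<phi> t\<close> and \<open>\<phi> a\<close>.\<close>
  then have "complement_in (idem_ideal T (sinv T (\<phi> t) \<cdot>\<^bsub>T\<^esub> \<phi> t)) (sinv T (\<phi> a) \<cdot>\<^bsub>T\<^esub> \<phi> a) (\<phi> g)"
    using tC aC by (simp add: mult sinv)
  then have "\<phi> a \<in> X \<or> \<phi> t \<cdot>\<^bsub>T\<^esub> \<phi> g \<in> X"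
    by (rule T.uf_difference[OF X tC(2) mono[OF a(1) tC(1)]])
  then have "\<phi> (t \<cdot>\<^bsub>S\<^esub> g) \<in> X"
    using a(2) aC tC gE by (simp add: mem_pre mult)
  then have "t \<cdot>\<^bsub>S\<^esub> g \<in> pre X"
    using tC gE by (simp add: mem_pre)
  moreover have "S.nmeet a (t \<cdot>\<^bsub>S\<^esub> g) = szero S"
    using S.difference(2)[OF tC(1) a(1) g] .
  ultimately show "\<exists>c\<in>pre X. S.nmeet a c = szero S"
    by blast
qed

text \<open>By \<open>pre_uf\<close> the requirement that the preimage be an ultrafilter reduces to
  its being nonempty; in this form the domain is easily seen to be open.\<close>

lemma UG_map_eq:
  "UG_map S T \<phi> X = (if X \<in> ultrafilters T \<and> (\<exists>s. s \<in> pre X) then Some (pre X) else None)"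
proof -
  have "X \<in> ultrafilters T \<and> pre X \<in> ultrafilters S \<longleftrightarrow> X \<in> ultrafilters T \<and> (\<exists>s. s \<in> pre X)"
    using pre_uf S.uf_nonempty by blast
  then show ?thesis
    unfolding UG_map_def Let_def pre_def by simp
qed

abbreviation UD :: "'t set set" where "UD \<equiv> dom (UG_map S T \<phi>)"

lemma mem_UD: "X \<in> UD \<longleftrightarrow> X \<in> ultrafilters T \<and> (\<exists>s. s \<in> pre X)"
  by (auto simp: dom_def UG_map_eq)

lemma UG_map_the: "X \<in> UD \<Longrightarrow> the (UG_map S T \<phi> X) = pre X"
  unfolding mem_UD UG_map_eq by simp

lemma UD_uf: "X \<in> UD \<Longrightarrow> X \<in> ultrafilters T" and UD_pre: "X \<in> UD \<Longrightarrow> pre X \<in> ultrafilters S"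
  unfolding mem_UD using pre_uf by blast+

lemma UD_I: "X \<in> ultrafilters T \<Longrightarrow> s \<in> carrier S \<Longrightarrow> \<phi> s \<in> X \<Longrightarrow> X \<in> UD"
  unfolding mem_UD mem_pre by blast

lemma uf_at_UD: "s \<in> carrier S \<Longrightarrow> T.uf_at (\<phi> s) \<subseteq> UD"
proof
  fix X assume "s \<in> carrier S" "X \<in> T.uf_at (\<phi> s)"
  then show "X \<in> UD"
    unfolding T.mem_uf_at by (elim conjE) (rule UD_I)
qed

lemma openin_UD: "openin (gtop (UG T)) UD"
  unfolding T.openin_UG
proof
  fix X assume "X \<in> UD"
  then obtain s where s: "X \<in> ultrafilters T" "s \<in> carrier S" "\<phi> s \<in> X"
    unfolding mem_UD mem_pre by blast
  then show "\<exists>t. X \<in> T.uf_at t \<and> T.uf_at t \<subseteq> UD"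
    using uf_at_UD[OF s(2)] by (intro exI[of _ "\<phi> s"]) (simp add: T.mem_uf_at)
qed

lemma UD_ginv: "X \<in> UD \<Longrightarrow> ginv (UG T) X \<in> UD"
proof -
  assume X: "X \<in> UD"
  then obtain s where s: "s \<in> carrier S" "\<phi> s \<in> X"
    unfolding mem_UD mem_pre by blast
  show ?thesis
  proof (rule UD_I)
    show "ginv (UG T) X \<in> ultrafilters T"
      using T.uf_sinv_image[OF UD_uf[OF X]] by simp
    show "sinv S s \<in> carrier S" "\<phi> (sinv S s) \<in> ginv (UG T) X"
      using s sinv by auto
  qed
qed

lemma UD_gmult:
  assumes X: "X \<in> UD" and Y: "Y \<in> UD" and XY: "gdom (UG T) X = gran (UG T) Y"
  shows "X \<bullet>\<^bsub>UG T\<^esub> Y \<in> UD"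
proof -
  obtain s t where s: "s \<in> carrier S" "\<phi> s \<in> X" and t: "t \<in> carrier S" "\<phi> t \<in> Y"
    using X Y unfolding mem_UD mem_pre by blast
  show ?thesis
  proof (rule UD_I)
    show "X \<bullet>\<^bsub>UG T\<^esub> Y \<in> ultrafilters T"
      using T.UG.gmult_closed[OF _ _ XY] UD_uf[OF X] UD_uf[OF Y] by simp
    show "s \<cdot>\<^bsub>S\<^esub> t \<in> carrier S"
      using s t by simp
    have "\<phi> s \<cdot>\<^bsub>T\<^esub> \<phi> t \<in> X \<bullet>\<^bsub>UG T\<^esub> Y"
      using s t T.le_refl[of "\<phi> s \<cdot>\<^bsub>T\<^esub> \<phi> t"] unfolding T.mem_ufprod by blast
    then show "\<phi> (s \<cdot>\<^bsub>S\<^esub> t) \<in> X \<bullet>\<^bsub>UG T\<^esub> Y"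
      using s t mult by simp
  qed
qed

lemma UD_gdom: "X \<in> UD \<Longrightarrow> gdom (UG T) X \<in> UD"
  unfolding gdom_def using UD_gmult[OF UD_ginv] T.UG.gdom_ginv UD_uf by simp

lemma UD_gran: "X \<in> UD \<Longrightarrow> gran (UG T) X \<in> UD"
  unfolding gran_def using UD_gmult[OF _ UD_ginv] T.UG.gran_ginv UD_uf by simp

lemma pre_ginv:
  assumes X: "X \<in> UD"
  shows "pre (ginv (UG T) X) = ginv (UG S) (pre X)"
proof -
  have C: "X \<subseteq> carrier T" "pre X \<subseteq> carrier S"
    using T.uf_closed[OF UD_uf[OF X]] by (auto simp: mem_pre)
  have "s \<in> pre (ginv (UG T) X) \<longleftrightarrow> s \<in> ginv (UG S) (pre X)" if "s \<in> carrier S" for s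
    using that T.mem_sinv_image[OF C(1), of "\<phi> s"] S.mem_sinv_image[OF C(2), of s]
    by (simp add: mem_pre sinv)
  moreover have "ginv (UG S) (pre X) \<subseteq> carrier S" "pre (ginv (UG T) X) \<subseteq> carrier S"
    using C by (auto simp: mem_pre)
  ultimately show ?thesis
    by blast
qed

text \<open>In each of the following equations of ultrafilters one inclusion is evident, and
  maximality does the rest.\<close>

lemma pre_gdom:
  assumes X: "X \<in> UD"
  shows "pre (gdom (UG T) X) = gdom (UG S) (pre X)"
proof -
  have "gdom (UG S) (pre X) \<subseteq> pre (gdom (UG T) X)"
  proof
    fix s assume "s \<in> gdom (UG S) (pre X)"
    then obtain x where x: "s \<in> carrier S" "x \<in> pre X" "sinv S x \<cdot>\<^bsub>S\<^esub> x \<sqsubseteq>\<^bsub>nat_order S\<^esub> s"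
      using S.mem_dom_filt[OF S.uf_filt[OF UD_pre[OF X]]] by (auto simp: S.gdom_UG)
    then have xC: "x \<in> carrier S" "\<phi> x \<in> X"
      by (simp_all add: mem_pre)
    have "sinv T (\<phi> x) \<cdot>\<^bsub>T\<^esub> \<phi> x \<sqsubseteq>\<^bsub>nat_order T\<^esub> \<phi> s"
      using mono[OF x(3,1)] xC by (simp add: mult sinv)
    then have "\<phi> s \<in> gdom (UG T) X"
      using T.mem_dom_filt[OF T.uf_filt[OF UD_uf[OF X]]] x xC by (auto simp: T.gdom_UG)
    then show "s \<in> pre (gdom (UG T) X)"
      using x by (simp add: mem_pre)
  qed
  moreover have "gdom (UG S) (pre X) \<in> ultrafilters S"
    using UD_pre[OF X] S.UG.gdom_closed by simp
  ultimately show ?thesis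
    using S.uf_max[OF _ S.uf_filt[OF UD_pre[OF UD_gdom[OF X]]]] by blast
qed

lemma pre_gran:
  assumes X: "X \<in> UD"
  shows "pre (gran (UG T) X) = gran (UG S) (pre X)"
  using pre_gdom[OF UD_ginv[OF X]] pre_ginv[OF X] T.UG.gdom_ginv[of X] S.UG.gdom_ginv[of "pre X"]
    UD_uf[OF X] UD_pre[OF X] by simp

lemma pre_gmult:
  assumes X: "X \<in> UD" and Y: "Y \<in> UD" and XY: "gdom (UG T) X = gran (UG T) Y"
  shows "pre (X \<bullet>\<^bsub>UG T\<^esub> Y) = pre X \<bullet>\<^bsub>UG S\<^esub> pre Y"
proof -
  have "pre X \<bullet>\<^bsub>UG S\<^esub> pre Y \<subseteq> pre (X \<bullet>\<^bsub>UG T\<^esub> Y)"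
  proof
    fix s assume "s \<in> pre X \<bullet>\<^bsub>UG S\<^esub> pre Y"
    then obtain x y where x: "s \<in> carrier S" "x \<in> pre X" "y \<in> pre Y" "x \<cdot>\<^bsub>S\<^esub> y \<sqsubseteq>\<^bsub>nat_order S\<^esub> s"
      unfolding S.mem_ufprod by blast
    then have C: "x \<in> carrier S" "y \<in> carrier S" "\<phi> x \<in> X" "\<phi> y \<in> Y"
      by (simp_all add: mem_pre)
    have "\<phi> x \<cdot>\<^bsub>T\<^esub> \<phi> y \<sqsubseteq>\<^bsub>nat_order T\<^esub> \<phi> s"
      using mono[OF x(4,1)] C by (simp add: mult)
    then have "\<phi> s \<in> X \<bullet>\<^bsub>UG T\<^esub> Y"
      unfolding T.mem_ufprod using C x(1) by blast
    then show "s \<in> pre (X \<bullet>\<^bsub>UG T\<^esub> Y)"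
      using x by (simp add: mem_pre)
  qed
  moreover have "pre X \<bullet>\<^bsub>UG S\<^esub> pre Y \<in> ultrafilters S"
    using UD_pre[OF X] UD_pre[OF Y] S.UG.gmult_closed[of "pre X" "pre Y"] XY
      pre_gdom[OF X] pre_gran[OF Y] by simp
  ultimately show ?thesis
    using S.uf_max[OF _ S.uf_filt[OF UD_pre[OF UD_gmult[OF X Y XY]]]] by blast
qed

lemma continuous_pre: "continuous_map (subtopology (gtop (UG T)) UD) (gtop (UG S)) pre"
proof (rule S.continuous_map_into_UG)
  have top: "topspace (subtopology (gtop (UG T)) UD) = UD"
    using openin_subset[OF openin_UD] by auto
  fix X assume "X \<in> topspace (subtopology (gtop (UG T)) UD)"
  then have X: "X \<in> UD"
    unfolding top .
  then show "pre X \<in> ultrafilters S"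
    by (rule UD_pre)
  fix s assume s: "s \<in> pre X"
  have "openin (subtopology (gtop (UG T)) UD) (T.uf_at (\<phi> s))"
    using s uf_at_UD by (simp add: openin_open_subtopology openin_UD mem_pre)
  moreover have "X \<in> T.uf_at (\<phi> s)" "\<forall>Y\<in>T.uf_at (\<phi> s). s \<in> pre Y"
    using s UD_uf[OF X] by (auto simp: mem_pre T.mem_uf_at)
  ultimately show "\<exists>N. openin (subtopology (gtop (UG T)) UD) N \<and> X \<in> N \<and> (\<forall>Y\<in>N. s \<in> pre Y)"
    by blast
qed

text \<open>Cover \<open>K\<close> by finitely many \<open>S.uf_at s\<close>. The preimage lies in
  the union \<open>C\<close> of the corresponding \<open>T.uf_at (\<phi> s)\<close>, which is
  compact and contained in the domain, and by continuity it is closed in \<open>C\<close>.\<close>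

lemma compactin_pre:
  assumes K: "compactin (gtop (UG S)) K"
  shows "compactin (gtop (UG T)) (pvimage (UG_map S T \<phi>) K)"
proof -
  have K': "K \<subseteq> ultrafilters S"
    using compactin_subset_topspace[OF K] by simp
  have "\<exists>\<F>. finite \<F> \<and> \<F> \<subseteq> S.uf_at ` carrier S \<and> K \<subseteq> \<Union>\<F>"
  proof (rule compactinD[OF K])
    show "K \<subseteq> \<Union>(S.uf_at ` carrier S)"
    proof
      fix X assume "X \<in> K"
      then have X: "X \<in> ultrafilters S"
        using K' by blast
      then obtain s where "s \<in> X"
        using S.uf_nonempty by blast
      then show "X \<in> \<Union>(S.uf_at ` carrier S)"
        using X S.uf_closed[OF X] by (auto simp: S.mem_uf_at)
    qed
  qed auto
  then obtain A where A: "finite A" "A \<subseteq> carrier S" "K \<subseteq> \<Union>(S.uf_at ` A)"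
    by (metis finite_subset_image)
  define C where "C = \<Union>((\<lambda>s. T.uf_at (\<phi> s)) ` A)"
  have C: "compactin (gtop (UG T)) C"
    unfolding C_def using A T.compactin_uf_at by (intro compactin_Union) auto
  have CD: "C \<subseteq> UD"
    unfolding C_def using A uf_at_UD by blast
  have closed: "closedin (gtop (UG T)) C"
    using T.Hausdorff_space_UG C compactin_imp_closedin by blast
  have topC: "topspace (subtopology (gtop (UG T)) C) = C"
    using CD openin_subset[OF openin_UD] by auto
  have "continuous_map (subtopology (gtop (UG T)) C) (gtop (UG S)) pre"
    using continuous_pre CD by (rule continuous_map_from_subtopology_mono)
  moreover have "closedin (gtop (UG S)) K"
    using S.Hausdorff_space_UG K compactin_imp_closedin by blast
  ultimately have "closedin (subtopology (gtop (UG T)) C)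
      {X \<in> topspace (subtopology (gtop (UG T)) C). pre X \<in> K}"
    by (rule closedin_continuous_map_preimage)
  then have "closedin (gtop (UG T)) {X \<in> C. pre X \<in> K}"
    unfolding topC using closed by (simp add: closedin_closed_subtopology)
  then have "compactin (gtop (UG T)) {X \<in> C. pre X \<in> K}"
    by (rule closed_compactin[OF C, rotated]) blast
  moreover have "{X \<in> C. pre X \<in> K} = pvimage (UG_map S T \<phi>) K"
  proof (intro equalityI subsetI)
    fix X assume "X \<in> {X \<in> C. pre X \<in> K}"
    then have X: "X \<in> UD" "pre X \<in> K"
      using CD by blast+
    then show "X \<in> pvimage (UG_map S T \<phi>) K"
      unfolding pvimage_def mem_Collect_eq UG_map_the[OF X(1)] by (rule conjI)
  next
    fix X assume "X \<in> pvimage (UG_map S T \<phi>) K"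
    then have X: "X \<in> UD" "the (UG_map S T \<phi> X) \<in> K"
      unfolding pvimage_def by blast+
    then have "pre X \<in> K"
      unfolding UG_map_the[OF X(1)] by blast
    then obtain s where s: "s \<in> A" "s \<in> pre X"
      using A(3) by (auto simp: S.mem_uf_at)
    then have "X \<in> T.uf_at (\<phi> s)"
      using UD_uf[OF X(1)] by (simp add: T.mem_uf_at mem_pre)
    then show "X \<in> {X \<in> C. pre X \<in> K}"
      using s \<open>pre X \<in> K\<close> unfolding C_def by blast
  qed
  ultimately show ?thesis
    by simp
qed

lemma UG_map_hom: "UG_map S T \<phi> \<in> GrGp_hom \<Gamma> (UG T) (UG S)"
  unfolding GrGp_hom_def mem_Collect_eq
proof (intro conjI ballI)
  let ?U = "UG_map S T \<phi>"
  show "partial_functor (UG T) (UG S) ?U"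
    unfolding partial_functor_def open_subgroupoid_def
  proof (intro conjI ballI impI)
    show "ran ?U \<subseteq> carrier (UG S)"
    proof
      fix Y assume "Y \<in> ran ?U"
      then obtain X where "?U X = Some Y"
        by (auto simp: ran_def)
      then have X: "X \<in> UD" and Y: "Y = the (?U X)"
        by auto
      show "Y \<in> carrier (UG S)"
        unfolding Y UG_map_the[OF X] using UD_pre[OF X] by simp
    qed
    show "the (?U (X \<bullet>\<^bsub>UG T\<^esub> Y)) = the (?U X) \<bullet>\<^bsub>UG S\<^esub> the (?U Y)"
      if "X \<in> UD" "Y \<in> UD" "(X, Y) \<in> composable (UG T)" for X Y
    proof -
      have XY: "gdom (UG T) X = gran (UG T) Y"
        using that(3) by simp
      show ?thesis
        unfolding UG_map_the[OF that(1)] UG_map_the[OF that(2)]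
          UG_map_the[OF UD_gmult[OF that(1,2) XY]]
        by (rule pre_gmult[OF that(1,2) XY])
    qed
    show "X \<bullet>\<^bsub>UG T\<^esub> Y \<in> UD" if "X \<in> UD" "Y \<in> UD" "(X, Y) \<in> composable (UG T)" for X Y
      using that UD_gmult by simp
    fix X assume X: "X \<in> UD"
    show "the (?U (gdom (UG T) X)) = gdom (UG S) (the (?U X))"
      unfolding UG_map_the[OF X] UG_map_the[OF UD_gdom[OF X]] by (rule pre_gdom[OF X])
    show "the (?U (gran (UG T) X)) = gran (UG S) (the (?U X))"
      unfolding UG_map_the[OF X] UG_map_the[OF UD_gran[OF X]] by (rule pre_gran[OF X])
  qed (simp_all only: openin_UD UD_gdom UD_gran UD_ginv)
  show "star_injective (UG T) ?U"
    unfolding star_injective_def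
  proof (intro ballI impI)
    fix X Y assume XY: "X \<in> UD" "Y \<in> UD" and eq: "?U X = ?U Y \<and> gdom (UG T) X = gdom (UG T) Y"
    have "the (?U X) = the (?U Y)"
      using eq by simp
    then have "pre X = pre Y"
      unfolding UG_map_the[OF XY(1)] UG_map_the[OF XY(2)] .
    \<comment> \<open>The common preimage is nonempty, so \<open>X\<close> and \<open>Y\<close>
      share an element \<open>\<phi> s\<close>; having equal domains, they coincide.\<close>
    moreover obtain s where "s \<in> pre X"
      using XY unfolding mem_UD by blast
    ultimately have "\<phi> s \<in> X" "\<phi> s \<in> Y"
      unfolding pre_def by blast+
    then show "X = Y"
      using T.uf_eqI_dom[OF UD_uf[OF XY(1)] UD_uf[OF XY(2)]] eq by blast
  qed
  show "star_surjective (UG T) (UG S) ?U"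
    unfolding star_surjective_def
  proof (intro ballI impI)
    fix F Y assume "F \<in> UD \<inter> gunits (UG T)" and Y: "Y \<in> carrier (UG S)" "gdom (UG S) Y = the (?U F)"
    then have F: "F \<in> UD" "gdom (UG T) F = F"
      by (simp_all add: T.UG.gunits_iff)
    have Yuf: "Y \<in> ultrafilters S"
      using Y by simp
    obtain s where s: "s \<in> Y"
      using S.uf_nonempty[OF Yuf] ..
    have sC: "s \<in> carrier S"
      using S.uf_closed[OF Yuf s] .
    have "sinv S s \<cdot>\<^bsub>S\<^esub> s \<in> gdom (UG S) Y"
      using S.dom_mem_filt[OF S.uf_filt[OF Yuf] s] by (simp add: S.gdom_UG)
    then have "sinv T (\<phi> s) \<cdot>\<^bsub>T\<^esub> \<phi> s \<in> F"
      unfolding Y(2) UG_map_the[OF F(1)] using sC by (simp add: mem_pre mult sinv)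
    \<comment> \<open>The lift of \<open>Y\<close> at \<open>F\<close> is the arrow with domain
      \<open>F\<close> through \<open>\<phi> s\<close>, for any choice of
      \<open>s \<in> Y\<close>.\<close>
    note X = T.uf_at_dom[OF UD_uf[OF F(1)] closed[OF sC] this]
    let ?X = "T.translate (\<phi> s) F"
    have XD: "?X \<in> UD"
      using UD_I[OF X(1) sC X(2)] .
    have "pre ?X = Y"
    proof (rule S.uf_eqI_dom)
      show "s \<in> pre ?X"
        using X(2) sC by (simp add: mem_pre)
      show "gdom (UG S) (pre ?X) = gdom (UG S) Y"
        unfolding pre_gdom[OF XD, symmetric] X(3) Y(2) UG_map_the[OF F(1)] ..
    qed (use UD_pre[OF XD] Yuf s in simp_all)
    then show "\<exists>X\<in>UD. gdom (UG T) X = F \<and> the (?U X) = Y"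
      using XD X(3) UG_map_the[OF XD] by blast
  qed
  show "proper_partial (UG T) (UG S) ?U"
    unfolding proper_partial_def
  proof (intro conjI allI impI)
    show "continuous_map (subtopology (gtop (UG T)) UD) (gtop (UG S)) (the \<circ> ?U)"
      using continuous_pre by (rule continuous_map_eq) (simp add: UG_map_the)
  qed (rule compactin_pre)
  show "(the \<circ> ?U) ` (gcomponent (UG T) \<alpha> \<inter> UD) \<subseteq> gcomponent (UG S) \<alpha>" if "\<alpha> \<in> carrier \<Gamma>" for \<alpha>
  proof (rule image_subsetI)
    fix X assume "X \<in> gcomponent (UG T) \<alpha> \<inter> UD"
    then have X: "X \<in> UD" "gdeg (UG T) X = \<alpha>"
      by (auto simp: gcomponent_def)
    obtain s where s: "s \<in> pre X"
      using X(1) unfolding mem_UD by blast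
    then have sC: "s \<in> carrier S" "\<phi> s \<in> X"
      by (simp_all add: mem_pre)
    have "gdeg (UG S) (pre X) = sdeg T (\<phi> s)"
      using S.gdeg_UG[OF UD_pre[OF X(1)] s] sdeg[OF sC(1)]
        T.uf_nonzero[OF UD_uf[OF X(1)] sC(2)] by simp
    then have "gdeg (UG S) (pre X) = \<alpha>"
      using T.gdeg_UG[OF UD_uf[OF X(1)] sC(2)] X(2) by simp
    then show "(the \<circ> ?U) X \<in> gcomponent (UG S) \<alpha>"
      unfolding comp_def UG_map_the[OF X(1)] gcomponent_def using UD_pre[OF X(1)] by simp
  qed
qed

end

section \<open>Composition and isomorphisms of semigroup morphisms\<close>

lemma GrIS_morphismI:
  "group \<Gamma> \<Longrightarrow> S \<in> GrIS_ob \<Gamma> \<Longrightarrow> T \<in> GrIS_ob \<Gamma> \<Longrightarrow> \<phi> \<in> GrIS_hom \<Gamma> S T \<Longrightarrow> GrIS_morphism S T \<Gamma> \<phi>"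
  by (simp add: GrIS_morphism_def GrIS_morphism_axioms_def GrIS_ob_iff)

lemma GrIS_comp_hom:
  assumes \<phi>: "GrIS_morphism S T \<Gamma> \<phi>" and \<psi>: "GrIS_morphism T U \<Gamma> \<psi>"
  shows "GrIS_comp S \<psi> \<phi> \<in> GrIS_hom \<Gamma> S U"
proof -
  interpret p: GrIS_morphism S T \<Gamma> \<phi>
    by (rule \<phi>)
  interpret q: GrIS_morphism T U \<Gamma> \<psi>
    by (rule \<psi>)
  let ?c = "GrIS_comp S \<psi> \<phi>"
  have c: "?c x = \<psi> (\<phi> x)" if "x \<in> carrier S" for x
    using that by (simp add: GrIS_comp_def compose_def)
  have cE: "?c e = \<psi> (\<phi> e)" if "e \<in> idempotents S" for e
    using that by (intro c) simp
  show ?thesis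
    unfolding GrIS_hom_def mem_Collect_eq
  proof (intro conjI ballI allI impI)
    show "?c \<in> carrier S \<rightarrow>\<^sub>E carrier U"
      by (auto simp: GrIS_comp_def compose_def)
    show "?c (x \<cdot>\<^bsub>S\<^esub> y) = ?c x \<cdot>\<^bsub>U\<^esub> ?c y" if "x \<in> carrier S" "y \<in> carrier S" for x y
      using that by (simp add: c p.mult q.mult)
    show "?c ` scomponent S \<alpha> \<subseteq> scomponent U \<alpha>" if "\<alpha> \<in> carrier \<Gamma>" for \<alpha>
    proof (rule image_subsetI)
      fix x assume x: "x \<in> scomponent S \<alpha>"
      then have "x \<in> carrier S"
        by (auto simp: scomponent_def)
      then show "?c x \<in> scomponent U \<alpha>"
        using p.scomponent[OF that] q.scomponent[OF that] x by (simp add: c) blast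
    qed
    show "?c (x \<sqinter>\<^bsub>nat_order S\<^esub> y) = ?c x \<sqinter>\<^bsub>nat_order U\<^esub> ?c y"
      if "x \<in> carrier S" "y \<in> carrier S" for x y
      using that by (simp add: c p.meet q.meet)
    have "lattice (idem_order S)" "lattice (idem_order U)"
      by (rule p.S.lattice_idem_order q.T.lattice_idem_order)+
    moreover have "?c (e \<squnion>\<^bsub>idem_order S\<^esub> f) = ?c e \<squnion>\<^bsub>idem_order U\<^esub> ?c f"
      if ef: "e \<in> idempotents S" "f \<in> idempotents S" for e f
    proof -
      have "\<phi> (e \<squnion>\<^bsub>idem_order S\<^esub> f) = \<phi> e \<squnion>\<^bsub>idem_order T\<^esub> \<phi> f"
        using p.join_pres ef unfolding join_pres_def by simp
      moreover have "\<psi> (\<phi> e \<squnion>\<^bsub>idem_order T\<^esub> \<phi> f) = \<psi> (\<phi> e) \<squnion>\<^bsub>idem_order U\<^esub> \<psi> (\<phi> f)"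
        using q.join_pres p.idem[OF ef(1)] p.idem[OF ef(2)] unfolding join_pres_def by simp
      ultimately show ?thesis
        using cE[OF p.S.join_idem_order_closed[OF ef]] cE[OF ef(1)] cE[OF ef(2)] by simp
    qed
    moreover have "?c (e \<sqinter>\<^bsub>idem_order S\<^esub> f) = ?c e \<sqinter>\<^bsub>idem_order U\<^esub> ?c f"
      if ef: "e \<in> idempotents S" "f \<in> idempotents S" for e f
      using ef by (simp add: p.S.meet_idem_order q.T.meet_idem_order c p.mult q.mult)
    ultimately show "join_pres (idem_order S) (idem_order U) ?c"
        "meet_pres (idem_order S) (idem_order U) ?c"
      unfolding join_pres_def meet_pres_def by simp_all
    show "complement_in (idem_ideal U (?c f)) (?c e) (?c g)"
      if f: "f \<in> idempotents S" and eg: "complement_in (idem_ideal S f) e g" for f e g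
    proof -
      have "e \<in> idempotents S" "g \<in> idempotents S"
        using eg unfolding p.S.complement_iff[OF f] by blast+
      then show ?thesis
        using q.complement[OF p.idem[OF f] p.complement[OF f eg]] f by (simp add: cE)
    qed
  qed
qed

text \<open>The order, and with it everything a morphism has to preserve, is determined by the
  multiplication.\<close>

lemma GrIS_hom_bij:
  assumes S: "graded_boolean_semigroup S \<Gamma>" and T: "graded_boolean_semigroup T \<Gamma>"
    and ext: "\<phi> \<in> extensional (carrier S)" and bij: "bij_betw \<phi> (carrier S) (carrier T)"
    and mult: "\<And>x y. x \<in> carrier S \<Longrightarrow> y \<in> carrier S \<Longrightarrow> \<phi> (x \<cdot>\<^bsub>S\<^esub> y) = \<phi> x \<cdot>\<^bsub>T\<^esub> \<phi> y"
    and deg: "\<And>x. x \<in> carrier S \<Longrightarrow> x \<noteq> szero S \<Longrightarrow> sdeg T (\<phi> x) = sdeg S x"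
  shows "\<phi> \<in> GrIS_hom \<Gamma> S T"
proof -
  interpret S: graded_boolean_semigroup S \<Gamma>
    by (rule S)
  interpret T: graded_boolean_semigroup T \<Gamma>
    by (rule T)
  have C: "\<phi> x \<in> carrier T" if "x \<in> carrier S" for x
    using bij that by (rule bij_betw_apply)
  have inj: "\<phi> x = \<phi> y \<longleftrightarrow> x = y" if "x \<in> carrier S" "y \<in> carrier S" for x y
    using bij that by (auto simp: bij_betw_def inj_on_def)
  have surj: "\<exists>x\<in>carrier S. t = \<phi> x" if "t \<in> carrier T" for t
    using bij that by (auto simp: bij_betw_def)
  have idem: "\<phi> e \<in> T.E \<longleftrightarrow> e \<in> S.E" if "e \<in> carrier S" for e
  proof -
    have "\<phi> e \<in> T.E \<longleftrightarrow> \<phi> (e \<cdot>\<^bsub>S\<^esub> e) = \<phi> e"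
      by (simp only: idempotents_def mem_Collect_eq C[OF that] mult[OF that that] simp_thms)
    also have "\<dots> \<longleftrightarrow> e \<cdot>\<^bsub>S\<^esub> e = e"
      using that by (intro inj) auto
    also have "\<dots> \<longleftrightarrow> e \<in> S.E"
      by (simp only: idempotents_def mem_Collect_eq that simp_thms)
    finally show ?thesis .
  qed
  have surjE: "\<exists>e\<in>S.E. f = \<phi> e" if "f \<in> T.E" for f
  proof -
    obtain e where e: "e \<in> carrier S" "f = \<phi> e"
      using surj[of f] \<open>f \<in> T.E\<close> by blast
    then have "e \<in> S.E"
      using idem[OF e(1)] \<open>f \<in> T.E\<close> by blast
    then show ?thesis
      using e(2) by blast
  qed
  have idemC: "\<phi> e \<in> T.E" if "e \<in> S.E" for e
    using that idem by simp
  have le: "T.nle (\<phi> x) (\<phi> y) \<longleftrightarrow> S.nle x y" if "x \<in> carrier S" "y \<in> carrier S" for x y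
  proof
    assume "T.nle (\<phi> x) (\<phi> y)"
    then obtain f where f: "f \<in> T.E" "\<phi> x = \<phi> y \<cdot>\<^bsub>T\<^esub> f"
      unfolding T.nle_iff by blast
    then obtain e where e: "e \<in> S.E" "f = \<phi> e"
      using surjE by blast
    then have "\<phi> x = \<phi> (y \<cdot>\<^bsub>S\<^esub> e)"
      using f that mult[of y e] by simp
    then have "x = y \<cdot>\<^bsub>S\<^esub> e"
      using inj[of x "y \<cdot>\<^bsub>S\<^esub> e"] that e by simp
    then show "S.nle x y"
      unfolding S.nle_iff using e by blast
  next
    assume "S.nle x y"
    then obtain e where "e \<in> S.E" "x = y \<cdot>\<^bsub>S\<^esub> e"
      unfolding S.nle_iff by blast
    then show "T.nle (\<phi> x) (\<phi> y)"
      unfolding T.nle_iff using mult[of y e] that idemC by auto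
  qed
  \<comment> \<open>The zero goes to zero because it absorbs a preimage \<open>z\<close> of
    \<open>szero T\<close>.\<close>
  obtain z where z: "z \<in> carrier S" "szero T = \<phi> z"
    using surj[OF T.zero_closed] by blast
  have "\<phi> (szero S) = \<phi> (szero S \<cdot>\<^bsub>S\<^esub> z)"
    using z by simp
  also have "\<dots> = \<phi> (szero S) \<cdot>\<^bsub>T\<^esub> \<phi> z"
    using z by (intro mult) auto
  also have "\<dots> = szero T"
    unfolding z(2)[symmetric] by (intro T.zero_right C) auto
  finally have zero: "\<phi> (szero S) = szero T" .
  show ?thesis
    unfolding GrIS_hom_def mem_Collect_eq
  proof (intro conjI ballI allI impI)
    show "\<phi> \<in> carrier S \<rightarrow>\<^sub>E carrier T"
      using ext C by (simp add: PiE_def)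
    show "\<phi> (x \<cdot>\<^bsub>S\<^esub> y) = \<phi> x \<cdot>\<^bsub>T\<^esub> \<phi> y" if "x \<in> carrier S" "y \<in> carrier S" for x y
      using that by (rule mult)
    show "\<phi> ` scomponent S \<alpha> \<subseteq> scomponent T \<alpha>" for \<alpha>
      using zero C deg by (auto simp: scomponent_def)
    show "\<phi> (x \<sqinter>\<^bsub>nat_order S\<^esub> y) = \<phi> x \<sqinter>\<^bsub>nat_order T\<^esub> \<phi> y"
      if xy: "x \<in> carrier S" "y \<in> carrier S" for x y
    proof (rule partial_order.meet_eqI[OF T.partial_order_nat_order, symmetric])
      have "T.nle u (\<phi> (S.nmeet x y))" if u: "u \<in> carrier T" "T.nle u (\<phi> x)" "T.nle u (\<phi> y)" for u
      proof -
        obtain v where v: "v \<in> carrier S" "u = \<phi> v"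
          using surj[OF u(1)] by blast
        then show ?thesis
          using u xy le S.meet_greatest[of v x y] by simp
      qed
      then show "greatest (nat_order T) (\<phi> (S.nmeet x y)) (Lower (nat_order T) {\<phi> x, \<phi> y})"
        using xy C le by (subst greatest_Lower_pair_iff) simp_all
    qed
    have meet: "\<phi> (e \<sqinter>\<^bsub>idem_order S\<^esub> f) = \<phi> e \<sqinter>\<^bsub>idem_order T\<^esub> \<phi> f"
      if "e \<in> S.E" "f \<in> S.E" for e f
      using that idemC by (simp add: S.meet_idem_order T.meet_idem_order mult)
    have join: "\<phi> (e \<squnion>\<^bsub>idem_order S\<^esub> f) = \<phi> e \<squnion>\<^bsub>idem_order T\<^esub> \<phi> f"
      if ef: "e \<in> S.E" "f \<in> S.E" for e f
    proof (rule partial_order.join_eqI[OF T.partial_order_idem_order, symmetric])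
      interpret L: lattice "idem_order S"
        by (rule S.lattice_idem_order)
      let ?j = "e \<squnion>\<^bsub>idem_order S\<^esub> f"
      have j: "?j \<in> S.E" "S.nle e ?j" "S.nle f ?j"
        "\<And>u. u \<in> S.E \<Longrightarrow> S.nle e u \<Longrightarrow> S.nle f u \<Longrightarrow> S.nle ?j u"
        using S.join_idem_order_closed[OF ef] L.join_left[of e f] L.join_right[of e f]
          L.join_le[of e _ f] ef by simp_all
      have "T.nle (\<phi> ?j) u" if u: "u \<in> T.E" "T.nle (\<phi> e) u" "T.nle (\<phi> f) u" for u
      proof -
        obtain v where v: "v \<in> S.E" "u = \<phi> v"
          using surjE[OF u(1)] by blast
        then show ?thesis
          using u ef le j by simp
      qed
      then show "least (idem_order T) (\<phi> ?j) (Upper (idem_order T) {\<phi> e, \<phi> f})"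
        using ef j le idemC by (subst least_Upper_pair_iff) simp_all
    qed
    show "join_pres (idem_order S) (idem_order T) \<phi>" "meet_pres (idem_order S) (idem_order T) \<phi>"
      unfolding join_pres_def meet_pres_def
      using join meet S.lattice_idem_order T.lattice_idem_order by simp_all
    show "complement_in (idem_ideal T (\<phi> f)) (\<phi> e) (\<phi> g)"
      if f: "f \<in> S.E" and eg: "complement_in (idem_ideal S f) e g" for f e g
    proof -
      have *: "e \<in> S.E" "g \<in> S.E" "S.nle e f" "S.nle g f" "e \<cdot>\<^bsub>S\<^esub> g = szero S"
          and lub: "\<And>h. h \<in> S.E \<Longrightarrow> S.nle e h \<Longrightarrow> S.nle g h \<Longrightarrow> S.nle f h"
        using eg unfolding S.complement_iff[OF f] by blast+
      have "T.nle (\<phi> f) u" if u: "u \<in> T.E" "T.nle (\<phi> e) u" "T.nle (\<phi> g) u" for u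
      proof -
        obtain v where v: "v \<in> S.E" "u = \<phi> v"
          using surjE[OF u(1)] by blast
        then show ?thesis
          using u * f le lub by simp
      qed
      moreover have "\<phi> e \<cdot>\<^bsub>T\<^esub> \<phi> g = szero T"
        using mult[of e g] * zero by simp
      ultimately show ?thesis
        unfolding T.complement_iff[OF idemC[OF f]] using * f idemC le by simp
    qed
  qed
qed

text \<open>The set-theoretic inverse is again multiplicative and preserves degrees, so
  \<open>GrIS_hom_bij\<close> applies to it as well.\<close>

lemma GrIS_iso_bij:
  assumes S: "graded_boolean_semigroup S \<Gamma>" and T: "graded_boolean_semigroup T \<Gamma>"
    and ext: "\<phi> \<in> extensional (carrier S)" and bij: "bij_betw \<phi> (carrier S) (carrier T)"
    and mult: "\<And>x y. x \<in> carrier S \<Longrightarrow> y \<in> carrier S \<Longrightarrow> \<phi> (x \<cdot>\<^bsub>S\<^esub> y) = \<phi> x \<cdot>\<^bsub>T\<^esub> \<phi> y"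
    and deg: "\<And>x. x \<in> carrier S \<Longrightarrow> x \<noteq> szero S \<Longrightarrow> sdeg T (\<phi> x) = sdeg S x"
  shows "GrIS_iso \<Gamma> S T \<phi>"
proof -
  interpret S: graded_boolean_semigroup S \<Gamma>
    by (rule S)
  interpret T: graded_boolean_semigroup T \<Gamma>
    by (rule T)
  define \<psi> where "\<psi> = restrict (inv_into (carrier S) \<phi>) (carrier T)"
  have C: "\<phi> x \<in> carrier T" if "x \<in> carrier S" for x
    using bij that by (rule bij_betw_apply)
  have \<psi>C: "\<psi> y \<in> carrier S" "\<phi> (\<psi> y) = y" if "y \<in> carrier T" for y
    using bij that by (auto simp: \<psi>_def bij_betw_def inv_into_into f_inv_into_f)
  have \<psi>\<phi>: "\<psi> (\<phi> x) = x" if "x \<in> carrier S" for x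
    using bij that C by (simp add: \<psi>_def bij_betw_def inv_into_f_f)
  have hom: "\<phi> \<in> GrIS_hom \<Gamma> S T"
    using assms by (rule GrIS_hom_bij)
  then interpret GrIS_morphism S T \<Gamma> \<phi>
    by unfold_locales
  have "\<psi> \<in> GrIS_hom \<Gamma> T S"
  proof (rule GrIS_hom_bij[OF T S])
    show "\<psi> \<in> extensional (carrier T)"
      by (simp add: \<psi>_def)
    show "bij_betw \<psi> (carrier T) (carrier S)"
      using bij_betw_inv_into[OF bij] by (simp add: \<psi>_def bij_betw_def inj_on_def)
    show "\<psi> (x \<cdot>\<^bsub>T\<^esub> y) = \<psi> x \<cdot>\<^bsub>S\<^esub> \<psi> y" if "x \<in> carrier T" "y \<in> carrier T" for x y
      using \<psi>\<phi>[of "\<psi> x \<cdot>\<^bsub>S\<^esub> \<psi> y"] mult[of "\<psi> x" "\<psi> y"] \<psi>C that by simp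
    show "sdeg S (\<psi> x) = sdeg T x" if "x \<in> carrier T" "x \<noteq> szero T" for x
      using sdeg[of "\<psi> x"] \<psi>C that by simp
  qed
  moreover have "GrIS_comp S \<psi> \<phi> = GrIS_id S" "GrIS_comp T \<phi> \<psi> = GrIS_id T"
    using \<psi>\<phi> \<psi>C by (auto simp: GrIS_comp_def GrIS_id_def compose_def fun_eq_iff)
  ultimately show ?thesis
    unfolding GrIS_iso_def using hom by blast
qed

lemma GrIS_id_hom: "graded_boolean_semigroup S \<Gamma> \<Longrightarrow> GrIS_id S \<in> GrIS_hom \<Gamma> S S"
  by (rule GrIS_hom_bij)
    (auto simp: GrIS_id_def bij_betw_def inj_on_def graded_boolean_semigroup_def
      inv_semigroup.smult_closed)

section \<open>The unit of the duality on semigroups\<close>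

context graded_boolean_semigroup
begin

lemma graded_ample_groupoid_UG: "graded_ample_groupoid (UG S) \<Gamma>"
  using UG_in_GrGp_ob GrGp_ob_iff[OF group] by blast

interpretation UGA: graded_ample_groupoid "UG S" \<Gamma>
  by (rule graded_ample_groupoid_UG)

lemma uf_at_gcomponent: "s \<in> carrier S \<Longrightarrow> s \<noteq> \<zero> \<Longrightarrow> uf_at s \<subseteq> gcomponent (UG S) (sdeg S s)"
  using gdeg_UG by (auto simp: mem_uf_at gcomponent_def)

lemma uf_at_Sgr: "s \<in> carrier S \<Longrightarrow> uf_at s \<in> carrier (Sgr \<Gamma> (UG S))"
proof (cases "s = \<zero>")
  case True
  then show ?thesis
    using UGA.Sgr_empty uf_at_zero by simp
next
  case False
  assume s: "s \<in> carrier S"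
  show ?thesis
    by (rule UGA.SgrI[OF openin_uf_at compactin_uf_at[OF s] _ _ sdeg_closed[OF s False]
          uf_at_gcomponent[OF s False]]) (use slice_uf_at[of s] in \<open>simp_all add: slice_def\<close>)
qed

lemma nu_eq: "s \<in> carrier S \<Longrightarrow> nu S s = uf_at s"
  by (simp add: nu_def ultrafilters_at_def)

text \<open>A nonzero product would lie in some ultrafilter, which \<open>uf_at_mult\<close> factors
  into composable ultrafilters through \<open>s\<close> and \<open>t\<close>. In this way
  orthogonality of elements is read off from their slices.\<close>

lemma product_zeroI:
  assumes C: "s \<in> carrier S" "t \<in> carrier S"
    and no: "\<And>X Y. X \<in> uf_at s \<Longrightarrow> Y \<in> uf_at t \<Longrightarrow> gdom (UG S) X \<noteq> gran (UG S) Y"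
  shows "s \<cdot> t = \<zero>"
proof (rule ccontr)
  assume "s \<cdot> t \<noteq> \<zero>"
  then obtain Z where "Z \<in> ultrafilters S" "s \<cdot> t \<in> Z"
    using uf_containing[of "s \<cdot> t"] C by blast
  then have "Z \<in> uf_at (s \<cdot> t)"
    by (simp add: mem_uf_at)
  then show False
    unfolding uf_at_mult[OF C] using no by blast
qed

text \<open>Replacing \<open>s\<close> by the difference of \<open>s\<close> and its meet with \<open>t\<close> makes the pair orthogonal, so
  that a join exists.\<close>

lemma uf_at_Un:
  assumes C: "s \<in> carrier S" "t \<in> carrier S" and X: "X \<in> carrier (Sgr \<Gamma> (UG S))"
    and sub: "uf_at s \<subseteq> X" "uf_at t \<subseteq> X"
  shows "\<exists>j\<in>carrier S. uf_at j = uf_at s \<union> uf_at t"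
proof -
  obtain c where c: "c \<in> carrier S" "c \<preceq> s" "(s \<triangle> t) \<triangle> c = \<zero>"
      "\<And>Y. Y \<in> ultrafilters S \<Longrightarrow> s \<in> Y \<Longrightarrow> s \<triangle> t \<in> Y \<or> c \<in> Y"
    by (rule difference_exists[OF C(1) meet_left[OF C]]) blast
  have cs: "uf_at c \<subseteq> uf_at s"
    using uf_at_subset_iff[OF c(1) C(1)] c(2) by simp
  have Un: "uf_at s \<union> uf_at t = uf_at c \<union> uf_at t"
  proof -
    have "Y \<in> uf_at (s \<triangle> t) \<union> uf_at c" if "Y \<in> uf_at s" for Y
      using that c(4)[of Y] by (auto simp: mem_uf_at)
    then have "uf_at s \<subseteq> uf_at (s \<triangle> t) \<union> uf_at c"
      by blast
    moreover have "uf_at (s \<triangle> t) \<subseteq> uf_at t"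
      using uf_at_meet[OF C] by blast
    ultimately show ?thesis
      using cs by blast
  qed
  have disj: False if "Y \<in> uf_at c" "Y \<in> uf_at t" for Y
  proof -
    have "Y \<in> uf_at (s \<triangle> t)"
      using that cs uf_at_meet[OF C] by blast
    then show False
      using uf_disjoint[of Y "s \<triangle> t" c] uf_filt[of Y] c(3) that by (simp add: mem_uf_at)
  qed
  have inv: "ginv (UG S) Y \<in> uf_at x" if "x \<in> carrier S" "Y \<in> uf_at (\<iota> x)" for x Y
  proof -
    have Y: "Y \<in> ultrafilters S" "\<iota> x \<in> Y"
      using that by (simp_all add: mem_uf_at)
    then have "\<iota> (\<iota> x) \<in> \<iota> ` Y"
      by blast
    then show ?thesis
      using uf_sinv_image[OF Y(1)] that(1) by (simp add: mem_uf_at)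
  qed
  have XC: "Y \<in> X" if "Y \<in> uf_at c \<or> Y \<in> uf_at t" for Y
    using that sub cs by blast
  \<comment> \<open>If \<open>V\<close> and \<open>W\<close> were composable, the inverse of
    \<open>V\<close> and \<open>W\<close> would be members of \<open>X\<close> with the same range,
    so equal by injectivity on the slice \<open>X\<close>, although \<open>uf_at c\<close> and
    \<open>uf_at t\<close> are disjoint.\<close>
  have "\<iota> c \<cdot> t = \<zero>"
  proof (rule product_zeroI)
    fix V W assume V: "V \<in> uf_at (\<iota> c)" and W: "W \<in> uf_at t"
    have V': "V \<in> ultrafilters S"
      using V by (simp add: mem_uf_at)
    show "gdom (UG S) V \<noteq> gran (UG S) W"
    proof
      assume "gdom (UG S) V = gran (UG S) W"
      then have "gran (UG S) (ginv (UG S) V) = gran (UG S) W"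
        using UG.gran_ginv[of V] V' by simp
      then have "ginv (UG S) V = W"
        using UGA.Sgr_granD[OF X] XC inv[OF c(1) V] W by blast
      then show False
        using disj[of W] inv[OF c(1) V] W by simp
    qed
  qed (use c C in auto)
  moreover have "c \<cdot> \<iota> t = \<zero>"
  proof (rule product_zeroI)
    fix V W assume V: "V \<in> uf_at c" and W: "W \<in> uf_at (\<iota> t)"
    have W': "W \<in> ultrafilters S"
      using W by (simp add: mem_uf_at)
    show "gdom (UG S) V \<noteq> gran (UG S) W"
    proof
      assume "gdom (UG S) V = gran (UG S) W"
      then have "gdom (UG S) V = gdom (UG S) (ginv (UG S) W)"
        using UG.gdom_ginv[of W] W' by simp
      then have "V = ginv (UG S) W"
        using UGA.Sgr_gdomD[OF X] XC inv[OF C(2) W] V by blast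
      then show False
        using disj[of V] inv[OF C(2) W] V by simp
    qed
  qed (use c C in auto)
  ultimately have orth: "orthogonal_in S c t"
    by (simp add: orthogonal_in_def)
  \<comment> \<open>Joins are available within one degree only; homogeneity of \<open>X\<close> puts
    \<open>c\<close> and \<open>t\<close> into the same component.\<close>
  obtain \<alpha> where \<alpha>: "\<alpha> \<in> carrier \<Gamma>" "X \<subseteq> gcomponent (UG S) \<alpha>"
    using X unfolding UGA.mem_Sgr by blast
  have comp: "x \<in> scomponent S \<alpha>" if x: "x \<in> carrier S" "uf_at x \<subseteq> X" for x
  proof (cases "x = \<zero>")
    case False
    then obtain Y where Y: "Y \<in> ultrafilters S" "x \<in> Y"
      using uf_containing x by blast
    then have "Y \<in> gcomponent (UG S) \<alpha>"
      using x(2) \<alpha>(2) mem_uf_at by blast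
    then show ?thesis
      using gdeg_UG[OF Y] x(1) False by (simp add: scomponent_def gcomponent_def)
  qed (simp add: scomponent_def)
  have "c \<in> scomponent S \<alpha>" "t \<in> scomponent S \<alpha>"
    using comp[OF c(1)] comp[OF C(2)] cs sub by auto
  then obtain j where j: "least (nat_order S) j (Upper (nat_order S) {c, t})"
    using boolean orth \<alpha>(1) unfolding graded_boolean_def by blast
  then have jC: "j \<in> carrier S" "c \<preceq> j" "t \<preceq> j"
    using c(1) C(2) least_Upper_pair_iff[of c "nat_order S" t j] by simp_all
  have "Y \<in> uf_at c \<union> uf_at t" if "Y \<in> uf_at j" for Y
    using that uf_lub[OF j c(1) C(2), of Y] by (auto simp: mem_uf_at)
  then have "uf_at j \<subseteq> uf_at c \<union> uf_at t"
    by blast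
  moreover have "uf_at c \<subseteq> uf_at j" "uf_at t \<subseteq> uf_at j"
    using uf_at_subset_iff c(1) C(2) jC by simp_all
  ultimately show ?thesis
    using Un jC(1) by blast
qed

lemma Sgr_UG_surj:
  assumes X: "X \<in> carrier (Sgr \<Gamma> (UG S))"
  shows "\<exists>s\<in>carrier S. X = uf_at s"
proof -
  have cover: "X \<subseteq> \<Union>{uf_at s | s. s \<in> carrier S \<and> uf_at s \<subseteq> X}"
  proof
    fix Y assume Y: "Y \<in> X"
    then obtain s where s: "Y \<in> uf_at s" "uf_at s \<subseteq> X"
      using UGA.Sgr_open[OF X] unfolding openin_UG by blast
    then have "s \<in> carrier S"
      using uf_closed by (auto simp: mem_uf_at)
    then show "Y \<in> \<Union>{uf_at s | s. s \<in> carrier S \<and> uf_at s \<subseteq> X}"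
      using s by blast
  qed
  have "\<exists>\<F>. finite \<F> \<and> \<F> \<subseteq> {uf_at s | s. s \<in> carrier S \<and> uf_at s \<subseteq> X} \<and> X \<subseteq> \<Union>\<F>"
    by (rule compactinD[OF UGA.Sgr_compact[OF X] _ cover]) auto
  then obtain \<F> where \<F>: "finite \<F>" "\<F> \<subseteq> {uf_at s | s. s \<in> carrier S \<and> uf_at s \<subseteq> X}" "X \<subseteq> \<Union>\<F>"
    by blast
  \<comment> \<open>All members are kept inside \<open>X\<close>, since \<open>uf_at_Un\<close>
    joins only basic sets contained in a common homogeneous slice.\<close>
  have union: "\<exists>s\<in>carrier S. \<Union>\<F>' = uf_at s"
    if "finite \<F>'" "\<F>' \<subseteq> {uf_at s | s. s \<in> carrier S \<and> uf_at s \<subseteq> X}" for \<F>'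
    using that
  proof (induction \<F>' rule: finite_induct)
    case empty
    then show ?case
      using uf_at_zero by auto
  next
    case (insert A \<F>')
    then obtain t where t: "t \<in> carrier S" "\<Union>\<F>' = uf_at t"
      by blast
    obtain s where s: "s \<in> carrier S" "A = uf_at s" "uf_at s \<subseteq> X"
      using insert.prems by blast
    have "\<Union>\<F>' \<subseteq> X"
      using insert.prems by blast
    then obtain j where "j \<in> carrier S" "uf_at j = uf_at s \<union> uf_at t"
      using uf_at_Un[OF s(1) t(1) X s(3)] t(2) by auto
    then show ?case
      using s t by (intro bexI[of _ j]) auto
  qed
  obtain s where s: "s \<in> carrier S" "\<Union>\<F> = uf_at s"
    using union[OF \<F>(1,2)] by blast
  have "\<Union>\<F> \<subseteq> X"
    using \<F>(2) by blast
  then have "X = uf_at s"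
    using \<F>(3) s(2) by simp
  then show ?thesis
    using s(1) by blast
qed

lemma nu_iso: "GrIS_iso \<Gamma> S (Sgr \<Gamma> (UG S)) (nu S)"
proof (rule GrIS_iso_bij[OF graded_boolean_semigroup_axioms UGA.SG.graded_boolean_semigroup_axioms])
  show "nu S \<in> extensional (carrier S)"
    by (simp add: nu_def)
  show "bij_betw (nu S) (carrier S) (carrier (Sgr \<Gamma> (UG S)))"
    unfolding bij_betw_def
  proof (intro conjI inj_onI equalityI subsetI)
    fix s t assume st: "s \<in> carrier S" "t \<in> carrier S" "nu S s = nu S t"
    then have "uf_at s = uf_at t"
      by (simp add: nu_eq)
    then show "s = t"
      using st uf_at_subset_iff[of s t] uf_at_subset_iff[of t s] by (intro le_antisym) auto
  next
    fix X assume "X \<in> nu S ` carrier S"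
    then obtain s where s: "s \<in> carrier S" "X = nu S s"
      by blast
    show "X \<in> carrier (Sgr \<Gamma> (UG S))"
      unfolding s(2) nu_eq[OF s(1)] by (rule uf_at_Sgr[OF s(1)])
  next
    fix X assume "X \<in> carrier (Sgr \<Gamma> (UG S))"
    then obtain s where s: "s \<in> carrier S" "X = uf_at s"
      using Sgr_UG_surj by blast
    show "X \<in> nu S ` carrier S"
      unfolding s(2) nu_eq[OF s(1), symmetric] using s(1) by (rule imageI)
  qed
  show "nu S (s \<cdot> t) = nu S s \<cdot>\<^bsub>Sgr \<Gamma> (UG S)\<^esub> nu S t" if "s \<in> carrier S" "t \<in> carrier S" for s t
    using that uf_at_mult[OF that] by (simp add: nu_eq UGA.setprod_def)
  show "sdeg (Sgr \<Gamma> (UG S)) (nu S s) = sdeg S s" if s: "s \<in> carrier S" "s \<noteq> \<zero>" for s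
  proof -
    obtain Y where Y: "Y \<in> ultrafilters S" "s \<in> Y"
      using uf_containing s by blast
    then have "Y \<in> uf_at s"
      by (simp add: mem_uf_at)
    then show ?thesis
      using UGA.sdeg_Sgr_mem[OF uf_at_Sgr[OF s(1)]] gdeg_UG[OF Y] s(1) by (simp add: nu_eq)
  qed
qed

end

section \<open>The unit of the duality on groupoids\<close>

context graded_ample_groupoid
begin

definition point :: "'a \<Rightarrow> 'a set set" where "point x = {Y \<in> Q. x \<in> Y}"

lemma mem_point: "Y \<in> point x \<longleftrightarrow> Y \<in> Q \<and> x \<in> Y"
  by (simp add: point_def)

lemma point_nonempty: "x \<in> carrier G \<Longrightarrow> \<exists>Y. Y \<in> point x"
proof -
  assume x: "x \<in> carrier G"
  have "openin \<T> (carrier G)"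
    using openin_topspace[of \<T>] by simp
  then obtain K where "K \<in> Q" "x \<in> K"
    using x by (rule Sgr_base)
  then show ?thesis
    unfolding mem_point by blast
qed

text \<open>Suppose a larger filter contained some \<open>B\<close> missing \<open>x\<close>. As
  \<open>B\<close> is closed, a slice \<open>K\<close> through \<open>x\<close> avoids it; yet
  \<open>K\<close> and \<open>B\<close> would have a common lower bound in the filter, which could
  only be empty.\<close>

lemma point_uf:
  assumes x: "x \<in> carrier G"
  shows "point x \<in> ultrafilters (Sgr \<Gamma> G)"
proof (rule SG.ufI)
  obtain Y where Y: "Y \<in> point x"
    using point_nonempty[OF x] ..
  show "SG.filt (point x)"
  proof (rule SG.filtI[OF _ Y])
    show "point x \<subseteq> Q" "szero (Sgr \<Gamma> G) \<notin> point x"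
      by (auto simp: mem_point)
    show "B \<in> point x" if "A \<in> point x" "B \<in> Q" "A \<sqsubseteq>\<^bsub>nat_order (Sgr \<Gamma> G)\<^esub> B" for A B
      using that le_Sgr_iff[of A B] by (auto simp: mem_point)
    show "\<exists>C\<in>point x. C \<sqsubseteq>\<^bsub>nat_order (Sgr \<Gamma> G)\<^esub> A \<and> C \<sqsubseteq>\<^bsub>nat_order (Sgr \<Gamma> G)\<^esub> B"
      if "A \<in> point x" "B \<in> point x" for A B
      using that by (intro bexI[of _ "A \<inter> B"]) (simp_all add: mem_point le_Sgr_iff Sgr_Int)
  qed
  fix Z assume Z: "SG.filt Z" "point x \<subseteq> Z"
  show "Z \<subseteq> point x"
  proof
    fix B assume B: "B \<in> Z"
    then have BQ: "B \<in> Q"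
      using SG.filt_closed[OF Z(1)] by blast
    have "x \<in> B"
    proof (rule ccontr)
      assume "x \<notin> B"
      moreover have "openin \<T> (topspace \<T> - B)"
        using compactin_closedin[OF Sgr_compact[OF BQ]] by blast
      ultimately obtain K where K: "K \<in> Q" "x \<in> K" "K \<subseteq> topspace \<T> - B"
        using x Sgr_base[of "topspace \<T> - B" x] by auto
      then have "K \<in> Z"
        using Z(2) mem_point by blast
      then obtain C where C: "C \<in> Z" "C \<sqsubseteq>\<^bsub>nat_order (Sgr \<Gamma> G)\<^esub> K" "C \<sqsubseteq>\<^bsub>nat_order (Sgr \<Gamma> G)\<^esub> B"
        using SG.filt_directed[OF Z(1) _ B] by blast
      have CQ: "C \<in> Q"
        using SG.filt_closed[OF Z(1) C(1)] .
      have "C \<subseteq> K" "C \<subseteq> B"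
        using C(2,3) le_Sgr_iff[OF CQ K(1)] le_Sgr_iff[OF CQ BQ] by simp_all
      then have "C = {}"
        using K(3) by blast
      then show False
        using C(1) SG.filt_not_zero[OF Z(1)] by simp
    qed
    then show "B \<in> point x"
      using BQ by (simp add: mem_point)
  qed
qed

lemma filt_finite_lower_bound:
  assumes Z: "SG.filt Z" and "finite \<F>" "\<F> \<subseteq> Z"
  shows "\<exists>C\<in>Z. \<forall>A\<in>\<F>. C \<subseteq> A"
  using assms(2,3)
proof (induction \<F> rule: finite_induct)
  case empty
  then show ?case
    using SG.filt_nonempty[OF Z] by blast
next
  case (insert A \<F>)
  then obtain C where C: "C \<in> Z" "\<forall>A\<in>\<F>. C \<subseteq> A"
    by blast
  have A: "A \<in> Z"
    using insert.prems by blast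
  obtain B where B: "B \<in> Z" "B \<sqsubseteq>\<^bsub>nat_order (Sgr \<Gamma> G)\<^esub> A" "B \<sqsubseteq>\<^bsub>nat_order (Sgr \<Gamma> G)\<^esub> C"
    using SG.filt_directed[OF Z A C(1)] by blast
  then have "B \<subseteq> A" "B \<subseteq> C"
    using SG.filt_closed[OF Z] A C(1) le_Sgr_iff by blast+
  then show ?case
    using B(1) C(2) by blast
qed

lemma point_surj:
  assumes Z: "Z \<in> ultrafilters (Sgr \<Gamma> G)"
  shows "\<exists>x\<in>carrier G. Z = point x"
proof -
  have fZ: "SG.filt Z"
    using Z SG.uf_filt by simp
  have ZQ: "Z \<subseteq> Q"
    using SG.filt_closed[OF fZ] by blast
  obtain K where K: "K \<in> Z"
    using SG.filt_nonempty[OF fZ] ..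
  then have KQ: "K \<in> Q"
    using ZQ by blast
  \<comment> \<open>The members of \<open>Z\<close> are closed, and any finitely many of them
    together with \<open>K\<close> contain a member of \<open>Z\<close>, which is nonempty;
    compactness of \<open>K\<close> gives a point in all of them.\<close>
  have "K \<inter> \<Inter>Z \<noteq> {}"
  proof -
    have "\<forall>C\<in>Z. closedin \<T> C"
      using ZQ Sgr_compact compactin_closedin by blast
    moreover have "K \<inter> \<Inter>\<F> \<noteq> {}" if \<F>: "finite \<F>" "\<F> \<subseteq> Z" for \<F>
    proof -
      obtain C where C: "C \<in> Z" "\<forall>A\<in>insert K \<F>. C \<subseteq> A"
        using filt_finite_lower_bound[OF fZ, of "insert K \<F>"] \<F> K by auto
      then have "C \<noteq> {}"
        using SG.filt_not_zero[OF fZ] by auto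
      then show ?thesis
        using C(2) by blast
    qed
    ultimately show ?thesis
      using Sgr_compact[OF KQ] unfolding compactin_fip by blast
  qed
  then obtain x where x: "x \<in> K" "x \<in> \<Inter>Z"
    by blast
  have xC: "x \<in> carrier G"
    using Sgr_closed[OF KQ x(1)] .
  have "Z \<subseteq> point x"
    using ZQ x(2) unfolding point_def by blast
  then have "Z = point x"
    using SG.uf_max[OF Z SG.uf_filt[OF point_uf[OF xC]]] by simp
  then show ?thesis
    using xC by blast
qed

lemma point_inj: "inj_on point (carrier G)"
proof (rule inj_onI, rule ccontr)
  fix x y assume C: "x \<in> carrier G" "y \<in> carrier G" and eq: "point x = point y" and ne: "x \<noteq> y"
  obtain U V where UV: "openin \<T> U" "openin \<T> V" "x \<in> U" "y \<in> V" "disjnt U V"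
    using Hausdorff C ne unfolding Hausdorff_space_def topspace_eq by blast
  obtain K where K: "K \<in> Q" "x \<in> K" "K \<subseteq> U"
    using UV(1,3) by (rule Sgr_base)
  then have "K \<in> point y"
    unfolding eq[symmetric] mem_point by blast
  then show False
    using K(3) UV(4,5) by (auto simp: mem_point disjnt_iff)
qed

text \<open>Since \<open>point\<close> takes ultrafilters as values, it is enough that each
  generator of the left-hand side contains the unit \<open>d x\<close>.\<close>

lemma gdom_point:
  assumes x: "x \<in> carrier G"
  shows "gdom (UG (Sgr \<Gamma> G)) (point x) = point (d x)"
proof -
  have uf: "point x \<in> ultrafilters (Sgr \<Gamma> G)"
    using point_uf[OF x] .
  have "gdom (UG (Sgr \<Gamma> G)) (point x) \<subseteq> point (d x)"
  proof
    fix A assume "A \<in> gdom (UG (Sgr \<Gamma> G)) (point x)"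
    then obtain Y where A: "A \<in> Q" "Y \<in> point x"
        "sinv (Sgr \<Gamma> G) Y \<cdot>\<^bsub>Sgr \<Gamma> G\<^esub> Y \<sqsubseteq>\<^bsub>nat_order (Sgr \<Gamma> G)\<^esub> A"
      using SG.mem_dom_filt[OF SG.uf_filt[OF uf]] by (auto simp: SG.gdom_UG)
    then have Y: "Y \<in> Q" "x \<in> Y"
      by (simp_all add: mem_point)
    have "\<iota> ` Y \<odot> Y \<subseteq> A"
      using A(3) le_Sgr_iff[OF Sgr_setprod[OF Sgr_ginv[OF Y(1)] Y(1)] A(1)]
        sinv_Sgr[OF Y(1)] by simp
    moreover have "\<iota> x \<bullet> x \<in> \<iota> ` Y \<odot> Y"
      using Y x by (intro setprodI) auto
    ultimately show "A \<in> point (d x)"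
      using A(1) by (auto simp: mem_point)
  qed
  moreover have "gdom (UG (Sgr \<Gamma> G)) (point x) \<in> ultrafilters (Sgr \<Gamma> G)"
    using SG.UG.gdom_closed uf by simp
  ultimately show ?thesis
    using SG.uf_max[OF _ SG.uf_filt[OF point_uf[of "d x"]]] x by blast
qed

lemma ginv_point:
  assumes x: "x \<in> carrier G"
  shows "ginv (UG (Sgr \<Gamma> G)) (point x) = point (\<iota> x)"
proof -
  have "ginv (UG (Sgr \<Gamma> G)) (point x) \<subseteq> point (\<iota> x)"
  proof
    fix A assume "A \<in> ginv (UG (Sgr \<Gamma> G)) (point x)"
    then obtain Y where "Y \<in> Q" "x \<in> Y" "A = sinv (Sgr \<Gamma> G) Y"
      by (auto simp: mem_point)
    then show "A \<in> point (\<iota> x)"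
      using Sgr_ginv by (simp add: mem_point sinv_Sgr)
  qed
  moreover have "ginv (UG (Sgr \<Gamma> G)) (point x) \<in> ultrafilters (Sgr \<Gamma> G)"
    using SG.UG.ginv_closed point_uf[OF x] by simp
  ultimately show ?thesis
    using SG.uf_max[OF _ SG.uf_filt[OF point_uf[of "\<iota> x"]]] x by blast
qed

lemma gran_point: "x \<in> carrier G \<Longrightarrow> gran (UG (Sgr \<Gamma> G)) (point x) = point (r x)"
  using gdom_point[of "\<iota> x"] SG.UG.gdom_ginv[of "point x"] ginv_point[of x] point_uf[of x] by simp

lemma gmult_point:
  assumes C: "x \<in> carrier G" "y \<in> carrier G" "d x = r y"
  shows "point x \<bullet>\<^bsub>UG (Sgr \<Gamma> G)\<^esub> point y = point (x \<bullet> y)"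
proof -
  have "point x \<bullet>\<^bsub>UG (Sgr \<Gamma> G)\<^esub> point y \<subseteq> point (x \<bullet> y)"
  proof
    fix A assume "A \<in> point x \<bullet>\<^bsub>UG (Sgr \<Gamma> G)\<^esub> point y"
    then obtain X Y where A: "A \<in> Q" "X \<in> point x" "Y \<in> point y"
        "X \<cdot>\<^bsub>Sgr \<Gamma> G\<^esub> Y \<sqsubseteq>\<^bsub>nat_order (Sgr \<Gamma> G)\<^esub> A"
      unfolding SG.mem_ufprod by blast
    then have XY: "X \<in> Q" "x \<in> X" "Y \<in> Q" "y \<in> Y"
      by (simp_all add: mem_point)
    have "X \<odot> Y \<subseteq> A"
      using A(4) le_Sgr_iff[OF Sgr_setprod[OF XY(1,3)] A(1)] by simp
    then show "A \<in> point (x \<bullet> y)"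
      using A(1) setprodI[OF XY(2,4) C(3)] by (auto simp: mem_point)
  qed
  moreover have "point x \<bullet>\<^bsub>UG (Sgr \<Gamma> G)\<^esub> point y \<in> ultrafilters (Sgr \<Gamma> G)"
    using SG.UG.gmult_closed[of "point x" "point y"] point_uf C gdom_point gran_point by simp
  ultimately show ?thesis
    using SG.uf_max[OF _ SG.uf_filt[OF point_uf[of "x \<bullet> y"]]] C by blast
qed

lemma gdeg_point:
  assumes x: "x \<in> carrier G"
  shows "gdeg (UG (Sgr \<Gamma> G)) (point x) = gdeg G x"
proof -
  obtain Y where Y: "Y \<in> point x"
    using point_nonempty[OF x] ..
  have "gdeg (UG (Sgr \<Gamma> G)) (point x) = sdeg (Sgr \<Gamma> G) Y"
    using SG.gdeg_UG[OF point_uf[OF x] Y] .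
  also have "\<dots> = gdeg G x"
    using Y by (intro sdeg_Sgr_mem) (simp_all add: mem_point)
  finally show ?thesis .
qed

lemma homeomorphic_map_point: "homeomorphic_map \<T> (gtop (UG (Sgr \<Gamma> G))) point"
proof (rule bijective_open_imp_homeomorphic_map)
  show "continuous_map \<T> (gtop (UG (Sgr \<Gamma> G))) point"
  proof (rule SG.continuous_map_into_UG)
    fix x assume "x \<in> topspace \<T>"
    then show "point x \<in> ultrafilters (Sgr \<Gamma> G)"
      using point_uf by simp
    fix Y assume "Y \<in> point x"
    then show "\<exists>N. openin \<T> N \<and> x \<in> N \<and> (\<forall>y\<in>N. Y \<in> point y)"
      using Sgr_open by (intro exI[of _ Y]) (simp add: mem_point)
  qed
  show "open_map \<T> (gtop (UG (Sgr \<Gamma> G))) point"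
    unfolding open_map_def
  proof (intro allI impI)
    fix V assume V: "openin \<T> V"
    show "openin (gtop (UG (Sgr \<Gamma> G))) (point ` V)"
      unfolding SG.openin_UG
    proof
      fix Z assume "Z \<in> point ` V"
      then obtain x where x: "x \<in> V" "Z = point x"
        by blast
      obtain K where K: "K \<in> Q" "x \<in> K" "K \<subseteq> V"
        using V x(1) by (rule Sgr_base)
      \<comment> \<open>Every ultrafilter through \<open>K\<close> is the point of some
        \<open>w\<close>, necessarily in \<open>K\<close>, so the image of \<open>V\<close> contains
        a whole basic set.\<close>
      have "SG.uf_at K \<subseteq> point ` V"
      proof
        fix W assume "W \<in> SG.uf_at K"
        then have W: "W \<in> ultrafilters (Sgr \<Gamma> G)" "K \<in> W"
          by (simp_all add: SG.mem_uf_at)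
        then obtain w where "W = point w"
          using point_surj by blast
        then show "W \<in> point ` V"
          using W(2) K(3) mem_point by blast
      qed
      moreover have "Z \<in> SG.uf_at K"
        using x K point_uf open_closed[OF V x(1)] by (simp add: SG.mem_uf_at mem_point)
      ultimately show "\<exists>s. Z \<in> SG.uf_at s \<and> SG.uf_at s \<subseteq> point ` V"
        by blast
    qed
  qed
  show "point ` topspace \<T> = topspace (gtop (UG (Sgr \<Gamma> G)))"
    using point_uf point_surj by auto
  show "inj_on point (topspace \<T>)"
    using point_inj by simp
qed

lemma mu_eq: "mu \<Gamma> G = (\<lambda>x. Some (point x)) |` carrier G"
  by (simp add: mu_def point_def)

lemma mu_iso: "GrGp_iso \<Gamma> G (UG (Sgr \<Gamma> G)) (mu \<Gamma> G)"
proof -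
  obtain g where g: "homeomorphic_maps \<T> (gtop (UG (Sgr \<Gamma> G))) point g"
    using homeomorphic_map_point homeomorphic_map_maps by blast
  show ?thesis
    unfolding mu_eq
    by (rule GrGp_total_iso[OF graded_ample_groupoid_axioms SG.graded_ample_groupoid_UG g])
      (simp_all add: gdom_point gran_point gmult_point gdeg_point)
qed

lemma Sgr_map_id: "Sgr_map \<Gamma> G (GrGp_id G) = GrIS_id (Sgr \<Gamma> G)"
proof
  fix X
  have "pvimage (GrGp_id G) X = X" if "X \<in> Q"
    using Sgr_closed[OF that] by (auto simp: pvimage_def GrGp_id_def)
  then show "Sgr_map \<Gamma> G (GrGp_id G) X = GrIS_id (Sgr \<Gamma> G) X"
    by (simp add: Sgr_map_def GrIS_id_def)
qed

end

section \<open>Functoriality and naturality\<close>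

lemma (in graded_boolean_semigroup) UG_map_id: "UG_map S S (GrIS_id S) = GrGp_id (UG S)"
proof
  fix X
  have "{s \<in> carrier S. GrIS_id S s \<in> X} = X" if "X \<in> ultrafilters S"
    using uf_closed[OF that] by (auto simp: GrIS_id_def)
  then show "UG_map S S (GrIS_id S) X = GrGp_id (UG S) X"
    by (simp add: UG_map_def GrGp_id_def restrict_map_def)
qed

context GrGp_morphism
begin

lemma Sgr_map_morphism: "GrIS_morphism (Sgr \<Gamma> H) (Sgr \<Gamma> G) \<Gamma> (Sgr_map \<Gamma> H \<phi>)"
  by (intro GrIS_morphism.intro GrIS_morphism_axioms.intro Sgr_map_hom
      G.SG.graded_boolean_semigroup_axioms H.SG.graded_boolean_semigroup_axioms)

text \<open>The two sides are undefined at the same arguments: outside the domain of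
  \<open>\<phi>\<close> no slice has a preimage containing \<open>x\<close>, so the ultrafilter at
  \<open>x\<close> has an empty preimage.\<close>

lemma mu_natural:
  "mu \<Gamma> H \<circ>\<^sub>m \<phi> = UG_map (Sgr \<Gamma> H) (Sgr \<Gamma> G) (Sgr_map \<Gamma> H \<phi>) \<circ>\<^sub>m mu \<Gamma> G"
proof
  interpret N: GrIS_morphism "Sgr \<Gamma> H" "Sgr \<Gamma> G" \<Gamma> "Sgr_map \<Gamma> H \<phi>"
    by (rule Sgr_map_morphism)
  let ?U = "UG_map (Sgr \<Gamma> H) (Sgr \<Gamma> G) (Sgr_map \<Gamma> H \<phi>)"
  fix x
  have pre: "N.pre (G.point x) = {X \<in> carrier (Sgr \<Gamma> H). x \<in> D \<and> f x \<in> X}"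
    using Sgr_map_eq pvimage_Sgr by (auto simp: N.mem_pre G.mem_point mem_pvimage)
  show "(mu \<Gamma> H \<circ>\<^sub>m \<phi>) x = (?U \<circ>\<^sub>m mu \<Gamma> G) x"
  proof (cases "x \<in> D")
    case True
    then have x: "x \<in> carrier G" "f x \<in> carrier H"
      using D_closed by simp_all
    have pt: "N.pre (G.point x) = H.point (f x)"
      using True pre by (simp add: H.point_def)
    have "\<phi> x = Some (f x)"
      using True by auto
    then have "(mu \<Gamma> H \<circ>\<^sub>m \<phi>) x = Some (H.point (f x))"
      using x by (simp add: H.mu_eq)
    moreover have "(?U \<circ>\<^sub>m mu \<Gamma> G) x = Some (H.point (f x))"
      using x G.point_uf[OF x(1)] H.point_nonempty[OF x(2)] pt by (simp add: G.mu_eq N.UG_map_eq)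
    ultimately show ?thesis
      by simp
  next
    case False
    then have "\<phi> x = None" "N.pre (G.point x) = {}"
      using pre by auto
    then show ?thesis
      by (cases "x \<in> carrier G") (simp_all add: G.mu_eq N.UG_map_eq)
  qed
qed

end

context GrIS_morphism
begin

text \<open>At \<open>s\<close> both sides consist of the ultrafilters \<open>X\<close> with
  \<open>\<phi> s \<in> X\<close>; such an \<open>X\<close> has a nonempty preimage and so lies in
  the domain of the dual functor.\<close>

lemma nu_natural:
  "GrIS_comp S (nu T) \<phi> = GrIS_comp S (Sgr_map \<Gamma> (UG S) (UG_map S T \<phi>)) (nu S)"
proof
  fix s
  have "nu T (\<phi> s) = Sgr_map \<Gamma> (UG S) (UG_map S T \<phi>) (nu S s)" if s: "s \<in> carrier S"
  proof -
    have "pvimage (UG_map S T \<phi>) (S.uf_at s) = T.uf_at (\<phi> s)"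
    proof (intro equalityI subsetI)
      fix X assume "X \<in> pvimage (UG_map S T \<phi>) (S.uf_at s)"
      then have X: "X \<in> UD" "the (UG_map S T \<phi> X) \<in> S.uf_at s"
        unfolding pvimage_def by blast+
      then have "s \<in> pre X"
        unfolding UG_map_the[OF X(1)] S.mem_uf_at by blast
      then show "X \<in> T.uf_at (\<phi> s)"
        using UD_uf[OF X(1)] by (simp add: mem_pre T.mem_uf_at)
    next
      fix X assume "X \<in> T.uf_at (\<phi> s)"
      then have X: "X \<in> ultrafilters T" "\<phi> s \<in> X"
        by (simp_all add: T.mem_uf_at)
      have XD: "X \<in> UD"
        using UD_I[OF X(1) s X(2)] .
      have "pre X \<in> S.uf_at s"
        using UD_pre[OF XD] s X(2) by (simp add: S.mem_uf_at mem_pre)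
      then show "X \<in> pvimage (UG_map S T \<phi>) (S.uf_at s)"
        unfolding pvimage_def mem_Collect_eq UG_map_the[OF XD] using XD by blast
    qed
    then show ?thesis
      using s S.uf_at_Sgr[OF s] T.nu_eq[OF closed[OF s]] by (simp add: S.nu_eq Sgr_map_def)
  qed
  then show "GrIS_comp S (nu T) \<phi> s = GrIS_comp S (Sgr_map \<Gamma> (UG S) (UG_map S T \<phi>)) (nu S) s"
    by (simp add: GrIS_comp_def compose_def)
qed

end

lemma Sgr_map_comp:
  assumes "GrGp_morphism G H \<Gamma> \<phi>" "GrGp_morphism H K \<Gamma> \<psi>"
  shows "Sgr_map \<Gamma> K (\<psi> \<circ>\<^sub>m \<phi>) = GrIS_comp (Sgr \<Gamma> K) (Sgr_map \<Gamma> H \<phi>) (Sgr_map \<Gamma> K \<psi>)"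
proof
  interpret q: GrGp_morphism H K \<Gamma> \<psi>
    by (rule assms(2))
  show "Sgr_map \<Gamma> K (\<psi> \<circ>\<^sub>m \<phi>) X = GrIS_comp (Sgr \<Gamma> K) (Sgr_map \<Gamma> H \<phi>) (Sgr_map \<Gamma> K \<psi>) X" for X
    using q.pvimage_Sgr[of X] by (simp add: Sgr_map_def GrIS_comp_def compose_def pvimage_map_comp)
qed

text \<open>Preimages compose, and the domains agree because a nonempty preimage along the composite
  forces a nonempty one along \<open>\<psi>\<close>.\<close>

lemma UG_map_comp:
  assumes \<phi>: "GrIS_morphism S T \<Gamma> \<phi>" and \<psi>: "GrIS_morphism T U \<Gamma> \<psi>"
  shows "UG_map S U (GrIS_comp S \<psi> \<phi>) = UG_map S T \<phi> \<circ>\<^sub>m UG_map T U \<psi>"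
proof
  interpret p: GrIS_morphism S T \<Gamma> \<phi>
    by (rule \<phi>)
  interpret q: GrIS_morphism T U \<Gamma> \<psi>
    by (rule \<psi>)
  interpret c: GrIS_morphism S U \<Gamma> "GrIS_comp S \<psi> \<phi>"
    using GrIS_comp_hom[OF \<phi> \<psi>] by unfold_locales
  fix X
  have pre: "c.pre X = p.pre (q.pre X)"
  proof (rule Set.set_eqI)
    show "s \<in> c.pre X \<longleftrightarrow> s \<in> p.pre (q.pre X)" for s
      unfolding c.mem_pre p.mem_pre q.mem_pre by (auto simp: GrIS_comp_def compose_def)
  qed
  have ne: "\<exists>t. t \<in> q.pre X" if "s \<in> p.pre (q.pre X)" for s
    using that p.mem_pre by blast
  show "UG_map S U (GrIS_comp S \<psi> \<phi>) X = (UG_map S T \<phi> \<circ>\<^sub>m UG_map T U \<psi>) X"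
  proof (cases "X \<in> ultrafilters U \<and> (\<exists>t. t \<in> q.pre X)")
    case True
    then have "q.pre X \<in> ultrafilters T"
      using q.pre_uf by blast
    then show ?thesis
      using True by (simp add: c.UG_map_eq p.UG_map_eq q.UG_map_eq pre)
  next
    case False
    then have "\<not> (X \<in> ultrafilters U \<and> (\<exists>s. s \<in> c.pre X))"
      unfolding pre using ne by blast
    then show ?thesis
      using False by (simp only: c.UG_map_eq q.UG_map_eq map_comp_def if_False option.case)
  qed
qed

section \<open>The laws of the two categories\<close>

lemma map_comp_GrGp_id:
  assumes "GrGp_morphism G H \<Gamma> \<phi>"
  shows "\<phi> \<circ>\<^sub>m GrGp_id G = \<phi>" "GrGp_id H \<circ>\<^sub>m \<phi> = \<phi>"
proof -
  interpret GrGp_morphism G H \<Gamma> \<phi>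
    by (rule assms)
  have "\<phi> x = None" if "x \<notin> carrier G" for x
    using that D_closed[of x] by auto
  then show "\<phi> \<circ>\<^sub>m GrGp_id G = \<phi>"
    by (auto simp: GrGp_id_def map_comp_def restrict_map_def fun_eq_iff)
  have "y \<in> carrier H" if "\<phi> x = Some y" for x y
    using that f_closed[of x] by auto
  then show "GrGp_id H \<circ>\<^sub>m \<phi> = \<phi>"
    by (auto simp: GrGp_id_def map_comp_def restrict_map_def fun_eq_iff split: option.splits)
qed

lemma map_comp_assoc: "(\<omega> \<circ>\<^sub>m \<psi>) \<circ>\<^sub>m \<phi> = \<omega> \<circ>\<^sub>m (\<psi> \<circ>\<^sub>m \<phi>)"
  by (auto simp: map_comp_def fun_eq_iff split: option.splits)

text \<open>Morphisms are extensional, so outside the carrier both sides take the default value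
  \<open>undefined\<close>.\<close>

lemma GrIS_comp_id:
  assumes "GrIS_morphism S T \<Gamma> \<phi>"
  shows "GrIS_comp S \<phi> (GrIS_id S) = \<phi>" "GrIS_comp S (GrIS_id T) \<phi> = \<phi>"
proof -
  interpret GrIS_morphism S T \<Gamma> \<phi>
    by (rule assms)
  have "\<phi> x = undefined" if "x \<notin> carrier S" for x
    using PiE that by (rule PiE_arb)
  then show "GrIS_comp S \<phi> (GrIS_id S) = \<phi>" "GrIS_comp S (GrIS_id T) \<phi> = \<phi>"
    by (auto simp: GrIS_comp_def GrIS_id_def compose_def fun_eq_iff)
qed

lemma GrIS_comp_assoc:
  assumes "GrIS_morphism S T \<Gamma> \<phi>"
  shows "GrIS_comp S (GrIS_comp T \<omega> \<psi>) \<phi> = GrIS_comp S \<omega> (GrIS_comp S \<psi> \<phi>)"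
proof -
  interpret GrIS_morphism S T \<Gamma> \<phi>
    by (rule assms)
  show ?thesis
    by (auto simp: GrIS_comp_def compose_def fun_eq_iff)
qed

text \<open>The objects in a law have separate type variables, so the instances at the types
  produced by \<open>Sgr\<close> and \<open>UG\<close> are included by instantiation.\<close>

theorem theorem5p13:
  fixes \<Gamma> :: "('c, 'm) monoid_scheme"
  assumes "group \<Gamma>"
  shows
    \<comment> \<open>the category of graded Hausdorff ample groupoids\<close>
    "(\<forall>G \<in> (GrGp_ob \<Gamma> :: ('a, 'c) graded_groupoid set). GrGp_id G \<in> GrGp_hom \<Gamma> G G) \<and>
     (\<forall>G \<in> (GrGp_ob \<Gamma> :: ('a, 'c) graded_groupoid set).
      \<forall>H \<in> (GrGp_ob \<Gamma> :: ('b, 'c) graded_groupoid set).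
      \<forall>\<phi>\<in>GrGp_hom \<Gamma> G H. \<phi> \<circ>\<^sub>m GrGp_id G = \<phi> \<and> GrGp_id H \<circ>\<^sub>m \<phi> = \<phi>) \<and>
     (\<forall>G \<in> (GrGp_ob \<Gamma> :: ('a, 'c) graded_groupoid set).
      \<forall>H \<in> (GrGp_ob \<Gamma> :: ('b, 'c) graded_groupoid set).
      \<forall>K \<in> (GrGp_ob \<Gamma> :: ('d, 'c) graded_groupoid set).
      \<forall>\<phi>\<in>GrGp_hom \<Gamma> G H. \<forall>\<psi>\<in>GrGp_hom \<Gamma> H K. \<psi> \<circ>\<^sub>m \<phi> \<in> GrGp_hom \<Gamma> G K) \<and>
     (\<forall>G \<in> (GrGp_ob \<Gamma> :: ('a, 'c) graded_groupoid set).
      \<forall>H \<in> (GrGp_ob \<Gamma> :: ('b, 'c) graded_groupoid set).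
      \<forall>K \<in> (GrGp_ob \<Gamma> :: ('d, 'c) graded_groupoid set).
      \<forall>L \<in> (GrGp_ob \<Gamma> :: ('e, 'c) graded_groupoid set).
      \<forall>\<phi>\<in>GrGp_hom \<Gamma> G H. \<forall>\<psi>\<in>GrGp_hom \<Gamma> H K. \<forall>\<omega>\<in>GrGp_hom \<Gamma> K L.
        (\<omega> \<circ>\<^sub>m \<psi>) \<circ>\<^sub>m \<phi> = \<omega> \<circ>\<^sub>m (\<psi> \<circ>\<^sub>m \<phi>)) \<and>

     \<comment> \<open>the category of graded-Boolean inverse meet-semigroups\<close>
     (\<forall>S \<in> (GrIS_ob \<Gamma> :: ('s, 'c) graded_semigroup set). GrIS_id S \<in> GrIS_hom \<Gamma> S S) \<and>
     (\<forall>S \<in> (GrIS_ob \<Gamma> :: ('s, 'c) graded_semigroup set).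
      \<forall>T \<in> (GrIS_ob \<Gamma> :: ('t, 'c) graded_semigroup set).
      \<forall>\<phi>\<in>GrIS_hom \<Gamma> S T.
        GrIS_comp S \<phi> (GrIS_id S) = \<phi> \<and> GrIS_comp S (GrIS_id T) \<phi> = \<phi>) \<and>
     (\<forall>S \<in> (GrIS_ob \<Gamma> :: ('s, 'c) graded_semigroup set).
      \<forall>T \<in> (GrIS_ob \<Gamma> :: ('t, 'c) graded_semigroup set).
      \<forall>U \<in> (GrIS_ob \<Gamma> :: ('u, 'c) graded_semigroup set).
      \<forall>\<phi>\<in>GrIS_hom \<Gamma> S T. \<forall>\<psi>\<in>GrIS_hom \<Gamma> T U. GrIS_comp S \<psi> \<phi> \<in> GrIS_hom \<Gamma> S U) \<and>
     (\<forall>S \<in> (GrIS_ob \<Gamma> :: ('s, 'c) graded_semigroup set).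
      \<forall>T \<in> (GrIS_ob \<Gamma> :: ('t, 'c) graded_semigroup set).
      \<forall>U \<in> (GrIS_ob \<Gamma> :: ('u, 'c) graded_semigroup set).
      \<forall>V \<in> (GrIS_ob \<Gamma> :: ('v, 'c) graded_semigroup set).
      \<forall>\<phi>\<in>GrIS_hom \<Gamma> S T. \<forall>\<psi>\<in>GrIS_hom \<Gamma> T U. \<forall>\<omega>\<in>GrIS_hom \<Gamma> U V.
        GrIS_comp S (GrIS_comp T \<omega> \<psi>) \<phi> = GrIS_comp S \<omega> (GrIS_comp S \<psi> \<phi>)) \<and>

     \<comment> \<open>(a) Sgr is a contravariant functor\<close>
     (\<forall>G \<in> (GrGp_ob \<Gamma> :: ('a, 'c) graded_groupoid set).
        Sgr \<Gamma> G \<in> GrIS_ob \<Gamma> \<and> Sgr_map \<Gamma> G (GrGp_id G) = GrIS_id (Sgr \<Gamma> G)) \<and>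
     (\<forall>G \<in> (GrGp_ob \<Gamma> :: ('a, 'c) graded_groupoid set).
      \<forall>H \<in> (GrGp_ob \<Gamma> :: ('b, 'c) graded_groupoid set).
      \<forall>\<phi>\<in>GrGp_hom \<Gamma> G H. Sgr_map \<Gamma> H \<phi> \<in> GrIS_hom \<Gamma> (Sgr \<Gamma> H) (Sgr \<Gamma> G)) \<and>
     (\<forall>G \<in> (GrGp_ob \<Gamma> :: ('a, 'c) graded_groupoid set).
      \<forall>H \<in> (GrGp_ob \<Gamma> :: ('b, 'c) graded_groupoid set).
      \<forall>K \<in> (GrGp_ob \<Gamma> :: ('d, 'c) graded_groupoid set).
      \<forall>\<phi>\<in>GrGp_hom \<Gamma> G H. \<forall>\<psi>\<in>GrGp_hom \<Gamma> H K.
        Sgr_map \<Gamma> K (\<psi> \<circ>\<^sub>m \<phi>) = GrIS_comp (Sgr \<Gamma> K) (Sgr_map \<Gamma> H \<phi>) (Sgr_map \<Gamma> K \<psi>)) \<and>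

     \<comment> \<open>(b) the ultrafilter groupoid is a contravariant functor\<close>
     (\<forall>S \<in> (GrIS_ob \<Gamma> :: ('s, 'c) graded_semigroup set).
        UG S \<in> GrGp_ob \<Gamma> \<and> UG_map S S (GrIS_id S) = GrGp_id (UG S)) \<and>
     (\<forall>S \<in> (GrIS_ob \<Gamma> :: ('s, 'c) graded_semigroup set).
      \<forall>T \<in> (GrIS_ob \<Gamma> :: ('t, 'c) graded_semigroup set).
      \<forall>\<phi>\<in>GrIS_hom \<Gamma> S T. UG_map S T \<phi> \<in> GrGp_hom \<Gamma> (UG T) (UG S)) \<and>
     (\<forall>S \<in> (GrIS_ob \<Gamma> :: ('s, 'c) graded_semigroup set).
      \<forall>T \<in> (GrIS_ob \<Gamma> :: ('t, 'c) graded_semigroup set).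
      \<forall>U \<in> (GrIS_ob \<Gamma> :: ('u, 'c) graded_semigroup set).
      \<forall>\<phi>\<in>GrIS_hom \<Gamma> S T. \<forall>\<psi>\<in>GrIS_hom \<Gamma> T U.
        UG_map S U (GrIS_comp S \<psi> \<phi>) = UG_map S T \<phi> \<circ>\<^sub>m UG_map T U \<psi>) \<and>

     \<comment> \<open>(c) mu is a natural isomorphism\<close>
     (\<forall>G \<in> (GrGp_ob \<Gamma> :: ('a, 'c) graded_groupoid set).
        GrGp_iso \<Gamma> G (UG (Sgr \<Gamma> G)) (mu \<Gamma> G)) \<and>
     (\<forall>G \<in> (GrGp_ob \<Gamma> :: ('a, 'c) graded_groupoid set).
      \<forall>H \<in> (GrGp_ob \<Gamma> :: ('b, 'c) graded_groupoid set).
      \<forall>\<phi>\<in>GrGp_hom \<Gamma> G H.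
        mu \<Gamma> H \<circ>\<^sub>m \<phi> = UG_map (Sgr \<Gamma> H) (Sgr \<Gamma> G) (Sgr_map \<Gamma> H \<phi>) \<circ>\<^sub>m mu \<Gamma> G) \<and>

     \<comment> \<open>(d) nu is a natural isomorphism\<close>
     (\<forall>S \<in> (GrIS_ob \<Gamma> :: ('s, 'c) graded_semigroup set).
        GrIS_iso \<Gamma> S (Sgr \<Gamma> (UG S)) (nu S)) \<and>
     (\<forall>S \<in> (GrIS_ob \<Gamma> :: ('s, 'c) graded_semigroup set).
      \<forall>T \<in> (GrIS_ob \<Gamma> :: ('t, 'c) graded_semigroup set).
      \<forall>\<phi>\<in>GrIS_hom \<Gamma> S T.
        GrIS_comp S (nu T) \<phi> = GrIS_comp S (Sgr_map \<Gamma> (UG S) (UG_map S T \<phi>)) (nu S))"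
proof -
  note gp = GrGp_ob_iff[OF assms, THEN iffD1]
  note sg = GrIS_ob_iff[OF assms, THEN iffD1]
  note gm = GrGp_morphismI[OF assms]
  note sm = GrIS_morphismI[OF assms]
  have Sgr: "Sgr \<Gamma> G \<in> GrIS_ob \<Gamma>" if "graded_ample_groupoid G \<Gamma>" for G :: "('x, 'c) graded_groupoid"
  proof -
    interpret graded_ample_groupoid G \<Gamma>
      by (rule that)
    show ?thesis
      using GrIS_ob_iff[OF assms] SG.graded_boolean_semigroup_axioms by blast
  qed
  show ?thesis
    \<comment> \<open>Splitting leaves one goal per law; each is matched by one of the rules, whose
      locale hypotheses have been turned into membership conditions by \<open>gp\<close>,
      \<open>sg\<close>, \<open>gm\<close> and \<open>sm\<close>.\<close>
    by (intro conjI ballI; rule GrGp_id_hom[OF gp] map_comp_GrGp_id[OF gm] GrGp_comp_hom[OF gm gm]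
        map_comp_assoc GrIS_id_hom[OF sg] GrIS_comp_id[OF sm] GrIS_comp_hom[OF sm sm]
        GrIS_comp_assoc[OF sm] Sgr[OF gp] graded_ample_groupoid.Sgr_map_id[OF gp]
        GrGp_morphism.Sgr_map_hom[OF gm] Sgr_map_comp[OF gm gm]
        graded_boolean_semigroup.UG_in_GrGp_ob[OF sg] graded_boolean_semigroup.UG_map_id[OF sg]
        GrIS_morphism.UG_map_hom[OF sm] UG_map_comp[OF sm sm]
        graded_ample_groupoid.mu_iso[OF gp] GrGp_morphism.mu_natural[OF gm]
        graded_boolean_semigroup.nu_iso[OF sg] GrIS_morphism.nu_natural[OF sm]; assumption)
qed

end
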